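(* Let $E\subset\mathbb{R}^2$ be a finite union of (images of) smooth curves, not necessarily connected, and let $\mu$ be the normalized arc-length measure $\mathcal{H}^1|_E/\mathcal{H}^1(E)$ on $E$. Suppose that $E$ contains a subset of one of the following types: (a) a closed polygonal curve, i.e. $\bigcup_{i=1}^N L_i$ where $N\ge 3$, $x_0,\dots,x_N=x_0$ are points of $\mathbb{R}^2$ with $x_{i-1}\neq x_i$, $L_i$ is the segment from $x_{i-1}$ to $x_i$, and $L_i\cap L_j$ is finite for $i\ne j$; (b) three segments $\{x_0+tv_k:t\in[0,1]\}$, $k=1,2,3$, starting at a common point $x_0$, where the non-zero vectors $v_1,v_2,v_3$ point in pairwise distinct directions (no $v_i$ is a positive multiple of $v_j$ for $i\neq j$); (c) the image of a smooth closed planar curve of positive curvature having only finitely many self-intersection points, all of them transverse. Then $\mu$ is not a tight-frame spectral measure.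
   Context: $\mathcal{H}^1$ is one-dimensional Hausdorff measure. Smooth curves are regular $C^\infty$ curves defined on compact intervals. A smooth closed curve is an infinitely differentiable $\gamma:[0,L]\to\mathbb{R}^2$, parametrized by arc length ($\|\gamma'\|\equiv1$), with $\gamma^{(n)}(0)=\gamma^{(n)}(L)$ for all $n\ge0$; the parameters $0$ and $L$ are identified. It has positive curvature if its curvature $\pm\|\gamma''(s)\|$ never vanishes. A self-intersection point is a point $x_0=\gamma(s)=\gamma(t)$ for some distinct parameters $s,t$; it is transverse if it has only finitely many preimages under $\gamma$ and $\gamma'(s),\gamma'(t)$ are not parallel for all distinct $s,t$ with $\gamma(s)=\gamma(t)=x_0$. A compactly supported Borel probability measure $\mu$ on $\mathbb{R}^d$ is a tight-frame spectral measure if there exist a countable set $\Lambda\subset\mathbb{R}^d$ and a constant $A>0$ such that $\sum_{\lambda\in\Lambda}\left|\int f(x)e^{-2\pi i\lambda\cdot x}\,d\mu(x)\right|^2=A\int |f|^2\,d\mu$ for all $f\in L^2(\mu)$. *)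

theory Defs
  imports "HOL-Analysis.Analysis"
begin

text \<open>Covers are sequences, so finite covers are padded with empty sets. Boundedness is required
  separately because \<^const>\<open>diameter\<close> is only meaningful for bounded sets.\<close>

definition hausdorff1_delta :: "real \<Rightarrow> 'a::metric_space set \<Rightarrow> ennreal" where
  "hausdorff1_delta d A =
     (INF U \<in> {U :: nat \<Rightarrow> 'a set. A \<subseteq> (\<Union>i. U i) \<and> (\<forall>i. bounded (U i) \<and> diameter (U i) \<le> d)}.
        \<Sum>i. ennreal (diameter (U i)))"

definition hausdorff1_outer :: "'a::metric_space set \<Rightarrow> ennreal" where
  "hausdorff1_outer A = (SUP d \<in> {0<..}. hausdorff1_delta d A)"

definition hausdorff1 :: "'a::metric_space measure" where
  "hausdorff1 = measure_of UNIV (sets borel) hausdorff1_outer"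

text \<open>Since \<^const>\<open>measure_of\<close> yields the zero measure when its argument is not countably additive,
  we verify that \<^const>\<open>hausdorff1_outer\<close> is indeed a measure on the Borel sets
  (Caratheodory's criterion).\<close>

lemma hausdorff1_delta_empty: "0 < d \<Longrightarrow> hausdorff1_delta d {} = 0"
proof -
  assume d: "0 < d"
  have "hausdorff1_delta d ({}::'a set) \<le> (\<Sum>i::nat. ennreal (diameter ({}::'a set)))"
    unfolding hausdorff1_delta_def
    by (rule INF_lower2[where i="\<lambda>_. {}"]) (use d in auto)
  then show ?thesis by simp
qed

lemma hausdorff1_delta_mono: "A \<subseteq> B \<Longrightarrow> hausdorff1_delta d A \<le> hausdorff1_delta d B"
  unfolding hausdorff1_delta_def by (rule INF_superset_mono) auto

lemma hausdorff1_delta_antimono: "d \<le> e \<Longrightarrow> hausdorff1_delta e A \<le> hausdorff1_delta d A"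
  unfolding hausdorff1_delta_def by (rule INF_superset_mono) (auto intro: order_trans)

lemma hausdorff1_delta_le_outer: "0 < d \<Longrightarrow> hausdorff1_delta d A \<le> hausdorff1_outer A"
  unfolding hausdorff1_outer_def by (rule SUP_upper) auto

lemma hausdorff1_delta_subadditive:
  fixes A :: "nat \<Rightarrow> 'a::metric_space set"
  shows "hausdorff1_delta d (\<Union>i. A i) \<le> (\<Sum>i. hausdorff1_delta d (A i))"
proof (rule ennreal_le_epsilon)
  fix e :: real
  assume fin: "(\<Sum>i. hausdorff1_delta d (A i)) < top" and e: "0 < e"
  have "\<exists>U. A n \<subseteq> (\<Union>i. U i) \<and> (\<forall>i. bounded (U i) \<and> diameter (U i) \<le> d) \<and>
          (\<Sum>i. ennreal (diameter (U i))) \<le> hausdorff1_delta d (A n) + ennreal (e * (1/2)^Suc n)" for n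
  proof -
    have "hausdorff1_delta d (A n) < top"
      using fin by (meson ennreal_suminf_lessD)
    then have "hausdorff1_delta d (A n) < hausdorff1_delta d (A n) + ennreal (e * (1/2)^Suc n)"
      using e by (auto simp: less_top ennreal_zero_less_mult_iff)
    then obtain U where "U \<in> {U :: nat \<Rightarrow> 'a set. A n \<subseteq> (\<Union>i. U i) \<and> (\<forall>i. bounded (U i) \<and> diameter (U i) \<le> d)}"
      "(\<Sum>i. ennreal (diameter (U i))) < hausdorff1_delta d (A n) + ennreal (e * (1/2)^Suc n)"
      by (subst (asm) (1) hausdorff1_delta_def, subst (asm) INF_less_iff) blast
    then show ?thesis by (auto intro!: exI[of _ U])
  qed
  then obtain U where U: "\<And>n. A n \<subseteq> (\<Union>i. U n i)" "\<And>n i. bounded (U n i)"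
      "\<And>n i. diameter (U n i) \<le> d"
      "\<And>n. (\<Sum>i. ennreal (diameter (U n i))) \<le> hausdorff1_delta d (A n) + ennreal (e * (1/2)^Suc n)"
    by metis
  define V where "V k = case_prod U (prod_decode k)" for k
  have "hausdorff1_delta d (\<Union>i. A i) \<le> (\<Sum>k. ennreal (diameter (V k)))"
    unfolding hausdorff1_delta_def
  proof (rule INF_lower, safe)
    fix x i assume "x \<in> A i"
    then obtain j where "x \<in> U i j" using U(1) by blast
    then have "x \<in> V (prod_encode (i,j))" by (simp add: V_def)
    then show "x \<in> (\<Union>k. V k)" by blast
  qed (auto simp: V_def U split: prod.split)
  also have "\<dots> = (\<Sum>n. \<Sum>i. ennreal (diameter (U n i)))"
    unfolding V_def
    by (rule suminf_ennreal_2dimen[where f="\<lambda>p. ennreal (diameter (case_prod U p))"]) simp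
  also have "\<dots> \<le> (\<Sum>n. hausdorff1_delta d (A n) + ennreal (e * (1/2)^Suc n))"
    by (intro suminf_le U) auto
  also have "\<dots> = (\<Sum>n. hausdorff1_delta d (A n)) + (\<Sum>n. ennreal (e * (1/2)^Suc n))"
    by (rule suminf_add[symmetric]) auto
  also have "(\<Sum>n. ennreal (e * (1/2)^Suc n)) = ennreal e"
    using sums_mult[OF power_half_series, of e] e
    by (intro suminf_ennreal_eq) auto
  finally show "hausdorff1_delta d (\<Union>i. A i) \<le> (\<Sum>i. hausdorff1_delta d (A i)) + ennreal e" .
qed

lemma hausdorff1_outer_countable_subadditive:
  "hausdorff1_outer (\<Union>i. A i) \<le> (\<Sum>i::nat. hausdorff1_outer (A i))"
  unfolding hausdorff1_outer_def[of "\<Union>i. A i"]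
  by (intro SUP_least order_trans[OF hausdorff1_delta_subadditive] suminf_le)
     (auto intro: hausdorff1_delta_le_outer)

lemma outer_measure_space_hausdorff1: "outer_measure_space (Pow UNIV) hausdorff1_outer"
  unfolding outer_measure_space_def
proof (intro conjI)
  show "positive (Pow UNIV) hausdorff1_outer"
    by (simp add: positive_def hausdorff1_outer_def hausdorff1_delta_empty)
  show "increasing (Pow UNIV) hausdorff1_outer"
    unfolding increasing_def hausdorff1_outer_def by (blast intro: SUP_mono hausdorff1_delta_mono)
  show "countably_subadditive (Pow UNIV) hausdorff1_outer"
    by (simp add: countably_subadditive_def hausdorff1_outer_countable_subadditive)
qed

lemma hausdorff1_outer_mono: "A \<subseteq> B \<Longrightarrow> hausdorff1_outer A \<le> hausdorff1_outer B"
  using outer_measure_space_hausdorff1 by (auto simp: outer_measure_space_def increasing_def)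

lemma hausdorff1_outer_empty: "hausdorff1_outer {} = 0"
  using outer_measure_space_hausdorff1 by (auto simp: outer_measure_space_def positive_def)

lemma hausdorff1_outer_subadditive:
  "hausdorff1_outer (A \<union> B) \<le> hausdorff1_outer A + hausdorff1_outer B"
proof -
  have "hausdorff1_outer (\<Union>i. binaryset A B i) \<le> (\<Sum>i. hausdorff1_outer (binaryset A B i))"
    by (rule hausdorff1_outer_countable_subadditive)
  also have "\<dots> = hausdorff1_outer A + hausdorff1_outer B"
    by (rule suminf_binaryset_eq) (rule hausdorff1_outer_empty)
  finally show ?thesis by (simp add: UN_binaryset_eq)
qed

lemma hausdorff1_delta_separated:
  fixes A B :: "'a::metric_space set"
  assumes "0 < d" "\<And>x y. x \<in> A \<Longrightarrow> y \<in> B \<Longrightarrow> d < dist x y"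
  shows "hausdorff1_delta d A + hausdorff1_delta d B \<le> hausdorff1_delta d (A \<union> B)"
  unfolding hausdorff1_delta_def[of d "A \<union> B"]
proof (rule INF_greatest, safe)
  fix U :: "nat \<Rightarrow> 'a set"
  assume U: "A \<union> B \<subseteq> (\<Union>i. U i)" "\<forall>i. bounded (U i) \<and> diameter (U i) \<le> d"
  define V where "V X i = (if U i \<inter> X \<noteq> {} then U i else {})" for X :: "'a set" and i
  have V: "hausdorff1_delta d X \<le> (\<Sum>i. ennreal (diameter (V X i)))" if "X \<subseteq> A \<union> B" for X
    unfolding hausdorff1_delta_def
  proof (rule INF_lower, safe)
    fix x assume "x \<in> X"
    with that U(1) obtain i where "x \<in> U i" by blast
    with \<open>x \<in> X\<close> have "x \<in> V X i" by (auto simp: V_def)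
    then show "x \<in> (\<Union>i. V X i)" by blast
  qed (use U(2) assms(1) in \<open>auto simp: V_def\<close>)
  have "hausdorff1_delta d A + hausdorff1_delta d B
      \<le> (\<Sum>i. ennreal (diameter (V A i))) + (\<Sum>i. ennreal (diameter (V B i)))"
    by (intro add_mono V) auto
  also have "\<dots> = (\<Sum>i. ennreal (diameter (V A i)) + ennreal (diameter (V B i)))"
    by (rule suminf_add) auto
  also have "\<dots> \<le> (\<Sum>i. ennreal (diameter (U i)))"
  proof (rule suminf_le)
    fix i
    have "U i \<inter> A = {} \<or> U i \<inter> B = {}"
    proof (rule ccontr)
      assume "\<not> ?thesis"
      then obtain x y where xy: "x \<in> U i" "x \<in> A" "y \<in> U i" "y \<in> B" by blast
      have "dist x y \<le> diameter (U i)" using U(2) xy by (simp add: diameter_bounded_bound)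
      moreover have "diameter (U i) \<le> d" using U(2) by blast
      moreover have "d < dist x y" using assms(2) xy by blast
      ultimately show False by linarith
    qed
    then show "ennreal (diameter (V A i)) + ennreal (diameter (V B i)) \<le> ennreal (diameter (U i))"
      by (auto simp: V_def)
  qed auto
  finally show "hausdorff1_delta d A + hausdorff1_delta d B \<le> (\<Sum>i. ennreal (diameter (U i)))" .
qed

lemma hausdorff1_outer_separated:
  fixes A B :: "'a::metric_space set"
  assumes r: "0 < r" "\<And>x y. x \<in> A \<Longrightarrow> y \<in> B \<Longrightarrow> r \<le> dist x y"
  shows "hausdorff1_outer A + hausdorff1_outer B \<le> hausdorff1_outer (A \<union> B)"
proof -
  have *: "hausdorff1_delta d A + hausdorff1_delta e B \<le> hausdorff1_outer (A \<union> B)"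
    if "0 < d" "0 < e" for d e
  proof -
    define m where "m = min (r/2) (min d e)"
    have m: "0 < m" "m \<le> d" "m \<le> e" "m < r" using that r(1) by (auto simp: m_def)
    have "hausdorff1_delta d A + hausdorff1_delta e B \<le> hausdorff1_delta m A + hausdorff1_delta m B"
      by (intro add_mono hausdorff1_delta_antimono m)
    also have "\<dots> \<le> hausdorff1_delta m (A \<union> B)"
      using m r(2) by (intro hausdorff1_delta_separated) (auto intro: less_le_trans)
    also have "\<dots> \<le> hausdorff1_outer (A \<union> B)"
      by (rule hausdorff1_delta_le_outer[OF m(1)])
    finally show ?thesis .
  qed
  have ne: "{0::real<..} \<noteq> {}" by (metis greaterThan_non_empty)
  have "hausdorff1_outer A + hausdorff1_outer B
      = (SUP e\<in>{0<..}. SUP d\<in>{0<..}. hausdorff1_delta d A + hausdorff1_delta e B)"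
    unfolding hausdorff1_outer_def
    unfolding ennreal_SUP_add_left[OF ne, symmetric] ennreal_SUP_add_right[OF ne] ..
  also have "\<dots> \<le> hausdorff1_outer (A \<union> B)"
    by (intro SUP_least *) auto
  finally show ?thesis .
qed

lemma hausdorff1_outer_closed_split:
  fixes A F :: "'a::metric_space set"
  assumes F: "closed F" "F \<noteq> {}"
  shows "hausdorff1_outer (A \<inter> F) + hausdorff1_outer (A - F) \<le> hausdorff1_outer A"
proof (cases "hausdorff1_outer A = top")
  case False
  let ?H = "hausdorff1_outer"
  define S where "S n = {x \<in> A. 1 / (real n + 1) \<le> infdist x F}" for n
  define R where "R n = {x \<in> A. 1 / (real n + 2) \<le> infdist x F \<and> infdist x F < 1 / (real n + 1)}" for n
  have sep: "?H X + ?H Y \<le> ?H (X \<union> Y)"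
    if "b < a" "\<And>x. x \<in> X \<Longrightarrow> a \<le> infdist x F" "\<And>y. y \<in> Y \<Longrightarrow> infdist y F \<le> b" for X Y a b
  proof (rule hausdorff1_outer_separated[of "a - b"])
    fix x y assume "x \<in> X" "y \<in> Y"
    with that(2,3) have "a \<le> infdist x F" "infdist y F \<le> b" by auto
    moreover have "infdist x F \<le> infdist y F + dist x y" by (rule infdist_triangle)
    ultimately show "a - b \<le> dist x y" by linarith
  qed (use that in auto)
  have half: "(\<Sum>k<n. ?H (R (2*k+c))) \<le> ?H (\<Union>k<n. R (2*k+c))" for n c
  proof (induction n)
    case 0 show ?case by simp
  next
    case (Suc n)
    have "(\<Sum>k<Suc n. ?H (R (2*k+c))) \<le> ?H (\<Union>k<n. R (2*k+c)) + ?H (R (2*n+c))"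
      using Suc by (simp add: add_mono)
    also have "\<dots> \<le> ?H ((\<Union>k<n. R (2*k+c)) \<union> R (2*n+c))"
    proof (cases "n = 0")
      case True then show ?thesis by (simp add: hausdorff1_outer_empty)
    next
      case n: False
      show ?thesis
      proof (rule sep)
        show "1 / (real (2*n+c) + 1) < 1 / real (2*n+c)"
          using n by (simp add: field_simps)
        fix x assume "x \<in> (\<Union>k<n. R (2*k+c))"
        then obtain k where k: "k < n" "x \<in> R (2*k+c)" by auto
        have "1 / real (2*n+c) \<le> 1 / (real (2*k+c) + 2)"
          using k(1) by (intro divide_left_mono) (auto intro!: mult_pos_pos)
        also have "\<dots> \<le> infdist x F" using k(2) by (simp add: R_def)
        finally show "1 / real (2*n+c) \<le> infdist x F" .
      next
        fix y assume "y \<in> R (2*n+c)"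
        then show "infdist y F \<le> 1 / (real (2*n+c) + 1)" by (simp add: R_def)
      qed
    qed
    also have "(\<Union>k<n. R (2*k+c)) \<union> R (2*n+c) = (\<Union>k<Suc n. R (2*k+c))"
      by (auto simp: less_Suc_eq)
    finally show ?case .
  qed
  have halfA: "(\<Sum>k<n. ?H (R (2*k+c))) \<le> ?H A" for n c
    by (rule order_trans[OF half], rule hausdorff1_outer_mono) (auto simp: R_def)
  have dbl: "(\<Sum>k<2*n. ?H (R k)) = (\<Sum>k<n. ?H (R (2*k+0))) + (\<Sum>k<n. ?H (R (2*k+1)))" for n
    by (induction n) (auto simp: algebra_simps)
  have "(\<Sum>k<n. ?H (R k)) \<le> ?H A + ?H A" for n
  proof -
    have "(\<Sum>k<n. ?H (R k)) \<le> (\<Sum>k<2*n. ?H (R k))"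
      by (rule sum_mono2) auto
    also have "\<dots> \<le> ?H A + ?H A"
      unfolding dbl by (intro add_mono halfA)
    finally show ?thesis .
  qed
  then have "(\<Sum>k. ?H (R k)) \<le> ?H A + ?H A"
    by (intro suminf_le_const) auto
  then have fin: "(\<Sum>k. ?H (R k)) \<noteq> top"
    using False by (auto simp: top_unique)
  have tail: "(\<lambda>n. \<Sum>k. ?H (R (k + n))) \<longlonglongrightarrow> 0"
  proof -
    have "(\<lambda>n. (\<Sum>k. ?H (R k)) - (\<Sum>k<n. ?H (R k))) \<longlonglongrightarrow> (\<Sum>k. ?H (R k)) - (\<Sum>k. ?H (R k))"
      using fin by (intro tendsto_diff_ennreal_general summable_LIMSEQ) auto
    moreover have "(\<Sum>k. ?H (R k)) - (\<Sum>k<n. ?H (R k)) = (\<Sum>k. ?H (R (k + n)))" for n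
    proof -
      have "(\<Sum>k. ?H (R k)) = (\<Sum>k. ?H (R (k + n))) + (\<Sum>k<n. ?H (R k))"
        by (rule suminf_offset) auto
      moreover have "(\<Sum>k<n. ?H (R k)) \<noteq> top"
        using fin calculation by auto
      ultimately show ?thesis by (simp add: ennreal_add_diff_cancel_right)
    qed
    ultimately show ?thesis using fin by (simp add: ennreal_minus_cancel_iff)
  qed
  have le: "?H (A \<inter> F) + ?H (A - F) \<le> ?H A + (\<Sum>k. ?H (R (k + n)))" for n
  proof -
    have "A - F \<subseteq> S n \<union> (\<Union>k. R (k + n))"
    proof
      fix x assume x: "x \<in> A - F"
      with F have pos: "0 < infdist x F"
        by (metis DiffD2 in_closed_iff_infdist_zero infdist_nonneg less_eq_real_def)
      show "x \<in> S n \<union> (\<Union>k. R (k + n))"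
      proof (cases "1 / (real n + 1) \<le> infdist x F")
        case True with x show ?thesis by (simp add: S_def)
      next
        case lt: False
        have ex: "\<exists>m. 1 / (real m + 1) \<le> infdist x F"
        proof -
          obtain m where "inverse (real (Suc m)) < infdist x F"
            using reals_Archimedean[OF pos] by blast
          then have "1 / (real m + 1) \<le> infdist x F"
            by (simp add: inverse_eq_divide add.commute)
          then show ?thesis ..
        qed
        define m where "m = (LEAST m. 1 / (real m + 1) \<le> infdist x F)"
        have m: "1 / (real m + 1) \<le> infdist x F" unfolding m_def using ex by (rule LeastI_ex)
        have nm: "n < m"
        proof (rule ccontr)
          assume "\<not> n < m"
          then have "1 / (real n + 1) \<le> 1 / (real m + 1)" by (intro divide_left_mono) auto
          with m lt show False by linarith
        qed
        then obtain k where k: "m = Suc (k + n)" by (metis add.commute less_imp_Suc_add)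
        have "k + n < m" using k by simp
        then have "\<not> 1 / (real (k + n) + 1) \<le> infdist x F"
          unfolding m_def by (rule not_less_Least)
        moreover have "real m + 1 = real (k + n) + 2" using k by simp
        ultimately have "x \<in> R (k + n)" using m x unfolding R_def by (simp only: mem_Collect_eq not_le Diff_iff)
        then show ?thesis by blast
      qed
    qed
    then have "?H (A - F) \<le> ?H (S n \<union> (\<Union>k. R (k + n)))" by (rule hausdorff1_outer_mono)
    also have "\<dots> \<le> ?H (S n) + ?H (\<Union>k. R (k + n))" by (rule hausdorff1_outer_subadditive)
    also have "\<dots> \<le> ?H (S n) + (\<Sum>k. ?H (R (k + n)))"
      by (intro add_mono hausdorff1_outer_countable_subadditive) auto
    finally have "?H (A \<inter> F) + ?H (A - F) \<le> (?H (S n) + ?H (A \<inter> F)) + (\<Sum>k. ?H (R (k + n)))"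
      by (simp add: add_ac add_left_mono)
    moreover have "?H (S n) + ?H (A \<inter> F) \<le> ?H A"
    proof -
      have "?H (S n) + ?H (A \<inter> F) \<le> ?H (S n \<union> (A \<inter> F))"
        by (rule sep[of 0 "1 / (real n + 1)"]) (auto simp: S_def)
      also have "\<dots> \<le> ?H A" by (rule hausdorff1_outer_mono) (auto simp: S_def)
      finally show ?thesis .
    qed
    ultimately show ?thesis by (meson add_right_mono order_trans)
  qed
  have "(\<lambda>n. ?H A + (\<Sum>k. ?H (R (k + n)))) \<longlonglongrightarrow> ?H A + 0"
    by (intro tendsto_add tendsto_const tail)
  then show ?thesis
    using le by (intro LIMSEQ_le_const[where X="\<lambda>n. ?H A + (\<Sum>k. ?H (R (k + n)))"]) auto
qed simp

lemma measure_space_hausdorff1: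
  "measure_space UNIV (sets borel) (hausdorff1_outer :: 'a::metric_space set \<Rightarrow> ennreal)"
proof -
  let ?L = "lambda_system UNIV (Pow UNIV) (hausdorff1_outer :: 'a set \<Rightarrow> ennreal)"
  have L: "measure_space UNIV ?L hausdorff1_outer"
    by (rule sigma_algebra.caratheodory_lemma[OF sigma_algebra_Pow outer_measure_space_hausdorff1])
  have closed: "F \<in> ?L" if "closed F" for F :: "'a set"
  proof (cases "F = {}")
    case True then show ?thesis by (simp add: lambda_system_def hausdorff1_outer_empty)
  next
    case False
    have "hausdorff1_outer (F \<inter> A) + hausdorff1_outer ((UNIV - F) \<inter> A) = hausdorff1_outer A" for A
    proof (rule antisym)
      have "(UNIV - F) \<inter> A = A - F" "F \<inter> A = A \<inter> F" by auto
      then show "hausdorff1_outer (F \<inter> A) + hausdorff1_outer ((UNIV - F) \<inter> A) \<le> hausdorff1_outer A"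
        using hausdorff1_outer_closed_split[OF that False, of A] by simp
      have "A = (F \<inter> A) \<union> ((UNIV - F) \<inter> A)" by auto
      then show "hausdorff1_outer A \<le> hausdorff1_outer (F \<inter> A) + hausdorff1_outer ((UNIV - F) \<inter> A)"
        by (metis hausdorff1_outer_subadditive)
    qed
    then show ?thesis by (simp add: lambda_system_def)
  qed
  have "sets borel = sigma_sets UNIV (Collect closed :: 'a set set)"
    by (simp add: borel_eq_closed)
  also have "\<dots> \<subseteq> ?L"
    using L closed by (intro sigma_algebra.sigma_sets_subset) (auto simp: measure_space_def)
  finally show ?thesis
    by (rule measure_down[OF L, rotated]) (use sets.sigma_algebra_axioms[of borel] in simp)
qed

lemma sets_hausdorff1: "sets hausdorff1 = sets borel"
  using sets.sets_measure_of_eq[of borel] by (simp add: hausdorff1_def)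

lemma emeasure_hausdorff1: "A \<in> sets borel \<Longrightarrow> emeasure hausdorff1 A = hausdorff1_outer A"
  unfolding hausdorff1_def
  by (rule emeasure_measure_of_sigma) (use measure_space_hausdorff1 in \<open>auto simp: measure_space_def\<close>)

text \<open>Derivatives are taken within the parameter interval, i.e. one-sided at its end points.\<close>

primrec nth_vector_derivative ::
    "real set \<Rightarrow> nat \<Rightarrow> (real \<Rightarrow> 'a::real_normed_vector) \<Rightarrow> real \<Rightarrow> 'a" where
  "nth_vector_derivative S 0 g = g"
| "nth_vector_derivative S (Suc n) g =
     (\<lambda>t. vector_derivative (nth_vector_derivative S n g) (at t within S))"

definition C_infinity_on :: "real set \<Rightarrow> (real \<Rightarrow> 'a::real_normed_vector) \<Rightarrow> bool" where
  "C_infinity_on S g \<longleftrightarrow> (\<forall>n. nth_vector_derivative S n g differentiable_on S)"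

definition smooth_curve :: "(real \<Rightarrow> 'a::real_normed_vector) \<Rightarrow> real \<Rightarrow> real \<Rightarrow> bool" where
  "smooth_curve g a b \<longleftrightarrow> a < b \<and> C_infinity_on {a..b} g \<and>
     (\<forall>t\<in>{a..b}. nth_vector_derivative {a..b} 1 g t \<noteq> 0)"

definition finite_union_of_smooth_curves :: "'a::real_normed_vector set \<Rightarrow> bool" where
  "finite_union_of_smooth_curves E \<longleftrightarrow>
     (\<exists>C. finite C \<and> (\<forall>K\<in>C. \<exists>g a b. smooth_curve g a b \<and> K = g ` {a..b}) \<and> E = \<Union>C)"

definition smooth_closed_curve :: "(real \<Rightarrow> real^2) \<Rightarrow> real \<Rightarrow> bool" where
  "smooth_closed_curve g L \<longleftrightarrow> 0 < L \<and> C_infinity_on {0..L} g \<and>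
     (\<forall>s\<in>{0..L}. norm (nth_vector_derivative {0..L} 1 g s) = 1) \<and>
     (\<forall>n. nth_vector_derivative {0..L} n g 0 = nth_vector_derivative {0..L} n g L)"

text \<open>For an arc-length parametrization the (unsigned) curvature is the norm of the second
  derivative.\<close>

definition positive_curvature :: "(real \<Rightarrow> real^2) \<Rightarrow> real \<Rightarrow> bool" where
  "positive_curvature g L \<longleftrightarrow> (\<forall>s\<in>{0..L}. norm (nth_vector_derivative {0..L} 2 g s) \<noteq> 0)"

text \<open>The half-open interval from 0 to L represents the parameters with 0 and L identified.\<close>

definition self_intersection_points :: "(real \<Rightarrow> real^2) \<Rightarrow> real \<Rightarrow> (real^2) set" where
  "self_intersection_points g L =
     {x0. \<exists>s\<in>{0..<L}. \<exists>t\<in>{0..<L}. s \<noteq> t \<and> g s = x0 \<and> g t = x0}"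

text \<open>Two vectors are parallel iff they are collinear with the origin.\<close>

definition transverse_at :: "(real \<Rightarrow> real^2) \<Rightarrow> real \<Rightarrow> real^2 \<Rightarrow> bool" where
  "transverse_at g L x0 \<longleftrightarrow> finite {s\<in>{0..<L}. g s = x0} \<and>
     (\<forall>s\<in>{0..<L}. \<forall>t\<in>{0..<L}. s \<noteq> t \<and> g s = x0 \<and> g t = x0 \<longrightarrow>
        \<not> collinear {0, nth_vector_derivative {0..L} 1 g s, nth_vector_derivative {0..L} 1 g t})"

definition closed_polygonal_curve :: "(real^2) set \<Rightarrow> bool" where
  "closed_polygonal_curve P \<longleftrightarrow>
     (\<exists>(N::nat) (x :: nat \<Rightarrow> real^2). N \<ge> 3 \<and> x N = x 0 \<and>
        (\<forall>i\<in>{1..N}. x (i - 1) \<noteq> x i) \<and>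
        (\<forall>i\<in>{1..N}. \<forall>j\<in>{1..N}. i \<noteq> j \<longrightarrow>
           finite (closed_segment (x (i - 1)) (x i) \<inter> closed_segment (x (j - 1)) (x j))) \<and>
        P = (\<Union>i\<in>{1..N}. closed_segment (x (i - 1)) (x i)))"

definition three_segments_from_point :: "(real^2) set \<Rightarrow> bool" where
  "three_segments_from_point P \<longleftrightarrow>
     (\<exists>(x0 :: real^2) (v :: nat \<Rightarrow> real^2).
        (\<forall>k\<in>{1..3}. v k \<noteq> 0) \<and>
        (\<forall>i\<in>{1..3}. \<forall>j\<in>{1..3}. i \<noteq> j \<longrightarrow> \<not> (\<exists>c>0. v i = c *\<^sub>R v j)) \<and>
        P = (\<Union>k\<in>{1..3}. (\<lambda>t. x0 + t *\<^sub>R v k) ` {0..1}))"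

definition transverse_positive_curvature_curve :: "(real^2) set \<Rightarrow> bool" where
  "transverse_positive_curvature_curve P \<longleftrightarrow>
     (\<exists>g L. smooth_closed_curve g L \<and> positive_curvature g L \<and>
        finite (self_intersection_points g L) \<and>
        (\<forall>x0\<in>self_intersection_points g L. transverse_at g L x0) \<and>
        P = g ` {0..L})"

definition arc_length_measure :: "(real^2) set \<Rightarrow> (real^2) measure" where
  "arc_length_measure E = uniform_measure hausdorff1 E"

text \<open>The notion is used for compactly supported Borel probability measures only. These conditions
  are deliberately not part of the predicate, so that its negation never holds merely because one
  of them fails.\<close>

definition tight_frame_spectral_measure :: "'a::euclidean_space measure \<Rightarrow> bool" where
  "tight_frame_spectral_measure M \<longleftrightarrow>
     (\<exists>(\<Lambda> :: 'a set) (A :: real). countable \<Lambda> \<and> A > 0 \<and>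
        (\<forall>f :: 'a \<Rightarrow> complex. f \<in> borel_measurable M \<and> integrable M (\<lambda>x. (cmod (f x))\<^sup>2) \<longrightarrow>
           ((\<lambda>l. (cmod (\<integral>x. f x * exp (- 2 * complex_of_real pi * \<i> * complex_of_real (l \<bullet> x)) \<partial>M))\<^sup>2)
             has_sum (A * (\<integral>x. (cmod (f x))\<^sup>2 \<partial>M))) \<Lambda>))"

end

theory Submission
  imports Defs
begin

text \<open>Suppose the normalised arc-length measure \<open>M\<close> of \<open>E\<close> satisfies the frame identity for the spectrum
  \<open>\<Lambda>\<close> and the constant \<open>A\<close>. Polarisation shows that for \<open>f\<close> and \<open>g\<close> with disjoint supports the sum over
  \<open>\<Lambda>\<close> of the real part of the product of the Fourier transform of \<open>f\<close> and the conjugate of that of \<open>g\<close>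
  is zero (\<open>frame_orthogonal\<close>). Apply this to \<open>\<rho>(x) b(x - z - u)\<close> and \<open>\<sigma>(y) b(y - z)\<close>, where \<open>\<rho>\<close> and
  \<open>\<sigma>\<close> have disjoint supports, and integrate over \<open>z\<close>. If finitely many such products \<open>\<rho>(x) \<sigma>(y)\<close> add up
  to a kernel whose image under \<open>(x, y) \<mapsto> x - y\<close> is Lebesgue measure near \<open>u\<close>, an
  \<open>off_diagonal_pairing\<close>, the result is that the power spectrum \<open>B\<close> of \<open>b\<close> satisfies
  \<open>(\<Sum>l\<in>\<Lambda>. B l * cos (2 * pi * (l \<bullet> u))) = 0\<close> (\<open>power_spectrum_vanishes\<close>), provided that the
  autocorrelation of \<open>b\<close> has small enough support.
  
  Assume this at all small \<open>u \<noteq> 0\<close>, with a support of diameter proportional to \<open>norm u\<close>. Let \<open>G\<close> be a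
  grid of \<open>N\<close> points with mutual distances at least of the order of \<open>\<epsilon>\<close>, inside a fixed ball, so that
  \<open>N\<close> is of the order of \<open>1 / \<epsilon>\<^sup>2\<close>. Expanding the sum over \<open>\<Lambda>\<close> of \<open>B l\<close> times the squared modulus of
  \<open>\<Sum>p\<in>G. exp (2 * pi * \<i> * (l \<bullet> p))\<close> leaves the diagonal terms only, and hence
  \<open>N\<^sup>2 / 4 * B l0 \<le> N * (\<Sum>l\<in>\<Lambda>. B l)\<close> for a fixed \<open>l0 \<in> \<Lambda>\<close> (\<open>separated_points_bound\<close>). For \<open>b\<close> take
  the restriction of \<open>M\<close> to a ball of radius \<open>\<epsilon>\<close>, smoothed at the same scale. The bound then says that
  \<open>N\<close> times the mass of the ball is at most \<open>64 * A\<close>. But a ball centred on a curve has mass at least of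
  the order of \<open>\<epsilon>\<close>, so that the product is at least of the order of \<open>1 / \<epsilon>\<close>: a contradiction
  (\<open>not_tight_frame_if_off_diagonal_pairings\<close>).
  
  It remains to represent Lebesgue measure near every small \<open>u\<close>. By compactness of the unit circle this
  can be done one direction \<open>\<phi>\<close> at a time (\<open>covered_directions_uniform\<close>). For two arcs \<open>h1\<close> and \<open>h2\<close> the
  Jacobian of \<open>(s, t) \<mapsto> h1 s - h2 t\<close> is, up to a sign, the determinant of \<open>h1' s\<close> and \<open>h2' t\<close>, a sum of two
  products; so a region that is covered exactly once by differences of points on disjoint arcs has a
  pairing (\<open>off_diagonal_pairing_product\<close>).
  
  For segments meeting at a corner the differences fill the cone spanned by the incoming and the
  outgoing direction (\<open>corner_pairing\<close>). In a cyclic sequence of directions with sum zero, the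
  determinant with \<open>\<phi>\<close> changes sign, so \<open>\<phi>\<close> or \<open>- \<phi>\<close> lies in such a cone or on the common boundary of
  two of them (\<open>covered_direction_cyclic\<close>). The edges of a closed polygon form such a sequence, and so do
  six signed copies of the vectors of three segments from a point. On a closed curve some tangent is
  parallel to \<open>\<phi>\<close>; with nonvanishing curvature the curve is near that point a strictly convex graph over
  its tangent, and every short vector close to the tangent direction is a chord of this graph in exactly
  one way (\<open>convex_graph_measure.covered\<close>).\<close>

section \<open>Real functions and tight frames\<close>

definition fourier_cos :: "'a::euclidean_space measure \<Rightarrow> ('a \<Rightarrow> real) \<Rightarrow> 'a \<Rightarrow> real" where
  "fourier_cos M f l = (\<integral>x. f x * cos (2 * pi * (l \<bullet> x)) \<partial>M)"

definition fourier_sin :: "'a::euclidean_space measure \<Rightarrow> ('a \<Rightarrow> real) \<Rightarrow> 'a \<Rightarrow> real" where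
  "fourier_sin M f l = (\<integral>x. f x * sin (2 * pi * (l \<bullet> x)) \<partial>M)"

text \<open>The real part of the product of one Fourier transform with the conjugate of the other; for
  \<open>f = g\<close> it is the power spectrum. Working with this real quantity avoids complex integrals.\<close>

definition fourier_cross ::
    "'a::euclidean_space measure \<Rightarrow> ('a \<Rightarrow> real) \<Rightarrow> ('a \<Rightarrow> real) \<Rightarrow> 'a \<Rightarrow> real" where
  "fourier_cross M f g l = fourier_cos M f l * fourier_cos M g l + fourier_sin M f l * fourier_sin M g l"

definition bounded_borel :: "('a::topological_space \<Rightarrow> real) \<Rightarrow> bool" where
  "bounded_borel f \<longleftrightarrow> f \<in> borel_measurable borel \<and> (\<exists>B. \<forall>x. \<bar>f x\<bar> \<le> B)"

lemma bounded_borelI: "f \<in> borel_measurable borel \<Longrightarrow> (\<And>x. \<bar>f x\<bar> \<le> B) \<Longrightarrow> bounded_borel f"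
  by (auto simp: bounded_borel_def)

lemma bounded_borel_measurable [measurable_dest]: "bounded_borel f \<Longrightarrow> f \<in> borel_measurable borel"
  by (simp add: bounded_borel_def)

lemma bounded_borelE:
  assumes "bounded_borel f" obtains B where "0 \<le> B" "\<And>x. \<bar>f x\<bar> \<le> B"
  using assms by (metis bounded_borel_def abs_ge_zero order_trans)

lemma bounded_borel_add: "bounded_borel f \<Longrightarrow> bounded_borel g \<Longrightarrow> bounded_borel (\<lambda>x. f x + g x)"
  unfolding bounded_borel_def
  by (auto, metis abs_triangle_ineq add_mono order_trans)

lemma bounded_borel_mult: "bounded_borel f \<Longrightarrow> bounded_borel g \<Longrightarrow> bounded_borel (\<lambda>x. f x * g x)"
  unfolding bounded_borel_def
  by (auto simp: abs_mult, metis abs_ge_zero mult_mono' )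

lemma bounded_borel_minus: "bounded_borel f \<Longrightarrow> bounded_borel (\<lambda>x. - f x)"
  unfolding bounded_borel_def by auto

lemma bounded_borel_diff: "bounded_borel f \<Longrightarrow> bounded_borel g \<Longrightarrow> bounded_borel (\<lambda>x. f x - g x)"
  using bounded_borel_add[of f "\<lambda>x. - g x"] bounded_borel_minus[of g] by simp

lemma bounded_borel_const: "bounded_borel (\<lambda>_. c)"
  by (rule bounded_borelI[where B="\<bar>c\<bar>"]) auto

lemma bounded_borel_indicator: "S \<in> sets borel \<Longrightarrow> bounded_borel (indicator S)"
  by (intro bounded_borelI[where B=1]) (auto simp: indicator_def)

lemma bounded_borel_compose:
  "bounded_borel f \<Longrightarrow> g \<in> borel_measurable borel \<Longrightarrow> bounded_borel (\<lambda>x. f (g x))"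
  unfolding bounded_borel_def by (auto simp: measurable_compose)

lemma bounded_borel_cos: "bounded_borel (\<lambda>x::'a::euclidean_space. cos (2 * pi * (l \<bullet> x)))"
  by (rule bounded_borelI[where B=1]) auto

lemma bounded_borel_sin: "bounded_borel (\<lambda>x::'a::euclidean_space. sin (2 * pi * (l \<bullet> x)))"
  by (rule bounded_borelI[where B=1]) auto

lemma integrable_bounded_borel:
  fixes M :: "'a::topological_space measure"
  assumes "finite_measure M" "sets M = sets borel" "bounded_borel f" shows "integrable M f"
proof -
  interpret finite_measure M by fact
  note [measurable_cong] = assms(2)
  obtain B where "\<And>x. \<bar>f x\<bar> \<le> B" using assms(3) bounded_borelE by blast
  then show ?thesis using assms(3) by (intro integrable_const_bound[where B=B]) auto
qed

lemma lborel_integral_reflect: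
  fixes f :: "'a::euclidean_space \<Rightarrow> real"
  assumes [measurable]: "f \<in> borel_measurable borel"
  shows "(\<integral>z. f (t - z) \<partial>lborel) = (\<integral>z. f z \<partial>lborel)"
proof -
  have "(\<integral>z. f z \<partial>lborel) = (\<integral>z. f z \<partial>density (distr lborel borel (\<lambda>x. t + (-1) *\<^sub>R x)) (\<lambda>_. ennreal (\<bar>-1\<bar> ^ DIM('a))))"
    using lborel_affine[of "-1" t] by simp
  also have "\<dots> = (\<integral>z. f z \<partial>distr lborel borel (\<lambda>x. t + (-1) *\<^sub>R x))"
    by (simp add: density_1)
  also have "\<dots> = (\<integral>z. f (t - z) \<partial>lborel)"
    by (subst integral_distr) auto
  finally show ?thesis by simp
qed

lemma lborel_integral_translate:
  fixes f :: "'a::euclidean_space \<Rightarrow> real"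
  assumes [measurable]: "f \<in> borel_measurable borel"
  shows "(\<integral>z. f (t + z) \<partial>lborel) = (\<integral>z. f z \<partial>lborel)"
  using lborel_integral_reflect[of "\<lambda>z. f (t - z)" 0] lborel_integral_reflect[of f t] by simp

lemma lborel_integrable_reflect:
  fixes f :: "'a::euclidean_space \<Rightarrow> real"
  assumes "integrable lborel f"
  shows "integrable lborel (\<lambda>z. f (t - z))"
proof -
  have [measurable]: "f \<in> borel_measurable borel" using assms by auto
  have "integrable (density (distr lborel borel (\<lambda>x. t + (-1) *\<^sub>R x)) (\<lambda>_. ennreal (\<bar>-1\<bar> ^ DIM('a)))) f"
    using lborel_affine[of "-1" t] assms by simp
  then have "integrable (distr lborel borel (\<lambda>x. t + (-1) *\<^sub>R x)) f"
    by (simp add: density_1)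
  then show ?thesis
    by (subst (asm) integrable_distr_eq) auto
qed

lemma lborel_integrable_translate:
  fixes f :: "'a::euclidean_space \<Rightarrow> real"
  assumes "integrable lborel f"
  shows "integrable lborel (\<lambda>z. f (t + z))"
  using lborel_integrable_reflect[OF lborel_integrable_reflect[OF assms], of t 0] by simp

text \<open>The frame identity for real bounded functions, with the sum over the spectrum written as an integral
  for counting measure, so that the Fubini theorem exchanges it with other integrals.\<close>

locale real_tight_frame = finite_measure M
  for M :: "'a::euclidean_space measure" +
  fixes \<Lambda> :: "'a set" and A :: real
  assumes sets_M [measurable_cong]: "sets M = sets borel"
    and countable_\<Lambda>: "countable \<Lambda>"
    and A_pos: "0 < A"
    and frame_integrable: "bounded_borel f \<Longrightarrow> integrable (count_space \<Lambda>) (fourier_cross M f f)"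
    and frame_integral: "bounded_borel f \<Longrightarrow>
          (\<integral>l. fourier_cross M f f l \<partial>count_space \<Lambda>) = A * (\<integral>x. f x * f x \<partial>M)"

lemma real_tight_frameI:
  fixes M :: "'a::euclidean_space measure"
  assumes tf: "tight_frame_spectral_measure M" and fin: "finite_measure M" and sets: "sets M = sets borel"
  obtains \<Lambda> A where "real_tight_frame M \<Lambda> A"
proof -
  interpret finite_measure M by (rule fin)
  note [measurable_cong] = sets
  obtain \<Lambda> and A :: real where LA: "countable \<Lambda>" "A > 0" and
    fr: "\<And>f :: 'a \<Rightarrow> complex. f \<in> borel_measurable M \<Longrightarrow> integrable M (\<lambda>x. (cmod (f x))\<^sup>2) \<Longrightarrow>
           ((\<lambda>l. (cmod (\<integral>x. f x * exp (- 2 * complex_of_real pi * \<i> * complex_of_real (l \<bullet> x)) \<partial>M))\<^sup>2)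
             has_sum (A * (\<integral>x. (cmod (f x))\<^sup>2 \<partial>M))) \<Lambda>"
    using tf unfolding tight_frame_spectral_measure_def by blast
  have key: "(fourier_cross M f f has_sum (A * (\<integral>x. f x * f x \<partial>M))) \<Lambda>" if f: "bounded_borel f" for f
  proof -
    have [measurable]: "f \<in> borel_measurable borel" using f by (rule bounded_borel_measurable)
    have i: "integrable M (\<lambda>x. f x * cos (2 * pi * (l \<bullet> x)))"
            "integrable M (\<lambda>x. f x * sin (2 * pi * (l \<bullet> x)))" for l
      by (intro integrable_bounded_borel[OF fin sets] bounded_borel_mult f bounded_borel_cos bounded_borel_sin)+
    have eq: "(\<integral>x. complex_of_real (f x) * exp (- 2 * complex_of_real pi * \<i> * complex_of_real (l \<bullet> x)) \<partial>M)
       = Complex (fourier_cos M f l) (- fourier_sin M f l)" for l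
    proof -
      have "complex_of_real (f x) * exp (- 2 * complex_of_real pi * \<i> * complex_of_real (l \<bullet> x))
         = complex_of_real (f x * cos (2 * pi * (l \<bullet> x))) - \<i> * complex_of_real (f x * sin (2 * pi * (l \<bullet> x)))" for x
      proof -
        have "exp (- 2 * complex_of_real pi * \<i> * complex_of_real (l \<bullet> x)) = cis (- (2 * pi * (l \<bullet> x)))"
          by (simp add: cis_conv_exp mult_ac)
        then show ?thesis by (simp add: complex_eq_iff)
      qed
      then have "(\<integral>x. complex_of_real (f x) * exp (- 2 * complex_of_real pi * \<i> * complex_of_real (l \<bullet> x)) \<partial>M)
         = (\<integral>x. complex_of_real (f x * cos (2 * pi * (l \<bullet> x))) - \<i> * complex_of_real (f x * sin (2 * pi * (l \<bullet> x))) \<partial>M)"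
        by simp
      also have "\<dots> = (\<integral>x. complex_of_real (f x * cos (2 * pi * (l \<bullet> x))) \<partial>M) - \<i> * (\<integral>x. complex_of_real (f x * sin (2 * pi * (l \<bullet> x))) \<partial>M)"
        using i[of l, THEN integrable_of_real[where 'a=complex]]
        by (subst Bochner_Integration.integral_diff) auto
      also have "\<dots> = Complex (fourier_cos M f l) (- fourier_sin M f l)"
        unfolding integral_complex_of_real fourier_cos_def fourier_sin_def by (simp add: complex_eq_iff)
      finally show ?thesis .
    qed
    have "((\<lambda>l. (cmod (\<integral>x. complex_of_real (f x) * exp (- 2 * complex_of_real pi * \<i> * complex_of_real (l \<bullet> x)) \<partial>M))\<^sup>2)
             has_sum (A * (\<integral>x. (cmod (complex_of_real (f x)))\<^sup>2 \<partial>M))) \<Lambda>"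
    proof (rule fr)
      have "integrable M (\<lambda>x. f x * f x)"
        by (intro integrable_bounded_borel[OF fin sets] bounded_borel_mult f)
      then show "integrable M (\<lambda>x. (cmod (complex_of_real (f x)))\<^sup>2)" by (simp add: power2_eq_square)
    qed measurable
    then show ?thesis
      unfolding eq by (simp add: fourier_cross_def[abs_def] cmod_power2 flip: power2_eq_square)
  qed
  have "real_tight_frame M \<Lambda> A"
  proof (unfold_locales, safe)
    fix f :: "'a \<Rightarrow> real" assume f: "bounded_borel f"
    have nn: "0 \<le> fourier_cross M f f l" for l by (simp add: fourier_cross_def)
    have as: "Infinite_Set_Sum.abs_summable_on (fourier_cross M f f) \<Lambda>"
      using key[OF f] nn summable_on_iff_abs_summable_on_real has_sum_imp_summable by (metis abs_summable_equivalent)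
    then show "integrable (count_space \<Lambda>) (fourier_cross M f f)"
      by (simp add: abs_summable_on_def)
    show "(\<integral>l. fourier_cross M f f l \<partial>count_space \<Lambda>) = A * (\<integral>x. f x * f x \<partial>M)"
      using infsetsum_infsum[OF as] infsumI[OF key[OF f]] by (simp add: infsetsum_def)
  qed (use sets LA in auto)
  then show ?thesis by (rule that)
qed

context real_tight_frame begin

lemma bb_integrable: "bounded_borel f \<Longrightarrow> integrable M f"
  by (rule integrable_bounded_borel[OF finite_measure_axioms sets_M])

lemma fourier_cos_add:
  "bounded_borel f \<Longrightarrow> bounded_borel g \<Longrightarrow> fourier_cos M (\<lambda>x. f x + g x) l = fourier_cos M f l + fourier_cos M g l"
  unfolding fourier_cos_def distrib_right
  by (intro Bochner_Integration.integral_add bb_integrable bounded_borel_mult bounded_borel_cos)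

lemma fourier_sin_add:
  "bounded_borel f \<Longrightarrow> bounded_borel g \<Longrightarrow> fourier_sin M (\<lambda>x. f x + g x) l = fourier_sin M f l + fourier_sin M g l"
  unfolding fourier_sin_def distrib_right
  by (intro Bochner_Integration.integral_add bb_integrable bounded_borel_mult bounded_borel_sin)

text \<open>Functions with disjoint supports are orthogonal, so polarising the frame identity gives the vanishing
  sum. The bound on the sum of absolute values makes the Fubini theorem applicable when \<open>f\<close> and \<open>g\<close>
  depend on a further variable.\<close>

lemma frame_orthogonal:
  assumes f: "bounded_borel f" and g: "bounded_borel g" and fg: "\<And>x. f x * g x = 0"
  shows "integrable (count_space \<Lambda>) (fourier_cross M f g)"
    and "(\<integral>l. fourier_cross M f g l \<partial>count_space \<Lambda>) = 0"
    and "(\<integral>l. \<bar>fourier_cross M f g l\<bar> \<partial>count_space \<Lambda>) \<le> A * ((\<integral>x. f x * f x \<partial>M) + (\<integral>x. g x * g x \<partial>M))"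
proof -
  let ?s = "\<lambda>x. f x + g x"
  have s: "bounded_borel ?s" by (intro bounded_borel_add f g)
  have ff: "bounded_borel (\<lambda>x. f x * f x)" "bounded_borel (\<lambda>x. g x * g x)"
    by (intro bounded_borel_mult f g)+
  have exp: "fourier_cross M f g = (\<lambda>l. (fourier_cross M ?s ?s l - fourier_cross M f f l - fourier_cross M g g l) / 2)"
    by (rule ext) (simp add: fourier_cross_def fourier_cos_add[OF f g] fourier_sin_add[OF f g] algebra_simps)
  show int: "integrable (count_space \<Lambda>) (fourier_cross M f g)"
    unfolding exp by (intro integrable_divide_zero Bochner_Integration.integrable_diff frame_integrable s f g)
  have "(\<integral>l. fourier_cross M f g l \<partial>count_space \<Lambda>)
     = (A * (\<integral>x. ?s x * ?s x \<partial>M) - A * (\<integral>x. f x * f x \<partial>M) - A * (\<integral>x. g x * g x \<partial>M)) / 2"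
    unfolding exp by (simp add: frame_integral s f g frame_integrable)
  also have "(\<integral>x. ?s x * ?s x \<partial>M) = (\<integral>x. f x * f x + g x * g x \<partial>M)"
    using fg by (intro Bochner_Integration.integral_cong) (auto simp: algebra_simps)
  also have "\<dots> = (\<integral>x. f x * f x \<partial>M) + (\<integral>x. g x * g x \<partial>M)"
    by (intro Bochner_Integration.integral_add bb_integrable ff)
  finally show "(\<integral>l. fourier_cross M f g l \<partial>count_space \<Lambda>) = 0" by (simp add: algebra_simps)
  have "(\<integral>l. \<bar>fourier_cross M f g l\<bar> \<partial>count_space \<Lambda>) \<le> (\<integral>l. fourier_cross M f f l + fourier_cross M g g l \<partial>count_space \<Lambda>)"
  proof (rule integral_mono)
    show "integrable (count_space \<Lambda>) (\<lambda>l. \<bar>fourier_cross M f g l\<bar>)" using int by (rule integrable_abs)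
    show "integrable (count_space \<Lambda>) (\<lambda>l. fourier_cross M f f l + fourier_cross M g g l)"
      by (intro Bochner_Integration.integrable_add frame_integrable f g)
    fix l
    have amgm: "\<bar>a * b\<bar> \<le> (a * a + b * b)" for a b :: real
    proof -
      have "2 * \<bar>a * b\<bar> \<le> a * a + b * b"
        using sum_squares_bound[of "\<bar>a\<bar>" "\<bar>b\<bar>"] by (simp add: abs_mult power2_eq_square mult.assoc)
      then show ?thesis using abs_ge_zero[of "a * b"] by linarith
    qed
    show "\<bar>fourier_cross M f g l\<bar> \<le> fourier_cross M f f l + fourier_cross M g g l"
      unfolding fourier_cross_def
      using amgm[of "fourier_cos M f l" "fourier_cos M g l"] amgm[of "fourier_sin M f l" "fourier_sin M g l"]
      by linarith
  qed
  also have "\<dots> = A * ((\<integral>x. f x * f x \<partial>M) + (\<integral>x. g x * g x \<partial>M))"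
    by (simp add: frame_integral f g frame_integrable algebra_simps)
  finally show "(\<integral>l. \<bar>fourier_cross M f g l\<bar> \<partial>count_space \<Lambda>) \<le> A * ((\<integral>x. f x * f x \<partial>M) + (\<integral>x. g x * g x \<partial>M))" .
qed

end

section \<open>Vanishing correlations over the spectrum\<close>

definition autocorrelation :: "('a::euclidean_space \<Rightarrow> real) \<Rightarrow> 'a \<Rightarrow> real" where
  "autocorrelation b v = (\<integral>z. b (v + z) * b z \<partial>lborel)"

lemma autocorrelation_measurable [measurable]:
  assumes [measurable]: "b \<in> borel_measurable borel"
  shows "autocorrelation b \<in> borel_measurable borel"
  unfolding autocorrelation_def[abs_def] by measurable

lemma integrable_mult_bounded_borel:
  fixes f g :: "'a::topological_space \<Rightarrow> real"
  assumes "sets N = sets borel" "bounded_borel f" "integrable N g"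
  shows "integrable N (\<lambda>x. f x * g x)"
proof -
  note [measurable_cong] = assms(1)
  obtain B where B: "\<And>x. \<bar>f x\<bar> \<le> B" using assms(2) bounded_borelE by blast
  have [measurable]: "f \<in> borel_measurable borel" using assms(2) by (rule bounded_borel_measurable)
  have "integrable N (\<lambda>x. B * g x)" using assms(3) by simp
  then show ?thesis
  proof (rule Bochner_Integration.integrable_bound)
    show "AE x in N. norm (f x * g x) \<le> norm (B * g x)"
      using B by (intro AE_I2) (simp add: abs_mult, meson abs_ge_self abs_ge_zero mult_right_mono order_trans)
  qed (use assms(3) in measurable)
qed

lemma bounded_autocorrelation:
  assumes b: "bounded_borel b" "integrable lborel b"
  shows "bounded_borel (autocorrelation b)"
proof -
  obtain B where B: "0 \<le> B" "\<And>x. \<bar>b x\<bar> \<le> B" using b(1) bounded_borelE by blast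
  have bm [measurable]: "b \<in> borel_measurable borel" using b(1) by (rule bounded_borel_measurable)
  have "\<bar>autocorrelation b v\<bar> \<le> B * (\<integral>z. \<bar>b z\<bar> \<partial>lborel)" for v
  proof -
    have i: "integrable lborel (\<lambda>z. b (v + z) * b z)"
      by (intro integrable_mult_bounded_borel b) (auto intro: bounded_borel_compose[OF b(1)])
    have "\<bar>autocorrelation b v\<bar> \<le> (\<integral>z. \<bar>b (v + z) * b z\<bar> \<partial>lborel)"
      unfolding autocorrelation_def by (rule integral_abs_bound)
    also have "\<dots> \<le> (\<integral>z. B * \<bar>b z\<bar> \<partial>lborel)"
      using i b(2) B by (intro integral_mono integrable_abs integrable_mult_right) (auto simp: abs_mult intro: mult_right_mono)
    finally show ?thesis by simp
  qed
  then show ?thesis by (intro bounded_borelI[where B="B * (\<integral>z. \<bar>b z\<bar> \<partial>lborel)"]) auto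
qed

text \<open>By the convolution theorem the Fourier transform of the autocorrelation is the power spectrum, and
  translation by \<open>u\<close> becomes a phase. The sine part is absent since the autocorrelation is even.\<close>

lemma autocorrelation_cos_integral:
  fixes b :: "'a::euclidean_space \<Rightarrow> real"
  assumes b: "bounded_borel b" "integrable lborel b"
  shows "(\<integral>v. autocorrelation b (v - u) * cos (2 * pi * (l \<bullet> v)) \<partial>lborel)
       = cos (2 * pi * (l \<bullet> u)) * fourier_cross lborel b b l"
proof -
  have bm [measurable]: "b \<in> borel_measurable borel" using b(1) by (rule bounded_borel_measurable)
  have iC: "integrable lborel (\<lambda>z. b z * cos (2 * pi * (l \<bullet> z)))"
    using integrable_mult_bounded_borel[OF _ bounded_borel_cos b(2)] by (simp add: mult.commute)
  have iS: "integrable lborel (\<lambda>z. b z * sin (2 * pi * (l \<bullet> z)))"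
    using integrable_mult_bounded_borel[OF _ bounded_borel_sin b(2)] by (simp add: mult.commute)
  let ?h = "\<lambda>v z. b (v - u + z) * b z * cos (2 * pi * (l \<bullet> v))"
  have inner_int: "integrable lborel (\<lambda>v. \<bar>b (v - u + z)\<bar>)" for z
    using lborel_integrable_translate[OF integrable_abs[OF b(2)], of "z - u"] by (simp add: algebra_simps)
  have inner: "(\<integral>v. \<bar>b (v - u + z)\<bar> \<partial>lborel) = (\<integral>v. \<bar>b v\<bar> \<partial>lborel)" for z
    using lborel_integral_translate[of "\<lambda>v. \<bar>b v\<bar>" "z - u"] by (simp add: algebra_simps)
  have int: "integrable (lborel \<Otimes>\<^sub>M lborel) (\<lambda>(z, v). ?h v z)"
  proof -
    have "integrable (lborel \<Otimes>\<^sub>M lborel) (\<lambda>(z, v). \<bar>b (v - u + z)\<bar> * \<bar>b z\<bar>)"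
    proof (rule lborel_pair.Fubini_integrable)
      show "integrable lborel (\<lambda>z. \<integral>v. norm (case (z, v) of (z, v) \<Rightarrow> \<bar>b (v - u + z)\<bar> * \<bar>b z\<bar>) \<partial>lborel)"
        using b(2) by (simp add: inner abs_mult)
      show "AE z in lborel. integrable lborel (\<lambda>v. case (z, v) of (z, v) \<Rightarrow> \<bar>b (v - u + z)\<bar> * \<bar>b z\<bar>)"
        using inner_int by simp
    qed measurable
    then show ?thesis
      by (rule Bochner_Integration.integrable_bound) 
         (auto simp: abs_mult intro!: AE_I2 mult_right_le_one_le)
  qed
  have "(\<integral>v. autocorrelation b (v - u) * cos (2 * pi * (l \<bullet> v)) \<partial>lborel) = (\<integral>v. (\<integral>z. ?h v z \<partial>lborel) \<partial>lborel)"
    unfolding autocorrelation_def by simp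
  also have "\<dots> = (\<integral>z. (\<integral>v. ?h v z \<partial>lborel) \<partial>lborel)"
    using int by (rule lborel_pair.Fubini_integral)
  also have "\<dots> = (\<integral>z. (\<integral>w. b w * b z * cos (2 * pi * (l \<bullet> (w + u - z))) \<partial>lborel) \<partial>lborel)"
  proof (rule Bochner_Integration.integral_cong[OF refl])
    fix z
    show "(\<integral>v. ?h v z \<partial>lborel) = (\<integral>w. b w * b z * cos (2 * pi * (l \<bullet> (w + u - z))) \<partial>lborel)"
      using lborel_integral_translate[of "\<lambda>w. b w * b z * cos (2 * pi * (l \<bullet> (w + u - z)))" "z - u"]
      by (simp add: algebra_simps)
  qed
  also have "\<dots> = (\<integral>z. cos (2 * pi * (l \<bullet> u)) * (fourier_cos lborel b l * (b z * cos (2 * pi * (l \<bullet> z))) + fourier_sin lborel b l * (b z * sin (2 * pi * (l \<bullet> z))))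
         + sin (2 * pi * (l \<bullet> u)) * (fourier_cos lborel b l * (b z * sin (2 * pi * (l \<bullet> z))) - fourier_sin lborel b l * (b z * cos (2 * pi * (l \<bullet> z)))) \<partial>lborel)"
  proof (rule Bochner_Integration.integral_cong[OF refl])
    fix z
    define p where "p = b z * (cos (2 * pi * (l \<bullet> u)) * cos (2 * pi * (l \<bullet> z)) + sin (2 * pi * (l \<bullet> u)) * sin (2 * pi * (l \<bullet> z)))"
    define q where "q = b z * (cos (2 * pi * (l \<bullet> u)) * sin (2 * pi * (l \<bullet> z)) - sin (2 * pi * (l \<bullet> u)) * cos (2 * pi * (l \<bullet> z)))"
    have "b w * b z * cos (2 * pi * (l \<bullet> (w + u - z)))
        = p * (b w * cos (2 * pi * (l \<bullet> w))) + q * (b w * sin (2 * pi * (l \<bullet> w)))" for w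
    proof -
      have "2 * pi * (l \<bullet> (w + u - z)) = 2 * pi * (l \<bullet> w) + (2 * pi * (l \<bullet> u) - 2 * pi * (l \<bullet> z))"
        by (simp add: inner_add_right inner_diff_right algebra_simps)
      then show ?thesis unfolding p_def q_def by (simp only: cos_add cos_diff sin_diff) (simp add: algebra_simps)
    qed
    then have "(\<integral>w. b w * b z * cos (2 * pi * (l \<bullet> (w + u - z))) \<partial>lborel)
       = p * fourier_cos lborel b l + q * fourier_sin lborel b l"
      using iC iS by (simp add: fourier_cos_def fourier_sin_def)
    then show "(\<integral>w. b w * b z * cos (2 * pi * (l \<bullet> (w + u - z))) \<partial>lborel)
      = cos (2 * pi * (l \<bullet> u)) * (fourier_cos lborel b l * (b z * cos (2 * pi * (l \<bullet> z))) + fourier_sin lborel b l * (b z * sin (2 * pi * (l \<bullet> z))))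
         + sin (2 * pi * (l \<bullet> u)) * (fourier_cos lborel b l * (b z * sin (2 * pi * (l \<bullet> z))) - fourier_sin lborel b l * (b z * cos (2 * pi * (l \<bullet> z))))"
      unfolding p_def q_def by (simp add: algebra_simps)
  qed
  also have "\<dots> = cos (2 * pi * (l \<bullet> u)) * fourier_cross lborel b b l"
    using iC iS by (simp add: fourier_cross_def fourier_cos_def[symmetric] fourier_sin_def[symmetric])
  finally show ?thesis .
qed

context real_tight_frame begin

text \<open>For every \<open>z\<close> the functions \<open>\<rho>(x) b(x - z - u)\<close> and \<open>\<sigma>(y) b(y - z)\<close> have disjoint supports, hence are
  orthogonal along the frame. Integrating this relation over \<open>z\<close> turns the two cut-offs into the
  autocorrelation of \<open>b\<close> at \<open>x - y - u\<close>.\<close>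

lemma frame_autocorrelation:
  fixes u :: 'a
  assumes r: "bounded_borel \<rho>" and s: "bounded_borel \<sigma>" and rs: "\<And>x. \<rho> x * \<sigma> x = 0"
    and b: "bounded_borel b" "integrable lborel b"
  defines "K \<equiv> (\<lambda>l. \<integral>p. \<rho> (fst p) * \<sigma> (snd p) *
            (autocorrelation b (fst p - snd p - u) * cos (2 * pi * (l \<bullet> (fst p - snd p)))) \<partial>(M \<Otimes>\<^sub>M M))"
  shows "integrable (count_space \<Lambda>) K" "(\<integral>l. K l \<partial>count_space \<Lambda>) = 0"
proof -
  define f where "f z x = \<rho> x * b (x - z - u)" for z x
  define g where "g z y = \<sigma> y * b (y - z)" for z y
  have [measurable]: "b \<in> borel_measurable borel" "\<rho> \<in> borel_measurable borel" "\<sigma> \<in> borel_measurable borel"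
    using b r s by auto
  have [measurable]: "case_prod f \<in> borel_measurable (borel \<Otimes>\<^sub>M borel)" "case_prod g \<in> borel_measurable (borel \<Otimes>\<^sub>M borel)"
    unfolding f_def[abs_def] g_def[abs_def] by measurable
  have fb: "bounded_borel (f z)" and gb: "bounded_borel (g z)" for z
    unfolding f_def[abs_def] g_def[abs_def]
    by (intro bounded_borel_mult r s bounded_borel_compose[OF b(1)]; measurable)+
  have fg0: "f z x * g z x = 0" for z x
    using rs[of x] by (auto simp: f_def g_def)
  obtain R S B where R: "0 \<le> R" "\<And>x. \<bar>\<rho> x\<bar> \<le> R" and S: "0 \<le> S" "\<And>x. \<bar>\<sigma> x\<bar> \<le> S" and B: "0 \<le> B" "\<And>x. \<bar>b x\<bar> \<le> B"
    using r s b(1) by (metis bounded_borelE)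
  interpret LC: sigma_finite_measure "count_space \<Lambda>"
    by (rule sigma_finite_measure_count_space_countable) (rule countable_\<Lambda>)
  interpret P: pair_sigma_finite "lborel :: 'a measure" "count_space \<Lambda>" ..
  interpret PLM: pair_sigma_finite "lborel :: 'a measure" M ..
  interpret MM: pair_sigma_finite M M ..
  interpret MM2: finite_measure "M \<Otimes>\<^sub>M M" by (rule finite_measure_pair_measure) unfold_locales
  interpret MML: pair_sigma_finite "lborel :: 'a measure" "M \<Otimes>\<^sub>M M" ..
  have b2: "integrable lborel (\<lambda>z. b (t - z) * b (t - z))" for t
    using lborel_integrable_reflect[OF integrable_mult_bounded_borel[OF _ b], of t] by simp
  have b2I: "(\<integral>z. b (t - z) * b (t - z) \<partial>lborel) = (\<integral>z. b z * b z \<partial>lborel)" for t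
    using lborel_integral_reflect[of "\<lambda>z. b z * b z" t] by simp
  have sq: "integrable lborel (\<lambda>z. \<integral>x. h z x * h z x \<partial>M)"
    if h: "\<And>z x. h z x = \<tau> x * b (x - a - z)" and t: "bounded_borel \<tau>" for h :: "'a \<Rightarrow> 'a \<Rightarrow> real" and \<tau> a
  proof -
    have [measurable]: "\<tau> \<in> borel_measurable borel" using t by (rule bounded_borel_measurable)
    have "integrable (M \<Otimes>\<^sub>M lborel) (\<lambda>(x, z). h z x * h z x)"
    proof -
      interpret MS: pair_sigma_finite M "lborel :: 'a measure" ..
      show ?thesis
      proof (rule MS.Fubini_integrable)
        show "(\<lambda>(x, z). h z x * h z x) \<in> borel_measurable (M \<Otimes>\<^sub>M lborel)"
          unfolding h by measurable
        have eq: "(\<integral>z. norm (h z x * h z x) \<partial>lborel) = \<tau> x * \<tau> x * (\<integral>z. b z * b z \<partial>lborel)" for x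
        proof -
          have "(\<integral>z. norm (h z x * h z x) \<partial>lborel) = (\<integral>z. \<tau> x * \<tau> x * (b (x - a - z) * b (x - a - z)) \<partial>lborel)"
            unfolding h by (intro Bochner_Integration.integral_cong) (auto simp: abs_mult algebra_simps)
          then show ?thesis by (simp add: b2I)
        qed
        show "integrable M (\<lambda>x. \<integral>z. norm (case (x, z) of (x, z) \<Rightarrow> h z x * h z x) \<partial>lborel)"
          unfolding prod.case eq
          by (intro integrable_mult_left bb_integrable bounded_borel_mult t)
        show "AE x in M. integrable lborel (\<lambda>z. case (x, z) of (x, z) \<Rightarrow> h z x * h z x)"
        proof (rule AE_I2)
          fix x
          have "integrable lborel (\<lambda>z. \<tau> x * \<tau> x * (b (x - a - z) * b (x - a - z)))"
            by (intro integrable_mult_right b2)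
          then show "integrable lborel (\<lambda>z. case (x, z) of (x, z) \<Rightarrow> h z x * h z x)"
            unfolding h by (simp add: algebra_simps)
        qed
      qed
    qed
    then have "integrable (lborel \<Otimes>\<^sub>M M) (\<lambda>(z, x). h z x * h z x)"
      by (subst PLM.integrable_product_swap_iff[symmetric]) (simp add: case_prod_unfold)
    from PLM.integrable_fst'[OF this] show ?thesis by simp
  qed
  have Hf: "integrable lborel (\<lambda>z. \<integral>x. f z x * f z x \<partial>M)"
    by (rule sq[where \<tau>=\<rho> and a=u]) (auto simp: f_def r algebra_simps)
  have Hg: "integrable lborel (\<lambda>z. \<integral>x. g z x * g z x \<partial>M)"
    by (rule sq[where \<tau>=\<sigma> and a=0]) (auto simp: g_def s algebra_simps)
  let ?G = "\<lambda>(z, l). fourier_cross M (f z) (g z) l"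
  have Gm: "(\<lambda>z. fourier_cross M (f z) (g z) l) \<in> borel_measurable lborel" for l
    unfolding fourier_cross_def fourier_cos_def fourier_sin_def by measurable
  have Gm' [measurable]: "?G \<in> borel_measurable (lborel \<Otimes>\<^sub>M count_space \<Lambda>)"
  proof (subst measurable_pair_swap_iff)
    show "(\<lambda>(x, y). ?G (y, x)) \<in> borel_measurable (count_space \<Lambda> \<Otimes>\<^sub>M lborel)"
      by (rule measurable_pair_measure_countable1[OF countable_\<Lambda>]) (simp only: prod.case Gm)
  qed
  have GI: "integrable (lborel \<Otimes>\<^sub>M count_space \<Lambda>) ?G"
  proof (rule P.Fubini_integrable)
    show "integrable lborel (\<lambda>z. \<integral>l. norm (case (z, l) of (z, l) \<Rightarrow> fourier_cross M (f z) (g z) l) \<partial>count_space \<Lambda>)"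
    proof (rule Bochner_Integration.integrable_bound)
      show "integrable lborel (\<lambda>z. A * ((\<integral>x. f z x * f z x \<partial>M) + (\<integral>x. g z x * g z x \<partial>M)))"
        by (intro integrable_mult_right Bochner_Integration.integrable_add Hf Hg)
      show "AE z in lborel. norm (\<integral>l. norm (case (z, l) of (z, l) \<Rightarrow> fourier_cross M (f z) (g z) l) \<partial>count_space \<Lambda>)
              \<le> norm (A * ((\<integral>x. f z x * f z x \<partial>M) + (\<integral>x. g z x * g z x \<partial>M)))"
      proof (rule AE_I2)
        fix z
        show "norm (\<integral>l. norm (case (z, l) of (z, l) \<Rightarrow> fourier_cross M (f z) (g z) l) \<partial>count_space \<Lambda>)
              \<le> norm (A * ((\<integral>x. f z x * f z x \<partial>M) + (\<integral>x. g z x * g z x \<partial>M)))"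
          using frame_orthogonal(3)[of "f z" "g z", OF fb gb fg0]
            Bochner_Integration.integral_nonneg[of "count_space \<Lambda>" "\<lambda>l. \<bar>fourier_cross M (f z) (g z) l\<bar>"]
          by simp
      qed
    qed measurable
    show "AE z in lborel. integrable (count_space \<Lambda>) (\<lambda>l. case (z, l) of (z, l) \<Rightarrow> fourier_cross M (f z) (g z) l)"
      using frame_orthogonal(1)[OF fb gb fg0] by simp
  qed measurable
  have Keq: "(\<integral>z. fourier_cross M (f z) (g z) l \<partial>lborel) = K l" for l
  proof -
    have cs: "integrable M (\<lambda>x. h x * cos (2 * pi * (l \<bullet> x)))" "integrable M (\<lambda>x. h x * sin (2 * pi * (l \<bullet> x)))"
      if "bounded_borel h" for h :: "'a \<Rightarrow> real"
      by (intro bb_integrable bounded_borel_mult that bounded_borel_cos bounded_borel_sin)+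
    have ints: "integrable (M \<Otimes>\<^sub>M M) (\<lambda>p. h (fst p) * k (snd p))"
      if hk: "bounded_borel h" "bounded_borel k" for h k :: "'a \<Rightarrow> real"
    proof -
      have [measurable]: "h \<in> borel_measurable borel" "k \<in> borel_measurable borel"
        by (intro bounded_borel_measurable hk)+
      obtain H where H: "0 \<le> H" "\<And>x. \<bar>h x\<bar> \<le> H" by (rule bounded_borelE[OF hk(1)], rule that)
      obtain L where L: "0 \<le> L" "\<And>x. \<bar>k x\<bar> \<le> L" by (rule bounded_borelE[OF hk(2)], rule that)
      show ?thesis
      proof (rule MM2.integrable_const_bound[where B="H * L"])
        show "AE p in M \<Otimes>\<^sub>M M. norm (h (fst p) * k (snd p)) \<le> H * L"
          by (rule AE_I2) (simp add: abs_mult mult_mono' H L)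
      qed measurable
    qed
    have prod: "(\<integral>x. h x \<partial>M) * (\<integral>y. k y \<partial>M) = (\<integral>p. h (fst p) * k (snd p) \<partial>(M \<Otimes>\<^sub>M M))"
      if hk: "bounded_borel h" "bounded_borel k" for h k :: "'a \<Rightarrow> real"
      using MM.integral_fst'[OF ints[OF hk]] by simp
    let ?c = "\<lambda>p. cos (2 * pi * (l \<bullet> (fst p - snd p)))"
    let ?\<Phi> = "\<lambda>z p. f z (fst p) * g z (snd p) * ?c p"
    have cross: "fourier_cross M (f z) (g z) l = (\<integral>p. ?\<Phi> z p \<partial>(M \<Otimes>\<^sub>M M))" for z
    proof -
      have bb: "bounded_borel (\<lambda>x. f z x * cos (2 * pi * (l \<bullet> x)))" "bounded_borel (\<lambda>x. f z x * sin (2 * pi * (l \<bullet> x)))"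
        "bounded_borel (\<lambda>x. g z x * cos (2 * pi * (l \<bullet> x)))" "bounded_borel (\<lambda>x. g z x * sin (2 * pi * (l \<bullet> x)))"
        by (intro bounded_borel_mult fb gb bounded_borel_cos bounded_borel_sin)+
      have "?\<Phi> z p = f z (fst p) * cos (2 * pi * (l \<bullet> fst p)) * (g z (snd p) * cos (2 * pi * (l \<bullet> snd p)))
         + f z (fst p) * sin (2 * pi * (l \<bullet> fst p)) * (g z (snd p) * sin (2 * pi * (l \<bullet> snd p)))" for p
      proof -
        have "2 * pi * (l \<bullet> (fst p - snd p)) = 2 * pi * (l \<bullet> fst p) - 2 * pi * (l \<bullet> snd p)"
          by (simp add: inner_diff_right algebra_simps)
        then show ?thesis by (simp only: cos_diff) (simp add: algebra_simps)
      qed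
      then show ?thesis
        unfolding fourier_cross_def fourier_cos_def fourier_sin_def prod[OF bb(1,3)] prod[OF bb(2,4)]
        using ints[OF bb(1,3)] ints[OF bb(2,4)] by simp
    qed
    interpret MS: pair_sigma_finite "M \<Otimes>\<^sub>M M" "lborel :: 'a measure" ..
    have babs: "integrable lborel (\<lambda>z. \<bar>b (t - z)\<bar>)" "(\<integral>z. \<bar>b (t - z)\<bar> \<partial>lborel) = (\<integral>z. \<bar>b z\<bar> \<partial>lborel)" for t
      using lborel_integrable_reflect[OF integrable_abs[OF b(2)], of t] lborel_integral_reflect[of "\<lambda>z. \<bar>b z\<bar>" t]
      by simp_all
    have "integrable ((M \<Otimes>\<^sub>M M) \<Otimes>\<^sub>M lborel) (\<lambda>(p, z). (R * S * B) * \<bar>b (snd p - z)\<bar>)"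
    proof (rule MS.Fubini_integrable)
      show "integrable (M \<Otimes>\<^sub>M M) (\<lambda>p. \<integral>z. norm (case (p, z) of (p, z) \<Rightarrow> (R * S * B) * \<bar>b (snd p - z)\<bar>) \<partial>lborel)"
        by (simp add: babs abs_mult)
      show "AE p in M \<Otimes>\<^sub>M M. integrable lborel (\<lambda>z. case (p, z) of (p, z) \<Rightarrow> (R * S * B) * \<bar>b (snd p - z)\<bar>)"
        using babs by simp
    qed measurable
    then have "integrable ((M \<Otimes>\<^sub>M M) \<Otimes>\<^sub>M lborel) (\<lambda>(p, z). ?\<Phi> z p)"
    proof (rule Bochner_Integration.integrable_bound)
      show "(\<lambda>(p, z). ?\<Phi> z p) \<in> borel_measurable ((M \<Otimes>\<^sub>M M) \<Otimes>\<^sub>M lborel)"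
        unfolding f_def g_def by measurable
      show "AE x in (M \<Otimes>\<^sub>M M) \<Otimes>\<^sub>M lborel. norm (case x of (p, z) \<Rightarrow> ?\<Phi> z p)
             \<le> norm (case x of (p, z) \<Rightarrow> (R * S * B) * \<bar>b (snd p - z)\<bar>)"
      proof (rule AE_I2)
        fix q :: "('a \<times> 'a) \<times> 'a"
        obtain x y z where q: "q = ((x, y), z)" by (metis prod.exhaust)
        have "\<bar>\<rho> x\<bar> * \<bar>b (x - z - u)\<bar> * (\<bar>\<sigma> y\<bar> * \<bar>b (y - z)\<bar>) * \<bar>?c (x, y)\<bar>
            \<le> R * B * (S * \<bar>b (y - z)\<bar>) * 1"
          using R S B by (intro mult_mono mult_nonneg_nonneg) auto
        then show "norm (case q of (p, z) \<Rightarrow> ?\<Phi> z p)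
             \<le> norm (case q of (p, z) \<Rightarrow> (R * S * B) * \<bar>b (snd p - z)\<bar>)"
          using R S B by (simp add: q f_def g_def abs_mult mult_ac)
      qed
    qed
    then have \<Phi>I: "integrable (lborel \<Otimes>\<^sub>M (M \<Otimes>\<^sub>M M)) (\<lambda>(z, p). ?\<Phi> z p)"
      by (subst MML.integrable_product_swap_iff[symmetric]) (simp add: case_prod_unfold)
    have "(\<integral>z. fourier_cross M (f z) (g z) l \<partial>lborel) = (\<integral>z. (\<integral>p. ?\<Phi> z p \<partial>(M \<Otimes>\<^sub>M M)) \<partial>lborel)"
      by (simp only: cross)
    also have "\<dots> = (\<integral>p. (\<integral>z. ?\<Phi> z p \<partial>lborel) \<partial>(M \<Otimes>\<^sub>M M))"
      using MML.Fubini_integral[OF \<Phi>I] by simp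
    also have "\<dots> = K l"
      unfolding K_def
    proof (rule Bochner_Integration.integral_cong[OF refl])
      fix p :: "'a \<times> 'a"
      have "(\<integral>z. ?\<Phi> z p \<partial>lborel)
          = (\<integral>z. \<rho> (fst p) * \<sigma> (snd p) * ?c p * (b (fst p - z - u) * b (snd p - z)) \<partial>lborel)"
        by (simp add: f_def g_def mult_ac)
      also have "\<dots> = \<rho> (fst p) * \<sigma> (snd p) * ?c p * (\<integral>z. b (fst p - z - u) * b (snd p - z) \<partial>lborel)"
        by simp
      also have "(\<integral>z. b (fst p - z - u) * b (snd p - z) \<partial>lborel) = autocorrelation b (fst p - snd p - u)"
        using lborel_integral_reflect[of "\<lambda>w. b (fst p - snd p - u + w) * b w" "snd p"]
        by (simp add: autocorrelation_def algebra_simps)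
      finally show "(\<integral>z. ?\<Phi> z p \<partial>lborel) = \<rho> (fst p) * \<sigma> (snd p) * (autocorrelation b (fst p - snd p - u) * ?c p)"
        by (simp add: mult_ac)
    qed
    finally show ?thesis .
  qed
  show "integrable (count_space \<Lambda>) K" "(\<integral>l. K l \<partial>count_space \<Lambda>) = 0"
    using P.integrable_snd[OF GI] P.Fubini_integral[OF GI] frame_orthogonal(2)[OF fb gb fg0]
    by (simp_all add: Keq)
qed

end

text \<open>The image of the kernel \<open>\<Sum>j. \<rho> j x * \<sigma> j y\<close> under \<open>(x, y) \<mapsto> x - y\<close> is Lebesgue measure on \<open>U\<close>. Since
  \<open>\<rho> j\<close> and \<open>\<sigma> j\<close> have disjoint supports, the kernel avoids the diagonal, and every summand is
  accessible to the orthogonality of disjointly supported functions.\<close>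

definition off_diagonal_kernel ::
    "'a::euclidean_space measure \<Rightarrow> 'a set \<Rightarrow> nat \<Rightarrow> (nat \<Rightarrow> 'a \<Rightarrow> real) \<Rightarrow> (nat \<Rightarrow> 'a \<Rightarrow> real) \<Rightarrow> bool" where
  "off_diagonal_kernel M U n \<rho> \<sigma> \<longleftrightarrow>
     (\<forall>j<n. bounded_borel (\<rho> j) \<and> bounded_borel (\<sigma> j) \<and> (\<forall>x. \<rho> j x * \<sigma> j x = 0)) \<and>
     (\<forall>\<psi>. bounded_borel \<psi> \<longrightarrow>
        (\<Sum>j<n. \<integral>p. \<rho> j (fst p) * \<sigma> j (snd p) * \<psi> (fst p - snd p) \<partial>(M \<Otimes>\<^sub>M M))
          = (\<integral>v. indicator U v * \<psi> v \<partial>lborel))"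

definition off_diagonal_pairing :: "'a::euclidean_space measure \<Rightarrow> 'a set \<Rightarrow> bool" where
  "off_diagonal_pairing M U \<longleftrightarrow>
     bounded U \<and> U \<in> sets borel \<and> (\<exists>n \<rho> \<sigma>. off_diagonal_kernel M U n \<rho> \<sigma>)"

lemma off_diagonal_kernelD:
  assumes "off_diagonal_kernel M U n \<rho> \<sigma>"
  shows "j < n \<Longrightarrow> bounded_borel (\<rho> j)" "j < n \<Longrightarrow> bounded_borel (\<sigma> j)" "j < n \<Longrightarrow> \<rho> j x * \<sigma> j x = 0"
    "bounded_borel \<psi> \<Longrightarrow>
       (\<Sum>j<n. \<integral>p. \<rho> j (fst p) * \<sigma> j (snd p) * \<psi> (fst p - snd p) \<partial>(M \<Otimes>\<^sub>M M))
         = (\<integral>v. indicator U v * \<psi> v \<partial>lborel)"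
  using assms unfolding off_diagonal_kernel_def by blast+

lemma real_tight_frame_nonempty:
  assumes "real_tight_frame M \<Lambda> A" "0 < measure M UNIV"
  shows "\<Lambda> \<noteq> {}"
proof
  interpret real_tight_frame M \<Lambda> A by fact
  assume "\<Lambda> = {}"
  moreover have "bounded_borel (\<lambda>_::'a. 1)" by (intro bounded_borelI[where B=1]) auto
  from frame_integral[OF this] have "(\<integral>l. fourier_cross M (\<lambda>_. 1) (\<lambda>_. 1) l \<partial>count_space \<Lambda>) = A * measure M UNIV"
    using sets_eq_imp_space_eq[OF sets_M] by simp
  ultimately show False using A_pos assms(2) by (simp add: lebesgue_integral_count_space_finite)
qed

lemma integral_count_space_ge_term:
  fixes f :: "'a \<Rightarrow> real"
  assumes "integrable (count_space S) f" "\<And>x. 0 \<le> f x" "a \<in> S"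
  shows "f a \<le> (\<integral>x. f x \<partial>count_space S)"
proof -
  have "f a = (\<integral>x. f a * indicator {a} x \<partial>count_space S)"
    using assms(3) by (simp add: measure_count_space)
  also have "\<dots> \<le> (\<integral>x. f x \<partial>count_space S)"
  proof (rule integral_mono)
    have "integrable (count_space S) (indicator {a} :: 'a \<Rightarrow> real)"
      using assms(3) by (intro integrable_real_indicator) (auto simp: emeasure_count_space)
    then show "integrable (count_space S) (\<lambda>x. f a * indicator {a} x)" by (rule integrable_mult_right)
  qed (use assms in \<open>auto simp: indicator_def\<close>)
  finally show ?thesis .
qed

text \<open>On the support of the translated autocorrelation the kernel represents Lebesgue measure, so summing
  the relations of \<open>frame_autocorrelation\<close> over the terms of the kernel leaves the cosine integral of
  the translated autocorrelation.\<close>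

lemma (in real_tight_frame) power_spectrum_vanishes:
  assumes U: "off_diagonal_pairing M U"
    and b: "bounded_borel b" "integrable lborel b"
    and supp: "\<And>v. v \<notin> U \<Longrightarrow> autocorrelation b (v - u) = 0"
  shows "integrable (count_space \<Lambda>) (\<lambda>l. cos (2 * pi * (l \<bullet> u)) * fourier_cross lborel b b l)"
    and "(\<integral>l. cos (2 * pi * (l \<bullet> u)) * fourier_cross lborel b b l \<partial>count_space \<Lambda>) = 0"
proof -
  obtain n \<rho> \<sigma> where k: "off_diagonal_kernel M U n \<rho> \<sigma>"
    using U unfolding off_diagonal_pairing_def by blast
  note rs = off_diagonal_kernelD(1-3)[OF k] and rep = off_diagonal_kernelD(4)[OF k]
  define K where "K j l = (\<integral>p. \<rho> j (fst p) * \<sigma> j (snd p) *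
            (autocorrelation b (fst p - snd p - u) * cos (2 * pi * (l \<bullet> (fst p - snd p)))) \<partial>(M \<Otimes>\<^sub>M M))" for j l
  have K: "integrable (count_space \<Lambda>) (K j)" "(\<integral>l. K j l \<partial>count_space \<Lambda>) = 0" if "j < n" for j
    using frame_autocorrelation[OF rs[OF that] b, of u] unfolding K_def[abs_def] by auto
  have eq: "(\<Sum>j<n. K j l) = cos (2 * pi * (l \<bullet> u)) * fourier_cross lborel b b l" for l
  proof -
    have m: "(\<lambda>v. v - u) \<in> borel_measurable borel" by measurable
    have "(\<Sum>j<n. K j l) = (\<integral>v. indicator U v * (autocorrelation b (v - u) * cos (2 * pi * (l \<bullet> v))) \<partial>lborel)"
      unfolding K_def
      by (rule rep) (intro bounded_borel_mult bounded_borel_cos bounded_borel_compose[OF bounded_autocorrelation[OF b] m])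
    also have "\<dots> = (\<integral>v. autocorrelation b (v - u) * cos (2 * pi * (l \<bullet> v)) \<partial>lborel)"
      using supp by (intro Bochner_Integration.integral_cong) (auto simp: indicator_def)
    finally have "(\<Sum>j<n. K j l) = (\<integral>v. autocorrelation b (v - u) * cos (2 * pi * (l \<bullet> v)) \<partial>lborel)" .
    then show ?thesis using autocorrelation_cos_integral[OF b, of u l] by simp
  qed
  show "integrable (count_space \<Lambda>) (\<lambda>l. cos (2 * pi * (l \<bullet> u)) * fourier_cross lborel b b l)"
    unfolding eq[symmetric] using K by (intro Bochner_Integration.integrable_sum) auto
  show "(\<integral>l. cos (2 * pi * (l \<bullet> u)) * fourier_cross lborel b b l \<partial>count_space \<Lambda>) = 0"
    unfolding eq[symmetric] using K by (subst Bochner_Integration.integral_sum) auto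
qed

section \<open>Smoothing the restriction of a measure to a ball\<close>

text \<open>The density of the convolution of \<open>M\<close> restricted to a ball with Lebesgue measure on a ball of the same
  radius. Restricting localises the autocorrelation, and smoothing makes a function out of a measure.\<close>

definition smoothed_restriction :: "'a::euclidean_space measure \<Rightarrow> 'a \<Rightarrow> real \<Rightarrow> 'a \<Rightarrow> real" where
  "smoothed_restriction M x0 \<epsilon> x = (\<integral>y. indicator (cball x0 \<epsilon>) y * indicator (cball 0 \<epsilon>) (x - y) \<partial>M)"

context
  fixes M :: "'a::euclidean_space measure" and x0 :: 'a and \<epsilon> :: real
  assumes fin: "finite_measure M" and sets_M' [measurable_cong]: "sets M = sets borel" and eps: "0 < \<epsilon>"
begin

interpretation finite_measure M by (rule fin)

private lemma cball_borel [measurable]: "cball (a::'a) e \<in> sets borel"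
  by simp

private abbreviation "b \<equiv> smoothed_restriction M x0 \<epsilon>"
private abbreviation "m \<equiv> measure M (cball x0 \<epsilon>)"

private lemma ind_int: "integrable M (\<lambda>y. indicator (cball x0 \<epsilon>) y * indicator (cball 0 \<epsilon>) (x - y) :: real)"
  by (rule integrable_const_bound[where B=1]) (auto simp: indicator_def)

lemma smoothed_restriction_bounds: "0 \<le> b x" "b x \<le> m"
proof -
  show "0 \<le> b x" unfolding smoothed_restriction_def by (rule Bochner_Integration.integral_nonneg) auto
  have "b x \<le> (\<integral>y. indicator (cball x0 \<epsilon>) y \<partial>M)"
    unfolding smoothed_restriction_def
    by (rule integral_mono[OF ind_int]) (auto simp: indicator_def intro!: integrable_const_bound[where B=1])
  also have "\<dots> = m" using sets_eq_imp_space_eq[OF sets_M'] by simp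
  finally show "b x \<le> m" .
qed

lemma smoothed_restriction_support: "2 * \<epsilon> < dist x0 x \<Longrightarrow> b x = 0"
proof -
  assume *: "2 * \<epsilon> < dist x0 x"
  have zero: "indicator (cball x0 \<epsilon>) y * indicator (cball 0 \<epsilon>) (x - y) = (0::real)" for y
    using * dist_triangle[of x0 x y] by (auto simp: indicator_def dist_norm norm_minus_commute)
  show ?thesis by (simp only: smoothed_restriction_def zero Bochner_Integration.integral_zero)
qed

lemma bounded_smoothed_restriction: "bounded_borel b"
proof (rule bounded_borelI)
  show "b \<in> borel_measurable borel" unfolding smoothed_restriction_def[abs_def] by measurable
  show "\<bar>b x\<bar> \<le> m" for x using smoothed_restriction_bounds[of x] by simp
qed

lemma integrable_smoothed_restriction: "integrable lborel b"
proof -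
  note [measurable] = bounded_borel_measurable[OF bounded_smoothed_restriction]
  have "integrable lborel (\<lambda>x. m * indicator (cball x0 (2 * \<epsilon>)) x :: real)"
    by (intro integrable_mult_right integrable_real_indicator emeasure_lborel_cball_finite) simp
  then show ?thesis
  proof (rule Bochner_Integration.integrable_bound)
    show "AE x in lborel. norm (b x) \<le> norm (m * indicator (cball x0 (2 * \<epsilon>)) x)"
      using smoothed_restriction_bounds smoothed_restriction_support by (intro AE_I2) (auto simp: indicator_def)
  qed measurable
qed

lemma autocorrelation_smoothed_restriction: "4 * \<epsilon> < norm v \<Longrightarrow> autocorrelation b v = 0"
proof -
  assume v: "4 * \<epsilon> < norm v"
  have zero: "b (v + z) * b z = 0" for z
  proof -
    have "norm v = dist z (v + z)" by (simp add: dist_norm)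
    then have "2 * \<epsilon> < dist x0 z \<or> 2 * \<epsilon> < dist x0 (v + z)"
      using v dist_triangle[of z "v + z" x0] by (auto simp: dist_commute)
    then show ?thesis using smoothed_restriction_support by auto
  qed
  show ?thesis by (simp only: autocorrelation_def zero Bochner_Integration.integral_zero)
qed

private abbreviation "q l \<equiv> (\<integral>z. indicator (cball 0 \<epsilon>) z * cos (2 * pi * (l \<bullet> z)) \<partial>lborel)"

private lemma iC: "integrable lborel (\<lambda>z. indicator (cball (0::'a) \<epsilon>) z * cos (2 * pi * (l \<bullet> z)))"
  and iS: "integrable lborel (\<lambda>z. indicator (cball (0::'a) \<epsilon>) z * sin (2 * pi * (l \<bullet> z)))"
  and i1: "integrable lborel (\<lambda>z. indicator (cball (0::'a) \<epsilon>) z :: real)"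
proof -
  show i: "integrable lborel (\<lambda>z. indicator (cball (0::'a) \<epsilon>) z :: real)"
    by (intro integrable_real_indicator emeasure_lborel_cball_finite) simp
  show "integrable lborel (\<lambda>z. indicator (cball (0::'a) \<epsilon>) z * cos (2 * pi * (l \<bullet> z)))"
    using integrable_mult_bounded_borel[OF _ bounded_borel_cos i] by (simp add: mult.commute)
  show "integrable lborel (\<lambda>z. indicator (cball (0::'a) \<epsilon>) z * sin (2 * pi * (l \<bullet> z)))"
    using integrable_mult_bounded_borel[OF _ bounded_borel_sin i] by (simp add: mult.commute)
qed

text \<open>The ball is symmetric, so its Fourier transform is real.\<close>

private lemma sin0: "(\<integral>z. indicator (cball (0::'a) \<epsilon>) z * sin (2 * pi * (l \<bullet> z)) \<partial>lborel) = 0"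
proof -
  have "(\<integral>z. indicator (cball (0::'a) \<epsilon>) (0 - z) * sin (2 * pi * (l \<bullet> (0 - z))) \<partial>lborel)
      = (\<integral>z. indicator (cball (0::'a) \<epsilon>) z * sin (2 * pi * (l \<bullet> z)) \<partial>lborel)"
    by (rule lborel_integral_reflect) measurable
  moreover have "indicator (cball (0::'a) \<epsilon>) (0 - z) = (indicator (cball (0::'a) \<epsilon>) z :: real)" for z
    by (auto simp: indicator_def)
  ultimately show ?thesis by simp
qed

text \<open>Integration against a convolution, in the form needed for the Fourier transforms below.\<close>

private lemma conv:
  assumes t: "bounded_borel t"
  shows "(\<integral>x. b x * t x \<partial>lborel)
       = (\<integral>y. indicator (cball x0 \<epsilon>) y * (\<integral>z. indicator (cball 0 \<epsilon>) z * t (y + z) \<partial>lborel) \<partial>M)"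
proof -
  have [measurable]: "t \<in> borel_measurable borel" using t by (rule bounded_borel_measurable)
  obtain T where T: "0 \<le> T" "\<And>x. \<bar>t x\<bar> \<le> T" by (rule bounded_borelE[OF t], rule that)
  interpret P: pair_sigma_finite M "lborel :: 'a measure" ..
  let ?h = "\<lambda>y x. indicator (cball x0 \<epsilon>) y * indicator (cball 0 \<epsilon>) (x - y) * t x"
  have i: "integrable lborel (\<lambda>x. indicator (cball (0::'a) \<epsilon>) (x - y) :: real)" for y
    using lborel_integrable_translate[OF i1, of "- y"] by simp
  have iv: "(\<integral>x. indicator (cball (0::'a) \<epsilon>) (x - y) \<partial>lborel) = (\<integral>z. indicator (cball (0::'a) \<epsilon>) z \<partial>lborel :: real)" for y
    using lborel_integral_translate[of "indicator (cball (0::'a) \<epsilon>) :: 'a \<Rightarrow> real" "- y"] by simp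
  have "integrable (M \<Otimes>\<^sub>M lborel) (\<lambda>(y, x). T * indicator (cball (0::'a) \<epsilon>) (x - y) :: real)"
  proof (rule P.Fubini_integrable)
    show "integrable M (\<lambda>y. \<integral>x. norm (case (y, x) of (y, x) \<Rightarrow> T * indicat_real (cball (0::'a) \<epsilon>) (x - y)) \<partial>lborel)"
      by (simp add: abs_mult iv)
    show "AE y in M. integrable lborel (\<lambda>x. case (y, x) of (y, x) \<Rightarrow> T * indicat_real (cball (0::'a) \<epsilon>) (x - y))"
      using i by simp
  qed measurable
  then have int: "integrable (M \<Otimes>\<^sub>M lborel) (\<lambda>(y, x). ?h y x)"
  proof (rule Bochner_Integration.integrable_bound)
    show "AE p in M \<Otimes>\<^sub>M lborel. norm (case p of (y, x) \<Rightarrow> ?h y x) \<le> norm (case p of (y, x) \<Rightarrow> T * indicat_real (cball (0::'a) \<epsilon>) (x - y))"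
      by (rule AE_I2) (use T in \<open>auto simp: indicator_def\<close>)
  qed measurable
  have "(\<integral>x. b x * t x \<partial>lborel) = (\<integral>x. (\<integral>y. ?h y x \<partial>M) \<partial>lborel)"
    unfolding smoothed_restriction_def by simp
  also have "\<dots> = (\<integral>y. (\<integral>x. ?h y x \<partial>lborel) \<partial>M)"
    by (rule P.Fubini_integral[OF int])
  also have "\<dots> = (\<integral>y. indicator (cball x0 \<epsilon>) y * (\<integral>z. indicator (cball 0 \<epsilon>) z * t (y + z) \<partial>lborel) \<partial>M)"
  proof (rule Bochner_Integration.integral_cong[OF refl])
    fix y
    have "(\<integral>x. ?h y x \<partial>lborel) = indicator (cball x0 \<epsilon>) y * (\<integral>x. indicator (cball 0 \<epsilon>) (x - y) * t x \<partial>lborel)"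
      by (simp add: mult.assoc)
    also have "(\<integral>x. indicator (cball 0 \<epsilon>) (x - y) * t x \<partial>lborel) = (\<integral>z. indicator (cball 0 \<epsilon>) z * t (y + z) \<partial>lborel)"
      using lborel_integral_translate[of "\<lambda>x. indicator (cball 0 \<epsilon>) (x - y) * t x" y] by simp
    finally show "(\<integral>x. ?h y x \<partial>lborel) = indicator (cball x0 \<epsilon>) y * (\<integral>z. indicator (cball 0 \<epsilon>) z * t (y + z) \<partial>lborel)" .
  qed
  finally show ?thesis .
qed

private abbreviation "X \<equiv> fourier_cross M (indicator (cball x0 \<epsilon>)) (indicator (cball x0 \<epsilon>))"

lemma fourier_cross_smoothed_restriction: "fourier_cross lborel b b l = X l * (q l)\<^sup>2"
proof -
  have c: "(\<integral>z. indicator (cball 0 \<epsilon>) z * cos (2 * pi * (l \<bullet> (y + z))) \<partial>lborel) = cos (2 * pi * (l \<bullet> y)) * q l" for y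
  proof -
    have "indicator (cball 0 \<epsilon>) z * cos (2 * pi * (l \<bullet> (y + z)))
       = cos (2 * pi * (l \<bullet> y)) * (indicator (cball 0 \<epsilon>) z * cos (2 * pi * (l \<bullet> z)))
         - sin (2 * pi * (l \<bullet> y)) * (indicator (cball 0 \<epsilon>) z * sin (2 * pi * (l \<bullet> z)))" for z
      by (simp add: inner_add_right distrib_left cos_add) (simp add: algebra_simps)
    then show ?thesis using iC iS sin0 by simp
  qed
  have s: "(\<integral>z. indicator (cball 0 \<epsilon>) z * sin (2 * pi * (l \<bullet> (y + z))) \<partial>lborel) = sin (2 * pi * (l \<bullet> y)) * q l" for y
  proof -
    have "indicator (cball 0 \<epsilon>) z * sin (2 * pi * (l \<bullet> (y + z)))
       = sin (2 * pi * (l \<bullet> y)) * (indicator (cball 0 \<epsilon>) z * cos (2 * pi * (l \<bullet> z)))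
         + cos (2 * pi * (l \<bullet> y)) * (indicator (cball 0 \<epsilon>) z * sin (2 * pi * (l \<bullet> z)))" for z
      by (simp add: inner_add_right distrib_left sin_add)
    then show ?thesis using iC iS sin0 by simp
  qed
  have "fourier_cos lborel b l = fourier_cos M (indicator (cball x0 \<epsilon>)) l * q l"
    unfolding fourier_cos_def conv[OF bounded_borel_cos] c by (simp flip: mult.assoc)
  moreover have "fourier_sin lborel b l = fourier_sin M (indicator (cball x0 \<epsilon>)) l * q l"
    unfolding fourier_sin_def conv[OF bounded_borel_sin] s by (simp flip: mult.assoc)
  ultimately show ?thesis by (simp add: fourier_cross_def power2_eq_square algebra_simps)
qed

private lemma X_nonneg: "0 \<le> X l" by (simp add: fourier_cross_def)

text \<open>The Fourier transform of the ball is at most its volume, so summability along a frame passes from the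
  power spectrum of the restriction to that of its smoothing.\<close>

lemma fourier_cross_smoothed_restriction_le: "fourier_cross lborel b b l \<le> (measure lborel (cball (0::'a) \<epsilon>))\<^sup>2 * X l"
proof -
  have "\<bar>q l\<bar> \<le> (\<integral>z. \<bar>indicator (cball 0 \<epsilon>) z * cos (2 * pi * (l \<bullet> z))\<bar> \<partial>lborel)"
    by (rule integral_abs_bound)
  also have "\<dots> \<le> (\<integral>z. indicator (cball (0::'a) \<epsilon>) z \<partial>lborel)"
    by (rule integral_mono[OF integrable_abs[OF iC] i1]) (auto simp: indicator_def)
  also have "\<dots> = measure lborel (cball (0::'a) \<epsilon>)" by simp
  finally have "\<bar>q l\<bar> \<le> measure lborel (cball (0::'a) \<epsilon>)" .
  then have "(q l)\<^sup>2 \<le> (measure lborel (cball (0::'a) \<epsilon>))\<^sup>2" by (intro abs_le_square_iff[THEN iffD1]) simp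
  then show ?thesis
    unfolding fourier_cross_smoothed_restriction mult.commute[of _ "X l"]
    by (rule mult_left_mono) (rule X_nonneg)
qed

text \<open>At low frequency all phases on the ball differ from the phase at its centre by at most \<open>pi / 3\<close>, whose
  cosine is \<open>1 / 2\<close>; hence both Fourier transforms have at least half of their maximal modulus.\<close>

lemma fourier_cross_smoothed_restriction_ge:
  assumes l: "2 * pi * norm l * \<epsilon> \<le> pi / 3"
  shows "m\<^sup>2 * (measure lborel (cball (0::'a) \<epsilon>))\<^sup>2 / 16 \<le> fourier_cross lborel b b l"
proof -
  have cos_ge: "1 / 2 \<le> cos (2 * pi * (l \<bullet> z))" if "norm z \<le> \<epsilon>" for z
  proof -
    have "\<bar>l \<bullet> z\<bar> \<le> norm l * \<epsilon>"
      using Cauchy_Schwarz_ineq2[of l z] that by (meson mult_left_mono norm_ge_zero order_trans)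
    then have "2 * pi * \<bar>l \<bullet> z\<bar> \<le> 2 * pi * (norm l * \<epsilon>)"
      by (intro mult_left_mono) auto
    then have "\<bar>2 * pi * (l \<bullet> z)\<bar> \<le> pi / 3"
      using l by (simp add: abs_mult mult.assoc)
    then have "cos (pi / 3) \<le> cos \<bar>2 * pi * (l \<bullet> z)\<bar>"
      by (intro cos_monotone_0_pi_le) auto
    then show ?thesis by (simp add: cos_60)
  qed
  have "measure lborel (cball (0::'a) \<epsilon>) / 2 = (\<integral>z. indicator (cball (0::'a) \<epsilon>) z * (1/2) \<partial>lborel)" by simp
  also have "\<dots> \<le> q l"
    by (rule integral_mono[OF integrable_mult_left[OF i1] iC]) (use cos_ge in \<open>auto simp: indicator_def\<close>)
  finally have qV: "measure lborel (cball (0::'a) \<epsilon>) / 2 \<le> q l" .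
  let ?f = "indicator (cball x0 \<epsilon>) :: 'a \<Rightarrow> real" and ?t = "2 * pi * (l \<bullet> x0)"
  have bf: "bounded_borel ?f" by (rule bounded_borel_indicator) simp
  note ib = integrable_bounded_borel[OF fin sets_M']
  have ic: "integrable M (\<lambda>x. ?f x * cos (2 * pi * (l \<bullet> x)))" and isn: "integrable M (\<lambda>x. ?f x * sin (2 * pi * (l \<bullet> x)))"
    by (intro ib bounded_borel_mult bf bounded_borel_cos bounded_borel_sin)+
  have "m / 2 = (\<integral>x. ?f x * (1 / 2) \<partial>M)" using sets_eq_imp_space_eq[OF sets_M'] by simp
  also have "\<dots> \<le> (\<integral>x. cos ?t * (?f x * cos (2 * pi * (l \<bullet> x))) + sin ?t * (?f x * sin (2 * pi * (l \<bullet> x))) \<partial>M)"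
  proof (rule integral_mono)
    show "integrable M (\<lambda>x. ?f x * (1 / 2))" by (intro integrable_mult_left ib bf)
    show "integrable M (\<lambda>x. cos ?t * (?f x * cos (2 * pi * (l \<bullet> x))) + sin ?t * (?f x * sin (2 * pi * (l \<bullet> x))))"
      using ic isn by simp
    fix x
    have "cos ?t * cos (2 * pi * (l \<bullet> x)) + sin ?t * sin (2 * pi * (l \<bullet> x)) = cos (2 * pi * (l \<bullet> (x0 - x)))"
      by (simp add: inner_diff_right right_diff_distrib cos_diff)
    moreover have "x \<in> cball x0 \<epsilon> \<Longrightarrow> 1 / 2 \<le> cos (2 * pi * (l \<bullet> (x0 - x)))"
      by (rule cos_ge) (simp add: dist_norm)
    ultimately show "?f x * (1 / 2) \<le> cos ?t * (?f x * cos (2 * pi * (l \<bullet> x))) + sin ?t * (?f x * sin (2 * pi * (l \<bullet> x)))"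
      by (auto simp: indicator_def)
  qed
  also have "\<dots> = cos ?t * fourier_cos M ?f l + sin ?t * fourier_sin M ?f l"
    using ic isn by (simp add: fourier_cos_def fourier_sin_def)
  finally have "m / 2 \<le> cos ?t * fourier_cos M ?f l + sin ?t * fourier_sin M ?f l" .
  then have "(m / 2)\<^sup>2 \<le> (cos ?t * fourier_cos M ?f l + sin ?t * fourier_sin M ?f l)\<^sup>2"
    by (intro power_mono) auto
  also have "\<dots> \<le> X l"
  proof -
    have "(c * C + s * S)\<^sup>2 + (c * S - s * C)\<^sup>2 = (c\<^sup>2 + s\<^sup>2) * (C * C + S * S)" for c s C S :: real
      by (simp add: power2_eq_square algebra_simps)
    from this[of "cos ?t" "fourier_cos M ?f l" "sin ?t" "fourier_sin M ?f l"]
    have "X l = (cos ?t * fourier_cos M ?f l + sin ?t * fourier_sin M ?f l)\<^sup>2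
             + (cos ?t * fourier_sin M ?f l - sin ?t * fourier_cos M ?f l)\<^sup>2"
      by (simp only: fourier_cross_def sin_cos_squared_add2 mult_1)
    then show ?thesis by simp
  qed
  finally have mX: "(m / 2)\<^sup>2 \<le> X l" .
  have "(measure lborel (cball (0::'a) \<epsilon>) / 2)\<^sup>2 \<le> (q l)\<^sup>2"
    by (rule power_mono[OF qV]) simp
  with mX have "(m / 2)\<^sup>2 * (measure lborel (cball (0::'a) \<epsilon>) / 2)\<^sup>2 \<le> X l * (q l)\<^sup>2"
    by (rule mult_mono) (rule X_nonneg, rule zero_le_power2)
  moreover have "(v / 2)\<^sup>2 * (w / 2)\<^sup>2 = v\<^sup>2 * w\<^sup>2 / 16" for v w :: real
    by (simp add: power_divide)
  ultimately show ?thesis unfolding fourier_cross_smoothed_restriction by (simp only:)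
qed

end

section \<open>Separated differences and the mass of small balls\<close>

definition square_grid :: "real \<Rightarrow> nat \<Rightarrow> (real^2) set" where
  "square_grid d n = (\<lambda>(i, j). vector [real i * d, real j * d]) ` ({..<n} \<times> {..<n})"

lemma norm_real2: "norm (x :: real^2) = sqrt ((x $ 1)\<^sup>2 + (x $ 2)\<^sup>2)"
  by (simp add: norm_vec_def L2_set_def UNIV_2)

lemma square_grid_card:
  assumes "0 < d" shows "finite (square_grid d n)" "card (square_grid d n) = n * n"
proof -
  have "inj_on (\<lambda>(i, j). vector [real i * d, real j * d] :: real^2) ({..<n} \<times> {..<n})"
    using assms by (auto simp: inj_on_def vec_eq_iff forall_2)
  then show "card (square_grid d n) = n * n"
    by (simp add: square_grid_def card_image card_cartesian_product)
  show "finite (square_grid d n)" by (simp add: square_grid_def)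
qed

lemma square_grid_dist:
  assumes d: "0 < d" and p: "p \<in> square_grid d n" "q \<in> square_grid d n"
  shows "norm (p - q) \<le> 2 * real n * d" "p \<noteq> q \<Longrightarrow> d \<le> norm (p - q)" "norm p \<le> 2 * real n * d"
proof -
  obtain i j k l where ij: "p = vector [real i * d, real j * d]" "i < n" "j < n"
      and kl: "q = vector [real k * d, real l * d]" "k < n" "l < n"
    using p by (auto simp: square_grid_def)
  have pq: "p - q = vector [(real i - real k) * d, (real j - real l) * d]"
    by (simp add: ij kl vec_eq_iff forall_2 algebra_simps)
  have le: "norm (vector [a * d, b * d] :: real^2) \<le> 2 * real n * d" if "\<bar>a\<bar> \<le> real n" "\<bar>b\<bar> \<le> real n" for a b
  proof -
    have "norm (vector [a * d, b * d] :: real^2) \<le> \<bar>a * d\<bar> + \<bar>b * d\<bar>"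
      unfolding norm_real2 by (simp add: sqrt_sum_squares_le_sum_abs)
    also have "\<dots> = \<bar>a\<bar> * d + \<bar>b\<bar> * d" using d by (simp add: abs_mult)
    also have "\<dots> \<le> real n * d + real n * d" using that d by (intro add_mono mult_right_mono) auto
    finally show ?thesis by (simp add: algebra_simps)
  qed
  show "norm (p - q) \<le> 2 * real n * d" unfolding pq using ij kl by (intro le) auto
  show "norm p \<le> 2 * real n * d" unfolding ij(1) using ij by (intro le) auto
  show "d \<le> norm (p - q)" if ne: "p \<noteq> q"
  proof -
    have "i \<noteq> k \<or> j \<noteq> l" using ne ij kl by auto
    then have "1 \<le> \<bar>real i - real k\<bar> \<or> 1 \<le> \<bar>real j - real l\<bar>" by linarith
    then have "d \<le> \<bar>(real i - real k) * d\<bar> \<or> d \<le> \<bar>(real j - real l) * d\<bar>"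
      using d by (auto simp: abs_mult)
    moreover have "\<bar>(p - q) $ 1\<bar> \<le> norm (p - q)" "\<bar>(p - q) $ 2\<bar> \<le> norm (p - q)"
      by (rule component_le_norm_cart)+
    ultimately show ?thesis unfolding pq by auto
  qed
qed

lemma sum_cos_diff:
  fixes l :: "'a::euclidean_space"
  assumes "finite G"
  shows "(\<Sum>p\<in>G. \<Sum>q\<in>G. cos (2 * pi * (l \<bullet> (p - q)))) = (\<Sum>p\<in>G. cos (2 * pi * (l \<bullet> p)))\<^sup>2 + (\<Sum>p\<in>G. sin (2 * pi * (l \<bullet> p)))\<^sup>2"
  by (simp add: inner_diff_right right_diff_distrib cos_diff sum.distrib power2_eq_square sum_product)

text \<open>A large-sieve argument: expanding the square in \<open>\<Sum>l. X l * (norm (\<Sum>p\<in>G. exp (2 * pi * \<i> * (l \<bullet> p))))\<^sup>2\<close>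
  only the diagonal terms \<open>p = q\<close> survive, while the single frequency \<open>l0\<close> already contributes at least
  \<open>(card G / 2)\<^sup>2 * X l0\<close>, as its phases at all points of \<open>G\<close> have cosine at least \<open>1 / 2\<close>.\<close>

lemma separated_points_bound:
  fixes X :: "'a::euclidean_space \<Rightarrow> real"
  assumes X: "integrable (count_space \<Lambda>) X" "\<And>l. 0 \<le> X l" and l0: "l0 \<in> \<Lambda>"
    and G: "finite G" and near: "\<And>p. p \<in> G \<Longrightarrow> 2 * pi * norm l0 * norm p \<le> pi / 3"
    and int: "\<And>p q. p \<in> G \<Longrightarrow> q \<in> G \<Longrightarrow> p \<noteq> q \<Longrightarrow> integrable (count_space \<Lambda>) (\<lambda>l. cos (2 * pi * (l \<bullet> (p - q))) * X l)"
    and zero: "\<And>p q. p \<in> G \<Longrightarrow> q \<in> G \<Longrightarrow> p \<noteq> q \<Longrightarrow> (\<integral>l. cos (2 * pi * (l \<bullet> (p - q))) * X l \<partial>count_space \<Lambda>) = 0"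
  shows "(real (card G))\<^sup>2 / 4 * X l0 \<le> real (card G) * (\<integral>l. X l \<partial>count_space \<Lambda>)"
proof -
  have int': "integrable (count_space \<Lambda>) (\<lambda>l. cos (2 * pi * (l \<bullet> (p - q))) * X l)" if "p \<in> G" "q \<in> G" for p q
    using int[OF that] X(1) by (cases "p = q") auto
  have val: "(\<integral>l. cos (2 * pi * (l \<bullet> (p - q))) * X l \<partial>count_space \<Lambda>) = (if p = q then (\<integral>l. X l \<partial>count_space \<Lambda>) else 0)"
    if "p \<in> G" "q \<in> G" for p q
    using zero[OF that] by auto
  define S where "S l = (\<Sum>p\<in>G. \<Sum>q\<in>G. cos (2 * pi * (l \<bullet> (p - q))) * X l)" for l
  have S: "S l = ((\<Sum>p\<in>G. cos (2 * pi * (l \<bullet> p)))\<^sup>2 + (\<Sum>p\<in>G. sin (2 * pi * (l \<bullet> p)))\<^sup>2) * X l" for l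
    unfolding S_def sum_distrib_right[symmetric] sum_cos_diff[OF G] ..
  have "1 / 2 \<le> cos (2 * pi * (l0 \<bullet> p))" if "p \<in> G" for p
  proof -
    have "\<bar>2 * pi * (l0 \<bullet> p)\<bar> \<le> 2 * pi * (norm l0 * norm p)"
      using Cauchy_Schwarz_ineq2[of l0 p] by (simp add: abs_mult)
    moreover have "2 * pi * (norm l0 * norm p) \<le> pi / 3" using near[OF that] by (simp only: mult.assoc)
    ultimately have "\<bar>2 * pi * (l0 \<bullet> p)\<bar> \<le> pi / 3" by linarith
    then have "cos (pi / 3) \<le> cos \<bar>2 * pi * (l0 \<bullet> p)\<bar>"
      by (intro cos_monotone_0_pi_le) auto
    then show ?thesis by (simp add: cos_60)
  qed
  then have "(\<Sum>p\<in>G. 1 / 2) \<le> (\<Sum>p\<in>G. cos (2 * pi * (l0 \<bullet> p)))" by (intro sum_mono) auto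
  then have "(real (card G) / 2)\<^sup>2 \<le> (\<Sum>p\<in>G. cos (2 * pi * (l0 \<bullet> p)))\<^sup>2" by (intro power_mono) auto
  then have "(real (card G) / 2)\<^sup>2 * X l0 \<le> S l0"
    unfolding S by (intro mult_right_mono X) (smt (verit) zero_le_power2)
  also have "S l0 \<le> (\<integral>l. S l \<partial>count_space \<Lambda>)"
  proof (rule integral_count_space_ge_term)
    show "integrable (count_space \<Lambda>) S"
      unfolding S_def[abs_def] by (intro Bochner_Integration.integrable_sum int')
    show "0 \<le> S l" for l unfolding S using X(2) by simp
  qed (rule l0)
  also have "\<dots> = (\<Sum>p\<in>G. \<Sum>q\<in>G. \<integral>l. cos (2 * pi * (l \<bullet> (p - q))) * X l \<partial>count_space \<Lambda>)"
    unfolding S_def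
    by (subst Bochner_Integration.integral_sum, intro Bochner_Integration.integrable_sum int', assumption+)
       (intro sum.cong refl Bochner_Integration.integral_sum int')
  also have "\<dots> = real (card G) * (\<integral>l. X l \<partial>count_space \<Lambda>)"
    by (simp add: val G cong: sum.cong)
  finally show ?thesis by (simp add: power_divide)
qed

text \<open>Choose \<open>n * n\<close> grid points of mutual distance at least \<open>d \<approx> 1 / n\<close> and a ball of radius \<open>\<epsilon>\<close>
  proportional to \<open>d\<close>. For any two of these points the correlation at their difference \<open>u\<close> vanishes, since
  the autocorrelation translated by \<open>u\<close> lives in \<open>ball u (c * norm u)\<close>. By the large sieve
  \<open>n\<^sup>2 * measure M (cball x0 \<epsilon>)\<close> is bounded independently of \<open>n\<close>, whereas it grows at least like
  \<open>n\<^sup>2 * \<epsilon> \<approx> n\<close>: a one-dimensional set is too large for its two-dimensional difference set.\<close>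

lemma not_tight_frame_if_off_diagonal_pairings:
  fixes M :: "(real^2) measure"
  assumes fin: "finite_measure M" and sets: "sets M = sets borel"
    and c: "0 < c" and r: "0 < r"
    and pairing: "\<And>u. 0 < norm u \<Longrightarrow> norm u \<le> r \<Longrightarrow>
      \<exists>U. ball u (c * norm u) \<subseteq> U \<and> off_diagonal_pairing M U"
    and c': "0 < c'" and e0: "0 < e0" and lower: "\<And>\<epsilon>. 0 < \<epsilon> \<Longrightarrow> \<epsilon> \<le> e0 \<Longrightarrow> c' * \<epsilon> \<le> measure M (cball x0 \<epsilon>)"
  shows "\<not> tight_frame_spectral_measure M"
proof
  assume "tight_frame_spectral_measure M"
  then obtain \<Lambda> A where "real_tight_frame M \<Lambda> A" using real_tight_frameI[OF _ fin sets] by blast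
  then interpret real_tight_frame M \<Lambda> A .
  have "0 < c' * e0" using c' e0 by simp
  also have "\<dots> \<le> measure M (cball x0 e0)" using lower[of e0] e0 by simp
  also have "\<dots> \<le> measure M UNIV" using sets by (intro finite_measure_mono) auto
  finally obtain l0 where l0: "l0 \<in> \<Lambda>"
    using real_tight_frame_nonempty[OF real_tight_frame_axioms] by auto
  \<comment> \<open>The second bound keeps all grid points so close to the origin that the phases at \<open>l0\<close> are
    at most \<open>pi / 3\<close>.\<close>
  define R where "R = min r (1 / (6 * (norm l0 + 1)))"
  have R: "0 < R" "R \<le> r" "R \<le> 1 / (6 * (norm l0 + 1))" using r by (auto simp: R_def add_nonneg_pos)
  define k where "k = min c 1"
  have k: "0 < k" "k \<le> c" "k \<le> 1" using c by (auto simp: k_def)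
  have l0_small: "2 * pi * norm l0 * t \<le> pi / 3" if "0 \<le> t" "t \<le> R" for t
  proof -
    have "norm l0 * t \<le> (norm l0 + 1) * (1 / (6 * (norm l0 + 1)))"
      using that R by (intro mult_mono) auto
    also have "\<dots> = 1 / 6" by (simp add: field_simps add_nonneg_pos) (smt (verit) norm_ge_zero)
    finally have "2 * pi * (norm l0 * t) \<le> 2 * pi * (1 / 6)" by (intro mult_left_mono) auto
    then show ?thesis by (simp add: mult.assoc)
  qed
  \<comment> \<open>The first bound gives \<open>\<epsilon> \<le> e0\<close>; the second one contradicts \<open>n * n * ?m \<le> 64 * A\<close> below.\<close>
  obtain n :: nat where n: "0 < n" "k * R / (16 * e0) \<le> real n" "64 * A * 16 / (c' * k * R) < real n"
  proof -
    obtain n :: nat where "max (k * R / (16 * e0)) (64 * A * 16 / (c' * k * R)) < real n"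
      using reals_Archimedean2 by blast
    then have "k * R / (16 * e0) < real n" "64 * A * 16 / (c' * k * R) < real n" by auto
    then show ?thesis by (intro that[of "Suc n"]) auto
  qed
  define d where "d = R / (2 * real n)"
  \<comment> \<open>The autocorrelation vanishes beyond \<open>4 * \<epsilon> = k * d / 2\<close>, which is less than \<open>c * norm u\<close>.\<close>
  define \<epsilon> where "\<epsilon> = k * d / 8"
  have d: "0 < d" "2 * real n * d = R" using R n by (auto simp: d_def)
  have eps: "0 < \<epsilon>" using d k by (simp add: \<epsilon>_def)
  have eps_eq: "\<epsilon> = k * R / (16 * real n)" by (simp add: \<epsilon>_def d_def)
  have eps_e0: "\<epsilon> \<le> e0" using n(1,2) e0 unfolding eps_eq by (simp add: field_simps)
  have dR: "d \<le> R" using d(2) d(1) n(1) by (smt (verit) mult_le_cancel_right1 of_nat_0_less_iff of_nat_1 of_nat_le_iff Suc_leI One_nat_def)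
  have eps_R: "\<epsilon> \<le> R"
  proof -
    have "k * d \<le> 1 * d" using k d by (intro mult_right_mono) auto
    then have "k * d \<le> R * 8" using dR d R by linarith
    then show ?thesis by (simp add: \<epsilon>_def)
  qed
  let ?b = "smoothed_restriction M x0 \<epsilon>"
  let ?m = "measure M (cball x0 \<epsilon>)" and ?V = "measure lborel (cball (0::real^2) \<epsilon>)"
  let ?X = "fourier_cross M (indicator (cball x0 \<epsilon>)) (indicator (cball x0 \<epsilon>))"
  let ?G = "square_grid d n"
  have X: "integrable (count_space \<Lambda>) ?X" "(\<integral>l. ?X l \<partial>count_space \<Lambda>) = A * ?m"
  proof -
    have bi: "bounded_borel (indicator (cball x0 \<epsilon>) :: real^2 \<Rightarrow> real)" by (rule bounded_borel_indicator) simp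
    show "integrable (count_space \<Lambda>) ?X" by (rule frame_integrable[OF bi])
    have "(\<integral>x. indicator (cball x0 \<epsilon>) x * indicator (cball x0 \<epsilon>) x \<partial>M) = (\<integral>x. indicator (cball x0 \<epsilon>) x \<partial>M :: real)"
      by (intro Bochner_Integration.integral_cong) (auto simp: indicator_def)
    then show "(\<integral>l. ?X l \<partial>count_space \<Lambda>) = A * ?m"
      using frame_integral[OF bi] sets_eq_imp_space_eq[OF sets] by simp
  qed
  have Bint: "integrable (count_space \<Lambda>) (fourier_cross lborel ?b ?b)"
  proof (rule Bochner_Integration.integrable_bound)
    show "integrable (count_space \<Lambda>) (\<lambda>l. ?V\<^sup>2 * ?X l)" using X by simp
    show "AE l in count_space \<Lambda>. norm (fourier_cross lborel ?b ?b l) \<le> norm (?V\<^sup>2 * ?X l)"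
      using fourier_cross_smoothed_restriction_le[OF fin sets eps, of x0]
      by (intro AE_I2) (smt (verit) fourier_cross_def real_norm_def zero_le_square)
  qed simp
  have Ble: "(\<integral>l. fourier_cross lborel ?b ?b l \<partial>count_space \<Lambda>) \<le> ?V\<^sup>2 * (A * ?m)"
  proof -
    have "(\<integral>l. fourier_cross lborel ?b ?b l \<partial>count_space \<Lambda>) \<le> (\<integral>l. ?V\<^sup>2 * ?X l \<partial>count_space \<Lambda>)"
      using X by (intro integral_mono Bint) (auto intro: fourier_cross_smoothed_restriction_le[OF fin sets eps])
    then show ?thesis using X by simp
  qed
  have vanish: "integrable (count_space \<Lambda>) (\<lambda>l. cos (2 * pi * (l \<bullet> (p - q))) * fourier_cross lborel ?b ?b l)"
    "(\<integral>l. cos (2 * pi * (l \<bullet> (p - q))) * fourier_cross lborel ?b ?b l \<partial>count_space \<Lambda>) = 0"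
    if pq: "p \<in> ?G" "q \<in> ?G" "p \<noteq> q" for p q
  proof -
    let ?u = "p - q"
    have u: "d \<le> norm ?u" "norm ?u \<le> R" using square_grid_dist[OF d(1) pq(1,2)] pq(3) d(2) by auto
    obtain U where sub: "ball ?u (c * norm ?u) \<subseteq> U" and U: "off_diagonal_pairing M U"
      using pairing[OF _ order_trans[OF u(2) R(2)]] pq(3) by auto
    have supp: "autocorrelation ?b (v - ?u) = 0" if v: "v \<notin> U" for v
    proof (rule autocorrelation_smoothed_restriction[OF fin sets eps])
      have "4 * \<epsilon> = k * d / 2" by (simp add: \<epsilon>_def)
      also have "\<dots> < k * d" using k d by simp
      also have "\<dots> \<le> c * norm ?u" using k u d by (intro mult_mono) auto
      also have "\<dots> \<le> norm (v - ?u)"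
      proof -
        have "v \<notin> ball ?u (c * norm ?u)" using v sub by blast
        then show ?thesis unfolding mem_ball by (simp add: dist_norm norm_minus_commute)
      qed
      finally show "4 * \<epsilon> < norm (v - ?u)" .
    qed
    note pv = power_spectrum_vanishes[OF U bounded_smoothed_restriction[OF fin sets eps] integrable_smoothed_restriction[OF fin sets eps] supp]
    show "integrable (count_space \<Lambda>) (\<lambda>l. cos (2 * pi * (l \<bullet> (p - q))) * fourier_cross lborel ?b ?b l)"
      by (rule pv(1))
    show "(\<integral>l. cos (2 * pi * (l \<bullet> (p - q))) * fourier_cross lborel ?b ?b l \<partial>count_space \<Lambda>) = 0"
      by (rule pv(2))
  qed
  have near: "2 * pi * norm l0 * norm p \<le> pi / 3" if "p \<in> ?G" for p
    using square_grid_dist(3)[OF d(1) that that] d(2) by (intro l0_small) auto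
  define N where "N = real (n * n)"
  have N: "0 < N" using n by (simp add: N_def)
  have "N\<^sup>2 / 4 * (?m\<^sup>2 * ?V\<^sup>2 / 16) \<le> N\<^sup>2 / 4 * fourier_cross lborel ?b ?b l0"
    by (intro mult_left_mono fourier_cross_smoothed_restriction_ge[OF fin sets eps] l0_small) (use eps eps_R in auto)
  also have "\<dots> \<le> N * (\<integral>l. fourier_cross lborel ?b ?b l \<partial>count_space \<Lambda>)"
    using separated_points_bound[OF Bint _ l0 square_grid_card(1)[OF d(1), of n] near vanish]
    by (simp add: square_grid_card(2)[OF d(1)] N_def fourier_cross_def)
  also have "\<dots> \<le> N * (?V\<^sup>2 * (A * ?m))" using Ble N by (intro mult_left_mono) auto
  finally have main: "N\<^sup>2 / 4 * (?m\<^sup>2 * ?V\<^sup>2 / 16) \<le> N * (?V\<^sup>2 * (A * ?m))" .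
  have V: "0 < ?V" using content_cball_pos[OF eps, of "0::real^2"] by simp
  have m: "c' * \<epsilon> \<le> ?m" using lower[OF eps eps_e0] .
  then have m0: "0 < ?m" using c' eps by (smt (verit) mult_pos_pos)
  have "(N * ?V\<^sup>2 * ?m) * (N * ?m) \<le> (N * ?V\<^sup>2 * ?m) * (64 * A)"
    using main by (simp add: power2_eq_square field_simps)
  moreover have "0 < N * ?V\<^sup>2 * ?m" using N V m0 by simp
  ultimately have Nm: "N * ?m \<le> 64 * A" by (rule mult_left_le_imp_le)
  have "real n * (c' * k * R / 16) = N * (c' * \<epsilon>)" using n by (simp add: N_def eps_eq field_simps)
  also have "\<dots> \<le> 64 * A" using mult_left_mono[OF m, of N] N Nm by linarith
  finally have "real n * (c' * k * R / 16) \<le> 64 * A" .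
  moreover have "64 * A < real n * (c' * k * R / 16)" using n(3) c' k R by (simp add: field_simps)
  ultimately show False by simp
qed

section \<open>Combining off-diagonal pairings\<close>

text \<open>Exchanging the two variables of the kernel reflects differences.\<close>

lemma off_diagonal_pairing_uminus:
  assumes fin: "finite_measure M" and sets: "sets M = sets borel"
    and U: "off_diagonal_pairing M U"
  shows "off_diagonal_pairing M (uminus ` U)"
proof -
  interpret finite_measure M by (rule fin)
  note [measurable_cong] = sets
  interpret MM: pair_sigma_finite M M ..
  have bdd: "bounded U" and borel [measurable]: "U \<in> sets borel"
    using U by (auto simp: off_diagonal_pairing_def)
  obtain n \<rho> \<sigma> where k: "off_diagonal_kernel M U n \<rho> \<sigma>"
    using U unfolding off_diagonal_pairing_def by blast
  note rs = off_diagonal_kernelD(1-3)[OF k] and rep = off_diagonal_kernelD(4)[OF k]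
  have um: "uminus ` U = uminus -` U" by (auto simp: image_iff) (metis minus_minus)
  have "(uminus :: 'a \<Rightarrow> 'a) -` U \<in> sets borel"
    using measurable_sets_borel[of uminus borel U] by simp
  show ?thesis
    unfolding off_diagonal_pairing_def
  proof (intro conjI, goal_cases)
    case 1 show ?case using bdd by simp
  next
    case 2 show ?case unfolding um by fact
  next
    case 3 show ?case
      unfolding off_diagonal_kernel_def
    proof (rule exI[of _ n], rule exI[of _ \<sigma>], rule exI[of _ \<rho>], intro conjI allI impI)
      fix \<psi> :: "'a \<Rightarrow> real"
      assume psi: "bounded_borel \<psi>"
      have [measurable]: "\<psi> \<in> borel_measurable borel" using psi by (rule bounded_borel_measurable)
      have "(\<Sum>j<n. \<integral>p. \<sigma> j (fst p) * \<rho> j (snd p) * \<psi> (fst p - snd p) \<partial>(M \<Otimes>\<^sub>M M))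
          = (\<Sum>j<n. \<integral>p. \<rho> j (fst p) * \<sigma> j (snd p) * \<psi> (- (fst p - snd p)) \<partial>(M \<Otimes>\<^sub>M M))"
      proof (rule sum.cong[OF refl])
        fix j assume "j \<in> {..<n}"
        then have [measurable]: "\<rho> j \<in> borel_measurable borel" "\<sigma> j \<in> borel_measurable borel"
          using rs by (auto intro: bounded_borel_measurable)
        have "(\<lambda>p. \<rho> j (fst p) * \<sigma> j (snd p) * \<psi> (- (fst p - snd p))) \<in> borel_measurable (M \<Otimes>\<^sub>M M)"
          by measurable
        from MM.integral_product_swap[OF this]
        show "(\<integral>p. \<sigma> j (fst p) * \<rho> j (snd p) * \<psi> (fst p - snd p) \<partial>(M \<Otimes>\<^sub>M M))
            = (\<integral>p. \<rho> j (fst p) * \<sigma> j (snd p) * \<psi> (- (fst p - snd p)) \<partial>(M \<Otimes>\<^sub>M M))"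
          by (simp add: case_prod_unfold mult_ac)
      qed
      also have "\<dots> = (\<integral>v. indicator U v * \<psi> (- v) \<partial>lborel)"
        by (rule rep) (rule bounded_borel_compose[OF psi], measurable)
      also have "\<dots> = (\<integral>v. indicator U (- v) * \<psi> v \<partial>lborel)"
        using lborel_integral_reflect[of "\<lambda>v. indicator U (- v) * \<psi> v" 0] by simp
      also have "\<dots> = (\<integral>v. indicator (uminus ` U) v * \<psi> v \<partial>lborel)"
        by (simp add: um indicator_def)
      finally show "(\<Sum>j<n. \<integral>p. \<sigma> j (fst p) * \<rho> j (snd p) * \<psi> (fst p - snd p) \<partial>(M \<Otimes>\<^sub>M M))
         = (\<integral>v. indicator (uminus ` U) v * \<psi> v \<partial>lborel)" .
    qed (use rs in \<open>auto simp: mult.commute\<close>)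
  qed
qed

lemma sum_lessThan_plus:
  fixes f :: "nat \<Rightarrow> 'b::comm_monoid_add"
  shows "(\<Sum>j<m + n. f j) = (\<Sum>j<m. f j) + (\<Sum>j<n. f (m + j))"
  by (induction n) (auto simp: add.assoc)

lemma off_diagonal_pairing_Un:
  assumes U: "off_diagonal_pairing M U" and U': "off_diagonal_pairing M U'" and disj: "U \<inter> U' = {}"
  shows "off_diagonal_pairing M (U \<union> U')"
proof -
  have b: "bounded U" "U \<in> sets borel" and b': "bounded U'" "U' \<in> sets borel"
    using U U' by (auto simp: off_diagonal_pairing_def)
  obtain n \<rho> \<sigma> where k: "off_diagonal_kernel M U n \<rho> \<sigma>"
    using U unfolding off_diagonal_pairing_def by blast
  obtain n' \<rho>' \<sigma>' where k': "off_diagonal_kernel M U' n' \<rho>' \<sigma>'"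
    using U' unfolding off_diagonal_pairing_def by blast
  note rs = off_diagonal_kernelD(1-3)[OF k] and rep = off_diagonal_kernelD(4)[OF k]
  note rs' = off_diagonal_kernelD(1-3)[OF k'] and rep' = off_diagonal_kernelD(4)[OF k']
  define R where "R j = (if j < n then \<rho> j else \<rho>' (j - n))" for j
  define S where "S j = (if j < n then \<sigma> j else \<sigma>' (j - n))" for j
  show ?thesis
    unfolding off_diagonal_pairing_def
  proof (intro conjI, goal_cases)
    case 1 show ?case using b b' by simp
  next
    case 2 show ?case using b b' by simp
  next
    case 3 show ?case
      unfolding off_diagonal_kernel_def
    proof (rule exI[of _ "n + n'"], rule exI[of _ R], rule exI[of _ S], intro conjI allI impI)
      fix \<psi> :: "'a \<Rightarrow> real"
      assume psi: "bounded_borel \<psi>"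
      have I: "integrable lborel (\<lambda>v. indicator W v * \<psi> v)" if W: "bounded W" "W \<in> sets borel" for W
      proof -
        have "emeasure lborel W < \<infinity>" using W(1) by (rule emeasure_bounded_finite)
        then have "integrable lborel (\<lambda>v. \<psi> v * indicator W v)"
          using W by (intro integrable_mult_bounded_borel psi integrable_real_indicator) auto
        then show ?thesis by (simp add: mult.commute)
      qed
      have "(\<Sum>j<n + n'. \<integral>p. R j (fst p) * S j (snd p) * \<psi> (fst p - snd p) \<partial>(M \<Otimes>\<^sub>M M))
         = (\<integral>v. indicator U v * \<psi> v \<partial>lborel) + (\<integral>v. indicator U' v * \<psi> v \<partial>lborel)"
        unfolding sum_lessThan_plus rep[OF psi, symmetric] rep'[OF psi, symmetric]
        by (simp add: R_def S_def)
      also have "\<dots> = (\<integral>v. indicator U v * \<psi> v + indicator U' v * \<psi> v \<partial>lborel)"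
        by (rule Bochner_Integration.integral_add[symmetric]) (intro I b b')+
      also have "\<dots> = (\<integral>v. indicator (U \<union> U') v * \<psi> v \<partial>lborel)"
        using disj by (intro Bochner_Integration.integral_cong) (auto simp: indicator_def)
      finally show "(\<Sum>j<n + n'. \<integral>p. R j (fst p) * S j (snd p) * \<psi> (fst p - snd p) \<partial>(M \<Otimes>\<^sub>M M))
         = (\<integral>v. indicator (U \<union> U') v * \<psi> v \<partial>lborel)" .
    next
      fix j x assume j: "j < n + n'"
      show "bounded_borel (R j)" "bounded_borel (S j)" "R j x * S j x = 0"
        using rs[of j] rs'[of "j - n"] j by (auto simp: R_def S_def)
    qed
  qed
qed

lemma off_diagonal_pairing_empty: "off_diagonal_pairing M {}"
  unfolding off_diagonal_pairing_def off_diagonal_kernel_def by (auto intro!: exI[of _ "0::nat"])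

lemma off_diagonal_pairing_UN:
  assumes "finite I" "\<And>i. i \<in> I \<Longrightarrow> off_diagonal_pairing M (U i)"
    "\<And>i j. i \<in> I \<Longrightarrow> j \<in> I \<Longrightarrow> i \<noteq> j \<Longrightarrow> U i \<inter> U j = {}"
  shows "off_diagonal_pairing M (\<Union>i\<in>I. U i)"
  using assms
proof (induction rule: finite_induct)
  case empty
  then show ?case by (simp add: off_diagonal_pairing_empty)
next
  case (insert i F)
  have "U i \<inter> (\<Union>j\<in>F. U j) = {}" using insert.prems(2)[of i] insert.hyps by fastforce
  moreover have "off_diagonal_pairing M (U i)" "off_diagonal_pairing M (\<Union>j\<in>F. U j)"
    using insert by simp_all
  ultimately have "off_diagonal_pairing M (U i \<union> (\<Union>j\<in>F. U j))" by (intro off_diagonal_pairing_Un)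
  then show ?case by simp
qed

section \<open>Bounded densities of parametrised curves\<close>

text \<open>A quantitative absolute continuity: the image of Lebesgue measure on \<open>I\<close> under \<open>h\<close> is at most a constant
  times \<open>M\<close>. It guarantees bounded densities with respect to \<open>M\<close>, as pairings require.\<close>

definition dominated_param :: "'a::euclidean_space measure \<Rightarrow> real set \<Rightarrow> (real \<Rightarrow> 'a) \<Rightarrow> bool" where
  "dominated_param M I h \<longleftrightarrow> I \<in> sets borel \<and> bounded I \<and> h \<in> borel_measurable borel \<and>
     (\<exists>C::real. \<forall>B\<in>sets borel. emeasure lborel (I \<inter> h -` B) \<le> ennreal C * emeasure M B)"

text \<open>The Radon-Nikodym density of the image measure exists by domination, and is almost everywhere at
  most the constant of the domination; truncating it there makes it bounded everywhere.\<close>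

lemma dominated_param_density_nonneg:
  fixes M :: "'a::euclidean_space measure"
  assumes fin: "finite_measure M" and sets: "sets M = sets borel" and dom: "dominated_param M I h"
    and a: "bounded_borel \<alpha>" "\<And>s. 0 \<le> \<alpha> s"
  obtains r where "bounded_borel r"
    "\<And>k. bounded_borel k \<Longrightarrow> (\<integral>s. indicator I s * \<alpha> s * k (h s) \<partial>lborel) = (\<integral>x. r x * k x \<partial>M)"
proof -
  interpret finite_measure M by (rule fin)
  note [measurable_cong] = sets
  have [measurable]: "I \<in> sets borel" "h \<in> borel_measurable borel" and bdd: "bounded I"
    using dom by (simp_all add: dominated_param_def)
  obtain C where "\<forall>B\<in>sets borel. emeasure lborel (I \<inter> h -` B) \<le> ennreal C * emeasure M B"
    using dom unfolding dominated_param_def by (elim conjE exE) (rule that)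
  note C = this[rule_format]
  have [measurable]: "\<alpha> \<in> borel_measurable borel" using a(1) by (rule bounded_borel_measurable)
  obtain a0 where a0: "0 \<le> a0" "\<And>s. \<bar>\<alpha> s\<bar> \<le> a0" by (rule bounded_borelE[OF a(1)], rule that)
  define w where "w s = indicator I s * \<alpha> s" for s
  have w [measurable]: "w \<in> borel_measurable borel" unfolding w_def by measurable
  have w0: "0 \<le> w s" for s using a by (simp add: w_def)
  define \<nu> where "\<nu> = distr (density lborel (\<lambda>s. ennreal (w s))) borel h"
  have sets_\<nu> [measurable_cong]: "sets \<nu> = sets borel" by (simp add: \<nu>_def)
  define K where "K = a0 * max C 0"
  have K: "0 \<le> K" using a0 by (simp add: K_def)
  have \<nu>_le: "emeasure \<nu> B \<le> ennreal K * emeasure M B" if B [measurable]: "B \<in> sets borel" for B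
  proof -
    have [measurable]: "h -` B \<in> sets borel" using measurable_sets_borel[of h borel B] by simp
    have "emeasure \<nu> B = (\<integral>\<^sup>+s. ennreal (w s) * indicator (h -` B) s \<partial>lborel)"
      unfolding \<nu>_def by (simp add: emeasure_distr emeasure_density)
    also have "\<dots> \<le> (\<integral>\<^sup>+s. ennreal a0 * indicator (I \<inter> h -` B) s \<partial>lborel)"
    proof (rule nn_integral_mono)
      fix s
      have "\<alpha> s \<le> a0" using a0(2)[of s] by linarith
      then show "ennreal (w s) * indicator (h -` B) s \<le> ennreal a0 * indicator (I \<inter> h -` B) s"
        by (cases "s \<in> I"; cases "h s \<in> B") (simp_all add: w_def ennreal_leI)
    qed
    also have "\<dots> = ennreal a0 * emeasure lborel (I \<inter> h -` B)"
      by (rule nn_integral_cmult_indicator) simp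
    also have "\<dots> \<le> ennreal a0 * (ennreal (max C 0) * emeasure M B)"
      by (intro mult_left_mono order_trans[OF C[OF B]] mult_right_mono ennreal_leI) auto
    finally show ?thesis using a0 by (simp add: K_def ennreal_mult mult.assoc)
  qed
  have "absolutely_continuous M \<nu>"
    unfolding absolutely_continuous_def
  proof
    fix B assume "B \<in> null_sets M"
    then have "B \<in> sets borel" "emeasure M B = 0" using sets by auto
    then show "B \<in> null_sets \<nu>" using \<nu>_le[of B] sets_\<nu> by (auto simp: null_sets_def)
  qed
  then obtain f where f [measurable]: "f \<in> borel_measurable M" and f\<nu>: "density M f = \<nu>"
    using Radon_Nikodym[of \<nu>] sets sets_\<nu> by auto
  \<comment> \<open>The set where the density exceeds \<open>K\<close> is null, by comparing \<open>\<nu> B\<close> with \<open>K * M B\<close>.\<close>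
  define B where "B = {x. ennreal K < f x}"
  have B [measurable]: "B \<in> sets borel"
  proof -
    have "f \<in> borel_measurable borel" using f by (simp cong: measurable_cong_sets add: sets)
    then show ?thesis unfolding B_def by measurable
  qed
  have "(\<integral>\<^sup>+x. f x * indicator B x - ennreal K * indicator B x \<partial>M)
      = (\<integral>\<^sup>+x. f x * indicator B x \<partial>M) - (\<integral>\<^sup>+x. ennreal K * indicator B x \<partial>M)"
  proof (rule nn_integral_diff)
    show "(\<integral>\<^sup>+x. ennreal K * indicator B x \<partial>M) \<noteq> \<infinity>"
      using B by (simp add: nn_integral_cmult_indicator sets ennreal_mult_eq_top_iff)
    show "AE x in M. ennreal K * indicator B x \<le> f x * indicator B x"
      by (intro AE_I2) (auto simp: B_def indicator_def)
  qed measurable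
  also have "(\<integral>\<^sup>+x. f x * indicator B x \<partial>M) = emeasure \<nu> B"
    unfolding f\<nu>[symmetric] by (rule emeasure_density[symmetric]) (use B sets in auto)
  also have "(\<integral>\<^sup>+x. ennreal K * indicator B x \<partial>M) = ennreal K * emeasure M B"
    by (rule nn_integral_cmult_indicator) (use B sets in auto)
  also have "emeasure \<nu> B - ennreal K * emeasure M B = 0"
  proof (rule diff_eq_0_ennreal)
    have "emeasure M B < top" by (metis emeasure_finite infinity_ennreal_def top.not_eq_extremum)
    then have "ennreal K * emeasure M B < top" by (simp add: ennreal_mult_less_top)
    then show "emeasure \<nu> B < top" using \<nu>_le[OF B] by (rule le_less_trans[rotated])
  qed (rule \<nu>_le[OF B])
  finally have "AE x in M. f x * indicator B x - ennreal K * indicator B x = 0"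
    by (subst (asm) nn_integral_0_iff_AE) auto
  then have fK: "AE x in M. f x \<le> ennreal K"
  proof eventually_elim
    case (elim x)
    show ?case
    proof (rule ccontr)
      assume "\<not> f x \<le> ennreal K"
      then have "f x - ennreal K = 0" "ennreal K < f x" using elim by (auto simp: B_def)
      then show False using ennreal_minus_eq_0[of "f x" "ennreal K"] by simp
    qed
  qed
  define r where "r x = enn2real (min (f x) (ennreal K))" for x
  have fr: "AE x in M. f x = ennreal (r x)"
    using fK proof eventually_elim
    case (elim x)
    then have "f x < top" by (rule le_less_trans) simp
    then show ?case using elim by (simp add: r_def min_absorb1)
  qed
  have rm [measurable]: "r \<in> borel_measurable borel"
  proof -
    have "r \<in> borel_measurable M" unfolding r_def by measurable
    then show ?thesis by (simp cong: measurable_cong_sets add: sets)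
  qed
  have r0: "0 \<le> r x" for x by (simp add: r_def)
  have rK: "r x \<le> K" for x
    using enn2real_mono[of "min (f x) (ennreal K)" "ennreal K"] K by (simp add: r_def)
  have dens: "\<nu> = density M (\<lambda>x. ennreal (r x))"
    unfolding f\<nu>[symmetric] by (rule density_cong) (use fr in auto)
  show ?thesis
  proof (rule that)
    show "bounded_borel r" by (rule bounded_borelI[where B=K]) (use rm r0 rK in auto)
    fix k :: "'a \<Rightarrow> real" assume k: "bounded_borel k"
    have [measurable]: "k \<in> borel_measurable borel" using k by (rule bounded_borel_measurable)
    have "(\<integral>s. indicator I s * \<alpha> s * k (h s) \<partial>lborel) = (\<integral>s. w s *\<^sub>R k (h s) \<partial>lborel)"
      by (simp add: w_def)
    also have "\<dots> = (\<integral>s. k (h s) \<partial>density lborel (\<lambda>s. ennreal (w s)))"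
      by (rule integral_density[symmetric]) (use w0 in auto)
    also have "\<dots> = (\<integral>x. k x \<partial>\<nu>)"
      unfolding \<nu>_def by (rule integral_distr[symmetric]) auto
    also have "\<dots> = (\<integral>x. r x *\<^sub>R k x \<partial>M)"
      unfolding dens by (rule integral_density) (use r0 in auto)
    finally show "(\<integral>s. indicator I s * \<alpha> s * k (h s) \<partial>lborel) = (\<integral>x. r x * k x \<partial>M)" by simp
  qed
qed

text \<open>A weight of varying sign is a difference of two nonnegative ones. Cutting the density down to \<open>S\<close> is
  harmless as the image measure lives on \<open>S\<close>, and it provides supports that are disjoint pointwise and
  not only up to null sets.\<close>

lemma dominated_param_density:
  fixes M :: "'a::euclidean_space measure"
  assumes fin: "finite_measure M" and sets: "sets M = sets borel" and dom: "dominated_param M I h"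
    and S: "h ` I \<subseteq> S" "S \<in> sets borel" and a: "bounded_borel (\<lambda>s. indicator I s * \<alpha> s)"
  obtains r where "bounded_borel r" "\<And>x. x \<notin> S \<Longrightarrow> r x = 0"
    "\<And>k. bounded_borel k \<Longrightarrow> (\<integral>s. indicator I s * \<alpha> s * k (h s) \<partial>lborel) = (\<integral>x. r x * k x \<partial>M)"
proof -
  let ?a = "\<lambda>s. indicator I s * \<alpha> s"
  have am [measurable]: "?a \<in> borel_measurable borel" using a by (rule bounded_borel_measurable)
  obtain a0 where a0: "0 \<le> a0" "\<And>s. \<bar>?a s\<bar> \<le> a0" by (rule bounded_borelE[OF a], rule that)
  have p: "bounded_borel (\<lambda>s. ?a s + a0)" "\<And>s. 0 \<le> ?a s + a0"
  proof -
    show "bounded_borel (\<lambda>s. ?a s + a0)"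
      by (intro bounded_borel_add a bounded_borelI[where B=a0]) (use a0 in auto)
    show "0 \<le> ?a s + a0" for s using a0(2)[of s] by linarith
  qed
  have c: "bounded_borel (\<lambda>s. a0)" "\<And>s. 0 \<le> a0"
    using a0 by (auto intro!: bounded_borelI[where B=a0])
  obtain r1 where r1: "bounded_borel r1"
    "\<And>k. bounded_borel k \<Longrightarrow> (\<integral>s. indicator I s * (?a s + a0) * k (h s) \<partial>lborel) = (\<integral>x. r1 x * k x \<partial>M)"
    by (rule dominated_param_density_nonneg[OF fin sets dom p], rule that)
  obtain r2 where r2: "bounded_borel r2"
    "\<And>k. bounded_borel k \<Longrightarrow> (\<integral>s. indicator I s * a0 * k (h s) \<partial>lborel) = (\<integral>x. r2 x * k x \<partial>M)"
    by (rule dominated_param_density_nonneg[OF fin sets dom c], rule that)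
  have I: "I \<in> sets borel" "bounded I" and h [measurable]: "h \<in> borel_measurable borel"
    using dom by (auto simp: dominated_param_def)
  have Iint: "integrable lborel (\<lambda>s. indicator I s * u s)" if "bounded_borel u" for u
  proof -
    have "emeasure lborel I < \<infinity>" using I(2) by (rule emeasure_bounded_finite)
    then have "integrable lborel (\<lambda>s. u s * indicator I s)"
      using I by (intro integrable_mult_bounded_borel that integrable_real_indicator) auto
    then show ?thesis by (simp add: mult.commute)
  qed
  show ?thesis
  proof (rule that[of "\<lambda>x. indicator S x * (r1 x - r2 x)"])
    show "bounded_borel (\<lambda>x. indicator S x * (r1 x - r2 x))"
      by (intro bounded_borel_mult bounded_borel_indicator S bounded_borel_diff r1 r2)
    show "indicator S x * (r1 x - r2 x) = 0" if "x \<notin> S" for x using that by simp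
    fix k :: "'a \<Rightarrow> real" assume k: "bounded_borel k"
    have kS: "bounded_borel (\<lambda>x. indicator S x * k x)"
      by (intro bounded_borel_mult bounded_borel_indicator S k)
    have kh: "bounded_borel (\<lambda>s. k (h s))" by (rule bounded_borel_compose[OF k h])
    have "(\<integral>s. indicator I s * \<alpha> s * k (h s) \<partial>lborel)
        = (\<integral>s. indicator I s * ((?a s + a0) * k (h s)) - indicator I s * (a0 * k (h s)) \<partial>lborel)"
      by (intro Bochner_Integration.integral_cong) (auto simp: indicator_def algebra_simps)
    also have "\<dots> = (\<integral>s. indicator I s * ((?a s + a0) * k (h s)) \<partial>lborel) - (\<integral>s. indicator I s * (a0 * k (h s)) \<partial>lborel)"
      by (intro Bochner_Integration.integral_diff Iint bounded_borel_mult p c kh)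
    also have "\<dots> = (\<integral>s. indicator I s * (?a s + a0) * (indicator S (h s) * k (h s)) \<partial>lborel)
        - (\<integral>s. indicator I s * a0 * (indicator S (h s) * k (h s)) \<partial>lborel)"
      using S(1) by (intro arg_cong2[where f="(-)"] Bochner_Integration.integral_cong) (auto simp: indicator_def)
    also have "\<dots> = (\<integral>x. r1 x * (indicator S x * k x) \<partial>M) - (\<integral>x. r2 x * (indicator S x * k x) \<partial>M)"
      by (simp only: r1(2)[OF kS] r2(2)[OF kS])
    also have "\<dots> = (\<integral>x. r1 x * (indicator S x * k x) - r2 x * (indicator S x * k x) \<partial>M)"
      by (intro Bochner_Integration.integral_diff[symmetric] integrable_bounded_borel[OF fin sets] bounded_borel_mult r1 r2 kS)
    also have "\<dots> = (\<integral>x. indicator S x * (r1 x - r2 x) * k x \<partial>M)"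
      by (simp add: algebra_simps)
    finally show "(\<integral>s. indicator I s * \<alpha> s * k (h s) \<partial>lborel) = (\<integral>x. indicator S x * (r1 x - r2 x) * k x \<partial>M)" .
  qed
qed

section \<open>Pairings from two parametrised curves\<close>

lemma real2_coords [simp]:
  "(s *\<^sub>R axis 1 1 + t *\<^sub>R axis 2 1 :: real^2) $ 1 = s"
  "(s *\<^sub>R axis 1 1 + t *\<^sub>R axis 2 1 :: real^2) $ 2 = t"
  by (simp_all add: axis_def)

lemma real2_measurable [measurable]:
  "(\<lambda>p. fst p *\<^sub>R axis 1 1 + snd p *\<^sub>R axis 2 1 :: real^2) \<in> borel_measurable borel"
  by (intro borel_measurable_continuous_onI continuous_intros)

lemma lborel_real2:
  "distr (lborel :: (real \<times> real) measure) borel (\<lambda>p. fst p *\<^sub>R axis 1 1 + snd p *\<^sub>R axis 2 1) = (lborel :: (real^2) measure)"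
proof (rule lborel_eqI[symmetric])
  let ?f = "\<lambda>p. fst p *\<^sub>R axis 1 1 + snd p *\<^sub>R axis 2 1 :: real^2"
  fix l u :: "real^2"
  assume le: "\<And>b. b \<in> Basis \<Longrightarrow> l \<bullet> b \<le> u \<bullet> b"
  have B: "(Basis :: (real^2) set) = {axis 1 1, axis 2 1}"
    by (auto simp: Basis_vec_def UNIV_2)
  have ne: "axis 1 1 \<noteq> (axis 2 1 :: real^2)" by (simp add: axis_eq_axis)
  have le': "l $ 1 \<le> u $ 1" "l $ 2 \<le> u $ 2"
    using le[of "axis 1 1"] le[of "axis 2 1"] by (simp_all add: B inner_axis)
  have "?f -` box l u = {l $ 1 <..< u $ 1} \<times> {l $ 2 <..< u $ 2}"
    by (auto simp: mem_box_cart forall_2 axis_def)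
  then have "emeasure (distr lborel borel ?f) (box l u) = emeasure (lborel \<Otimes>\<^sub>M lborel) ({l $ 1 <..< u $ 1} \<times> {l $ 2 <..< u $ 2})"
    by (subst emeasure_distr) (use real2_measurable in \<open>simp_all add: lborel_prod\<close>)
  also have "\<dots> = ennreal (u $ 1 - l $ 1) * ennreal (u $ 2 - l $ 2)"
    using le' by (subst lborel.emeasure_pair_measure_Times) auto
  also have "\<dots> = (\<Prod>b\<in>Basis. (u - l) \<bullet> b)"
    using le' ne by (simp add: B inner_axis ennreal_mult)
  finally show "emeasure (distr lborel borel ?f) (box l u) = (\<Prod>b\<in>Basis. (u - l) \<bullet> b)" .
qed simp

lemma lborel_real2_integral:
  fixes f :: "real^2 \<Rightarrow> real"
  assumes [measurable]: "f \<in> borel_measurable borel"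
  shows "(\<integral>x. f x \<partial>lborel) = (\<integral>p. f (fst p *\<^sub>R axis 1 1 + snd p *\<^sub>R axis 2 1) \<partial>(lborel \<Otimes>\<^sub>M lborel))"
  unfolding lborel_prod lborel_real2[symmetric] by (rule integral_distr) (use real2_measurable in simp_all)

lemma integrable_bounded_support:
  fixes f :: "'a::euclidean_space \<Rightarrow> real"
  assumes "bounded_borel f" "bounded W" "\<And>x. x \<notin> W \<Longrightarrow> f x = 0"
  shows "integrable lborel f"
proof -
  obtain r where r: "\<And>v. v \<in> W \<Longrightarrow> norm v \<le> r" using assms(2) by (auto simp: bounded_iff)
  have "integrable lborel (\<lambda>v. f v * indicator (cball 0 r) v)"
    by (intro integrable_mult_bounded_borel assms integrable_real_indicator emeasure_lborel_cball_finite) auto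
  moreover have "f v * indicator (cball 0 r) v = f v" for v
    using assms(3)[of v] r[of v] by (auto simp: indicator_def)
  ultimately show ?thesis by simp
qed

text \<open>Two curves can be treated one after the other: integrating over the second one first gives a bounded
  Borel function of the point on the first.\<close>

lemma dominated_tensor:
  fixes M :: "'a::euclidean_space measure"
  assumes fin: "finite_measure M" and sets: "sets M = sets borel"
    and d1: "dominated_param M I h1" "h1 ` I \<subseteq> S1" "S1 \<in> sets borel" "bounded_borel (\<lambda>s. indicator I s * \<alpha> s)"
    and d2: "dominated_param M J h2" "h2 ` J \<subseteq> S2" "S2 \<in> sets borel" "bounded_borel (\<lambda>s. indicator J s * \<beta> s)"
  shows "\<exists>\<rho> \<sigma>. bounded_borel \<rho> \<and> bounded_borel \<sigma> \<and> (\<forall>x. x \<notin> S1 \<longrightarrow> \<rho> x = 0) \<and> (\<forall>x. x \<notin> S2 \<longrightarrow> \<sigma> x = 0) \<and>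
    (\<forall>\<psi>. bounded_borel \<psi> \<longrightarrow>
       (\<integral>p. indicator I (fst p) * \<alpha> (fst p) * (indicator J (snd p) * \<beta> (snd p)) * \<psi> (h1 (fst p) - h2 (snd p)) \<partial>(lborel \<Otimes>\<^sub>M lborel))
       = (\<integral>p. \<rho> (fst p) * \<sigma> (snd p) * \<psi> (fst p - snd p) \<partial>(M \<Otimes>\<^sub>M M)))"
proof -
  interpret finite_measure M by (rule fin)
  note [measurable_cong] = sets
  interpret MM: pair_sigma_finite M M ..
  interpret MM2: finite_measure "M \<Otimes>\<^sub>M M" by (rule finite_measure_pair_measure) unfold_locales
  have I: "bounded I" "bounded J" and h [measurable]: "h1 \<in> borel_measurable borel" "h2 \<in> borel_measurable borel"
    using d1(1) d2(1) by (auto simp: dominated_param_def)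
  obtain \<rho> where r: "bounded_borel \<rho>" "\<And>x. x \<notin> S1 \<Longrightarrow> \<rho> x = 0"
    "\<And>k. bounded_borel k \<Longrightarrow> (\<integral>s. indicator I s * \<alpha> s * k (h1 s) \<partial>lborel) = (\<integral>x. \<rho> x * k x \<partial>M)"
    by (rule dominated_param_density[OF fin sets d1], rule that)
  obtain \<sigma> where s: "bounded_borel \<sigma>" "\<And>x. x \<notin> S2 \<Longrightarrow> \<sigma> x = 0"
    "\<And>k. bounded_borel k \<Longrightarrow> (\<integral>s. indicator J s * \<beta> s * k (h2 s) \<partial>lborel) = (\<integral>x. \<sigma> x * k x \<partial>M)"
    by (rule dominated_param_density[OF fin sets d2], rule that)
  note [measurable] = r(1)[THEN bounded_borel_measurable] s(1)[THEN bounded_borel_measurable]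
  show ?thesis
  proof (rule exI[of _ \<rho>], rule exI[of _ \<sigma>], intro conjI allI impI)
    fix \<psi> :: "'a \<Rightarrow> real" assume psi: "bounded_borel \<psi>"
    note [measurable] = bounded_borel_measurable[OF psi]
    obtain P where P: "0 \<le> P" "\<And>x. \<bar>\<psi> x\<bar> \<le> P" by (rule bounded_borelE[OF psi], rule that)
    obtain R where R: "0 \<le> R" "\<And>x. \<bar>\<rho> x\<bar> \<le> R" by (rule bounded_borelE[OF r(1)], rule that)
    obtain S where S: "0 \<le> S" "\<And>x. \<bar>\<sigma> x\<bar> \<le> S" by (rule bounded_borelE[OF s(1)], rule that)
    let ?u = "\<lambda>s. indicator I s * \<alpha> s" and ?v = "\<lambda>t. indicator J t * \<beta> t"
    let ?F = "\<lambda>p. ?u (fst p) * ?v (snd p) * \<psi> (h1 (fst p) - h2 (snd p))"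
    have m: "fst \<in> borel_measurable (borel :: (real \<times> real) measure)" "snd \<in> borel_measurable (borel :: (real \<times> real) measure)"
      by (intro borel_measurable_continuous_onI continuous_intros)+
    have hm: "(\<lambda>p. h1 (fst p) - h2 (snd p)) \<in> borel_measurable borel"
      unfolding borel_prod[symmetric] by measurable
    have Fb: "bounded_borel ?F"
      by (rule bounded_borel_mult[OF bounded_borel_mult[OF bounded_borel_compose[OF d1(4) m(1)] bounded_borel_compose[OF d2(4) m(2)]] bounded_borel_compose[OF psi hm]])
    have "integrable lborel ?F"
      by (rule integrable_bounded_support[OF Fb, of "I \<times> J"]) (use I in \<open>auto simp: bounded_Times indicator_def\<close>)
    then have Fi: "integrable (lborel \<Otimes>\<^sub>M lborel) ?F" by (simp add: lborel_prod)
    have sub: "bounded_borel (\<lambda>y. \<psi> (x - y))" for x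
      by (rule bounded_borel_compose[OF psi]) measurable
    define k where "k x = (\<integral>y. \<sigma> y * \<psi> (x - y) \<partial>M)" for x
    have k: "bounded_borel k"
    proof (rule bounded_borelI)
      show "k \<in> borel_measurable borel" unfolding k_def by measurable
      fix x
      have "\<bar>k x\<bar> \<le> (\<integral>y. \<bar>\<sigma> y * \<psi> (x - y)\<bar> \<partial>M)" unfolding k_def by (rule integral_abs_bound)
      also have "\<dots> \<le> (\<integral>y. S * P \<partial>M)"
      proof (rule integral_mono)
        show "integrable M (\<lambda>y. \<bar>\<sigma> y * \<psi> (x - y)\<bar>)"
          by (intro integrable_abs integrable_bounded_borel[OF fin sets] bounded_borel_mult s sub)
        show "\<bar>\<sigma> y * \<psi> (x - y)\<bar> \<le> S * P" for y unfolding abs_mult by (rule mult_mono') (use S P in auto)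
      qed simp
      finally show "\<bar>k x\<bar> \<le> S * P * measure M (space M)" by (simp add: mult_ac)
    qed
    have int2: "integrable (M \<Otimes>\<^sub>M M) (\<lambda>p. \<rho> (fst p) * \<sigma> (snd p) * \<psi> (fst p - snd p))"
    proof (rule MM2.integrable_const_bound[where B="R * S * P"])
      show "AE p in M \<Otimes>\<^sub>M M. norm (\<rho> (fst p) * \<sigma> (snd p) * \<psi> (fst p - snd p)) \<le> R * S * P"
        unfolding real_norm_def abs_mult
        by (intro AE_I2 mult_mono' mult_nonneg_nonneg R S P abs_ge_zero)
    qed measurable
    have "(\<integral>p. ?F p \<partial>(lborel \<Otimes>\<^sub>M lborel)) = (\<integral>s. (\<integral>t. ?F (s, t) \<partial>lborel) \<partial>lborel)"
      using lborel_pair.integral_fst'[OF Fi] by simp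
    also have "\<dots> = (\<integral>s. ?u s * k (h1 s) \<partial>lborel)"
    proof (rule Bochner_Integration.integral_cong[OF refl])
      fix s
      have "(\<integral>t. ?F (s, t) \<partial>lborel) = ?u s * (\<integral>t. ?v t * \<psi> (h1 s - h2 t) \<partial>lborel)"
        by (simp add: mult.assoc)
      also have "(\<integral>t. ?v t * \<psi> (h1 s - h2 t) \<partial>lborel) = k (h1 s)"
        unfolding k_def by (rule s(3)[OF sub])
      finally show "(\<integral>t. ?F (s, t) \<partial>lborel) = ?u s * k (h1 s)" .
    qed
    also have "\<dots> = (\<integral>x. \<rho> x * k x \<partial>M)" by (rule r(3)[OF k])
    also have "\<dots> = (\<integral>x. (\<integral>y. \<rho> x * \<sigma> y * \<psi> (x - y) \<partial>M) \<partial>M)"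
      unfolding k_def by (simp add: mult.assoc)
    also have "\<dots> = (\<integral>p. \<rho> (fst p) * \<sigma> (snd p) * \<psi> (fst p - snd p) \<partial>(M \<Otimes>\<^sub>M M))"
      using MM.integral_fst'[OF int2] by simp
    finally show "(\<integral>p. ?F p \<partial>(lborel \<Otimes>\<^sub>M lborel)) = (\<integral>p. \<rho> (fst p) * \<sigma> (snd p) * \<psi> (fst p - snd p) \<partial>(M \<Otimes>\<^sub>M M))" .
  qed (use r s in simp_all)
qed

definition cross2 :: "real^2 \<Rightarrow> real^2 \<Rightarrow> real" where
  "cross2 a b = a $ 1 * b $ 2 - a $ 2 * b $ 1"

text \<open>Change of variables for \<open>(s, t) \<mapsto> h1 s - h2 t\<close>, whose Jacobian is the modulus of a determinant in
  \<open>h1' s\<close> and \<open>h2' t\<close>. With a constant sign \<open>\<kappa>\<close> the modulus disappears, and the determinant is a sum of two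
  products of a function of \<open>s\<close> with a function of \<open>t\<close>.\<close>

lemma integral_difference_image:
  fixes h1 h2 h1' h2' :: "real \<Rightarrow> real^2"
  assumes I: "I \<in> sets borel" "bounded I" and J: "J \<in> sets borel" "bounded J"
    and h [measurable]: "h1 \<in> borel_measurable borel" "h2 \<in> borel_measurable borel"
    and deriv: "\<And>s. s \<in> I \<Longrightarrow> (h1 has_vector_derivative h1' s) (at s within I)"
      "\<And>t. t \<in> J \<Longrightarrow> (h2 has_vector_derivative h2' t) (at t within J)"
    and bb: "\<And>i. bounded_borel (\<lambda>s. indicator I s * (h1' s $ i))" "\<And>i. bounded_borel (\<lambda>t. indicator J t * (h2' t $ i))"
    and inj: "inj_on (\<lambda>(s, t). h1 s - h2 t) (I \<times> J)"
    and orient: "\<And>s t. s \<in> I \<Longrightarrow> t \<in> J \<Longrightarrow> \<bar>cross2 (h1' s) (h2' t)\<bar> = \<kappa> * cross2 (h1' s) (h2' t)"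
    and U: "(\<lambda>(s, t). h1 s - h2 t) ` (I \<times> J) \<in> sets borel"
    and psi: "bounded_borel \<psi>"
  shows "(\<integral>v. indicator ((\<lambda>(s, t). h1 s - h2 t) ` (I \<times> J)) v * \<psi> v \<partial>lborel)
    = (\<integral>p. indicator I (fst p) * (\<kappa> * h1' (fst p) $ 1) * (indicator J (snd p) * h2' (snd p) $ 2) * \<psi> (h1 (fst p) - h2 (snd p)) \<partial>(lborel \<Otimes>\<^sub>M lborel))
    + (\<integral>p. indicator I (fst p) * (- \<kappa> * h1' (fst p) $ 2) * (indicator J (snd p) * h2' (snd p) $ 1) * \<psi> (h1 (fst p) - h2 (snd p)) \<partial>(lborel \<Otimes>\<^sub>M lborel))"
proof -
  note [measurable] = bounded_borel_measurable[OF psi] I(1) J(1)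
  define G where "G p = h1 (p $ 1) - h2 (p $ 2)" for p :: "real^2"
  define G' where "G' p v = v $ 1 *\<^sub>R h1' (p $ 1) - v $ 2 *\<^sub>R h2' (p $ 2)" for p v :: "real^2"
  define S where "S = {p :: real^2. p $ 1 \<in> I \<and> p $ 2 \<in> J}"
  let ?U = "(\<lambda>(s, t). h1 s - h2 t) ` (I \<times> J)"
  have proj [measurable]: "(\<lambda>p :: real^2. p $ i) \<in> borel_measurable borel" for i
    by (intro borel_measurable_continuous_onI continuous_intros)
  have S: "S \<in> sets borel" unfolding S_def by measurable
  have GS: "G ` S = ?U"
  proof safe
    fix p assume "p \<in> S" then show "G p \<in> ?U" by (auto simp: G_def S_def)
  next
    fix s t assume "s \<in> I" "t \<in> J"
    then show "h1 s - h2 t \<in> G ` S"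
      by (intro image_eqI[of _ _ "s *\<^sub>R axis 1 1 + t *\<^sub>R axis 2 1"]) (simp_all only: G_def S_def real2_coords mem_Collect_eq)
  qed
  have Ginj: "inj_on G S"
  proof (rule inj_onI)
    fix p q assume "p \<in> S" "q \<in> S" "G p = G q"
    then have "(p $ 1, p $ 2) = (q $ 1, q $ 2)"
      by (intro inj_onD[OF inj]) (auto simp: G_def S_def)
    then show "p = q" by (simp add: vec_eq_iff forall_2)
  qed
  have Gd: "(G has_derivative G' p) (at p within S)" if "p \<in> S" for p
  proof -
    have p: "p $ 1 \<in> I" "p $ 2 \<in> J" using that by (auto simp: S_def)
    have l: "((\<lambda>p :: real^2. p $ i) has_derivative (\<lambda>v. v $ i)) (at p within S)" for i
      by (rule bounded_linear_imp_has_derivative) (rule bounded_linear_vec_nth)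
    have "((\<lambda>q. h1 (q $ 1)) has_derivative (\<lambda>v. v $ 1 *\<^sub>R h1' (p $ 1))) (at p within S)"
      by (rule has_derivative_in_compose2[OF deriv(1)[unfolded has_vector_derivative_def] _ that l[of 1]]) (auto simp: S_def)
    moreover have "((\<lambda>q. h2 (q $ 2)) has_derivative (\<lambda>v. v $ 2 *\<^sub>R h2' (p $ 2))) (at p within S)"
      by (rule has_derivative_in_compose2[OF deriv(2)[unfolded has_vector_derivative_def] _ that l[of 2]]) (auto simp: S_def)
    ultimately show ?thesis unfolding G_def[abs_def] G'_def[abs_def] by (rule has_derivative_diff)
  qed
  have det: "det (matrix (G' p)) = - cross2 (h1' (p $ 1)) (h2' (p $ 2))" for p
    by (simp add: det_2 matrix_def G'_def cross2_def axis_def)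
  define D1 where "D1 p = indicator I (p $ 1) * (\<kappa> * h1' (p $ 1) $ 1) * (indicator J (p $ 2) * h2' (p $ 2) $ 2) * \<psi> (h1 (p $ 1) - h2 (p $ 2))" for p :: "real^2"
  define D2 where "D2 p = indicator I (p $ 1) * (- \<kappa> * h1' (p $ 1) $ 2) * (indicator J (p $ 2) * h2' (p $ 2) $ 1) * \<psi> (h1 (p $ 1) - h2 (p $ 2))" for p :: "real^2"
  have kb: "bounded_borel (\<lambda>s. indicator I s * (c * h1' s $ i))" for c i
  proof -
    have "bounded_borel (\<lambda>s. c * (indicator I s * h1' s $ i))"
      by (intro bounded_borel_mult bb bounded_borelI[where B="\<bar>c\<bar>"]) auto
    then show ?thesis by (simp add: mult_ac)
  qed
  have Gm: "(\<lambda>p :: real^2. h1 (p $ 1) - h2 (p $ 2)) \<in> borel_measurable borel" by measurable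
  have Dbb: "bounded_borel D1" "bounded_borel D2"
    unfolding D1_def[abs_def] D2_def[abs_def]
    by (rule bounded_borel_mult[OF bounded_borel_mult[OF bounded_borel_compose[OF kb proj] bounded_borel_compose[OF bb(2) proj]] bounded_borel_compose[OF psi Gm]])+
  note Dm [measurable] = Dbb[THEN bounded_borel_measurable]
  have Sb: "bounded S"
  proof -
    obtain a b where ab: "\<And>s. s \<in> I \<Longrightarrow> \<bar>s\<bar> \<le> a" "\<And>t. t \<in> J \<Longrightarrow> \<bar>t\<bar> \<le> b"
      using I(2) J(2) by (auto simp: bounded_iff)
    have "norm p \<le> a + b" if "p \<in> S" for p
    proof -
      have "norm p \<le> \<bar>p $ 1\<bar> + \<bar>p $ 2\<bar>" unfolding norm_real2 by (rule sqrt_sum_squares_le_sum_abs)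
      then show ?thesis using ab that by (force simp: S_def)
    qed
    then show ?thesis by (auto simp: bounded_iff)
  qed
  have Di: "integrable lborel D1" "integrable lborel D2"
    by (rule integrable_bounded_support[OF Dbb(1) Sb] integrable_bounded_support[OF Dbb(2) Sb];
        auto simp: D1_def D2_def S_def indicator_def)+
  have eq: "indicator S p *\<^sub>R (\<bar>det (matrix (G' p))\<bar> * \<psi> (G p)) = D1 p + D2 p" for p
  proof (cases "p \<in> S")
    case True
    then have p: "p $ 1 \<in> I" "p $ 2 \<in> J" by (auto simp: S_def)
    have d: "\<bar>det (matrix (G' p))\<bar> = \<kappa> * cross2 (h1' (p $ 1)) (h2' (p $ 2))"
      using orient[OF p] by (simp add: det)
    show ?thesis
      unfolding d using True p by (simp add: D1_def D2_def G_def cross2_def algebra_simps)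
  next
    case False
    then show ?thesis by (auto simp: D1_def D2_def S_def indicator_def)
  qed
  have SI: "(\<lambda>p. \<bar>det (matrix (G' p))\<bar> * \<psi> (G p)) absolutely_integrable_on S"
    unfolding set_integrable_def eq using Di by (simp add: integrable_completion)
  have SV: "integral S (\<lambda>p. \<bar>det (matrix (G' p))\<bar> * \<psi> (G p)) = (\<integral>p. D1 p + D2 p \<partial>lborel)"
    using set_lebesgue_integral_eq_integral(2)[OF SI]
    unfolding set_lebesgue_integral_def eq by (simp add: integral_completion)
  have "(\<lambda>p. \<bar>det (matrix (G' p))\<bar> *\<^sub>R (vec (\<psi> (G p)) :: real^1)) absolutely_integrable_on S \<and>
      integral S (\<lambda>p. \<bar>det (matrix (G' p))\<bar> *\<^sub>R (vec (\<psi> (G p)) :: real^1)) = vec (\<integral>p. D1 p + D2 p \<partial>lborel)"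
    using SI SV by (simp add: absolutely_integrable_on_1_iff integral_on_1_eq)
  then have "(\<lambda>v. vec (\<psi> v) :: real^1) absolutely_integrable_on (G ` S) \<and>
      integral (G ` S) (\<lambda>v. vec (\<psi> v) :: real^1) = vec (\<integral>p. D1 p + D2 p \<partial>lborel)"
    by (subst (asm) has_absolute_integral_change_of_variables[OF _ Gd Ginj]) (use S in auto)
  then have UI: "\<psi> absolutely_integrable_on ?U" and UV: "integral ?U \<psi> = (\<integral>p. D1 p + D2 p \<partial>lborel)"
    unfolding GS by (simp_all add: absolutely_integrable_on_1_iff integral_on_1_eq)
  have "(\<integral>v. indicator ?U v * \<psi> v \<partial>lborel) = integral ?U \<psi>"
    using set_lebesgue_integral_eq_integral(2)[OF UI] U
    unfolding set_lebesgue_integral_def by (simp add: integral_completion)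
  also have "\<dots> = (\<integral>p. D1 p \<partial>lborel) + (\<integral>p. D2 p \<partial>lborel)"
    unfolding UV by (rule Bochner_Integration.integral_add[OF Di])
  finally show ?thesis
    unfolding lborel_real2_integral[OF Dm(1)] lborel_real2_integral[OF Dm(2)]
    unfolding D1_def D2_def real2_coords .
qed

text \<open>The two products in the Jacobian give a kernel with two terms, after moving the weights from the
  parameter intervals to densities on the curves.\<close>

lemma off_diagonal_pairing_product:
  fixes h1 h2 h1' h2' :: "real \<Rightarrow> real^2"
  assumes fin: "finite_measure M" and sets: "sets M = sets borel"
    and d1: "dominated_param M I h1" "h1 ` I \<subseteq> S1" "S1 \<in> sets borel"
    and d2: "dominated_param M J h2" "h2 ` J \<subseteq> S2" "S2 \<in> sets borel" and disj: "S1 \<inter> S2 = {}"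
    and deriv: "\<And>s. s \<in> I \<Longrightarrow> (h1 has_vector_derivative h1' s) (at s within I)"
      "\<And>t. t \<in> J \<Longrightarrow> (h2 has_vector_derivative h2' t) (at t within J)"
    and bb: "\<And>i. bounded_borel (\<lambda>s. indicator I s * (h1' s $ i))" "\<And>i. bounded_borel (\<lambda>t. indicator J t * (h2' t $ i))"
    and inj: "inj_on (\<lambda>(s, t). h1 s - h2 t) (I \<times> J)"
    and orient: "\<And>s t. s \<in> I \<Longrightarrow> t \<in> J \<Longrightarrow> \<bar>cross2 (h1' s) (h2' t)\<bar> = \<kappa> * cross2 (h1' s) (h2' t)"
    and U: "(\<lambda>(s, t). h1 s - h2 t) ` (I \<times> J) \<in> sets borel" "bounded ((\<lambda>(s, t). h1 s - h2 t) ` (I \<times> J))"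
  shows "off_diagonal_pairing M ((\<lambda>(s, t). h1 s - h2 t) ` (I \<times> J))"
proof -
  have I: "I \<in> sets borel" "bounded I" and J: "J \<in> sets borel" "bounded J"
    and h: "h1 \<in> borel_measurable borel" "h2 \<in> borel_measurable borel"
    using d1(1) d2(1) by (auto simp: dominated_param_def)
  have kb: "bounded_borel (\<lambda>s. indicator I s * (c * h1' s $ i))" for c i
  proof -
    have "bounded_borel (\<lambda>s. c * (indicator I s * h1' s $ i))"
      by (intro bounded_borel_mult bb bounded_borelI[where B="\<bar>c\<bar>"]) auto
    then show ?thesis by (simp add: mult_ac)
  qed
  obtain r1 s1 where T1: "bounded_borel r1 \<and> bounded_borel s1 \<and> (\<forall>x. x \<notin> S1 \<longrightarrow> r1 x = 0) \<and> (\<forall>x. x \<notin> S2 \<longrightarrow> s1 x = 0) \<and>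
    (\<forall>\<psi>. bounded_borel \<psi> \<longrightarrow>
       (\<integral>p. indicator I (fst p) * (\<kappa> * h1' (fst p) $ 1) * (indicator J (snd p) * h2' (snd p) $ 2) * \<psi> (h1 (fst p) - h2 (snd p)) \<partial>(lborel \<Otimes>\<^sub>M lborel))
       = (\<integral>p. r1 (fst p) * s1 (snd p) * \<psi> (fst p - snd p) \<partial>(M \<Otimes>\<^sub>M M)))"
    using dominated_tensor[OF fin sets d1 kb[of \<kappa> 1] d2 bb(2)[of 2]] by (elim exE) (rule that)
  obtain r2 s2 where T2: "bounded_borel r2 \<and> bounded_borel s2 \<and> (\<forall>x. x \<notin> S1 \<longrightarrow> r2 x = 0) \<and> (\<forall>x. x \<notin> S2 \<longrightarrow> s2 x = 0) \<and>
    (\<forall>\<psi>. bounded_borel \<psi> \<longrightarrow>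
       (\<integral>p. indicator I (fst p) * (- \<kappa> * h1' (fst p) $ 2) * (indicator J (snd p) * h2' (snd p) $ 1) * \<psi> (h1 (fst p) - h2 (snd p)) \<partial>(lborel \<Otimes>\<^sub>M lborel))
       = (\<integral>p. r2 (fst p) * s2 (snd p) * \<psi> (fst p - snd p) \<partial>(M \<Otimes>\<^sub>M M)))"
    using dominated_tensor[OF fin sets d1 kb[of "- \<kappa>" 2] d2 bb(2)[of 1]] by (elim exE) (rule that)
  have zero: "r1 x * s1 x = 0" "r2 x * s2 x = 0" for x
    using T1 T2 disj by (metis IntI emptyE mult_zero_left mult_zero_right)+
  have "off_diagonal_kernel M ((\<lambda>(s, t). h1 s - h2 t) ` (I \<times> J)) 2
      (\<lambda>j. if j = 0 then r1 else r2) (\<lambda>j. if j = 0 then s1 else s2)"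
    unfolding off_diagonal_kernel_def
  proof (intro conjI allI impI)
    fix \<psi> :: "real^2 \<Rightarrow> real" assume psi: "bounded_borel \<psi>"
    show "(\<Sum>j<2::nat. \<integral>p. (if j = 0 then r1 else r2) (fst p) * (if j = 0 then s1 else s2) (snd p) * \<psi> (fst p - snd p) \<partial>(M \<Otimes>\<^sub>M M))
        = (\<integral>v. indicator ((\<lambda>(s, t). h1 s - h2 t) ` (I \<times> J)) v * \<psi> v \<partial>lborel)"
      using integral_difference_image[OF I J h deriv bb inj orient U(1) psi] T1 T2 psi
      by (simp add: numeral_2_eq_2)
  qed (use T1 T2 zero in auto)
  then show ?thesis unfolding off_diagonal_pairing_def using U by blast
qed

section \<open>Hausdorff measure of parametrised curves\<close>

text \<open>The preimage of a set of the cover has diameter at most \<open>C\<close> times that of the set, so it lies in an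
  interval of that length; these intervals cover \<open>T\<close>.\<close>

lemma lebesgue_le_hausdorff1_delta:
  fixes h :: "real \<Rightarrow> 'a::metric_space"
  assumes C: "0 < C" and exp: "\<And>s t. s \<in> T \<Longrightarrow> t \<in> T \<Longrightarrow> \<bar>s - t\<bar> \<le> C * dist (h s) (h t)"
    and T: "T \<in> sets lborel"
  shows "emeasure lborel T / ennreal C \<le> hausdorff1_delta d (h ` T)"
  unfolding hausdorff1_delta_def
proof (rule INF_greatest, safe)
  fix U :: "nat \<Rightarrow> 'a set"
  assume cover: "h ` T \<subseteq> (\<Union>i. U i)" and U: "\<forall>i. bounded (U i) \<and> diameter (U i) \<le> d"
  define P where "P i = {s \<in> T. h s \<in> U i}" for i
  define J where "J i = (if P i = {} then {} else {Inf (P i) .. Inf (P i) + C * diameter (U i)})" for i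
  have diam: "0 \<le> diameter (U i)" for i using U by (simp add: diameter_ge_0)
  have PJ: "P i \<subseteq> J i" for i
  proof
    fix s assume s: "s \<in> P i"
    have close: "\<bar>s - t\<bar> \<le> C * diameter (U i)" if "s \<in> P i" "t \<in> P i" for s t
    proof -
      have "\<bar>s - t\<bar> \<le> C * dist (h s) (h t)" using exp that by (auto simp: P_def)
      also have "\<dots> \<le> C * diameter (U i)"
        using U that C by (intro mult_left_mono diameter_bounded_bound) (auto simp: P_def)
      finally show ?thesis .
    qed
    have bdd: "bdd_below (P i)"
      using close[OF s] by (intro bdd_belowI[of _ "s - C * diameter (U i)"]) force
    have "s - C * diameter (U i) \<le> Inf (P i)"
      using s close[OF s] by (intro cInf_greatest) force+
    moreover have "Inf (P i) \<le> s" using s bdd by (rule cInf_lower)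
    ultimately show "s \<in> J i" using s by (auto simp: J_def)
  qed
  have "emeasure lborel T \<le> emeasure lborel (\<Union>i. J i)"
  proof (rule emeasure_mono)
    show "T \<subseteq> (\<Union>i. J i)"
    proof
      fix s assume s: "s \<in> T"
      then obtain i where "h s \<in> U i" using cover by blast
      then have "s \<in> P i" using s by (simp add: P_def)
      then show "s \<in> (\<Union>i. J i)" using PJ by blast
    qed
  qed (auto simp: J_def)
  also have "\<dots> \<le> (\<Sum>i. emeasure lborel (J i))"
    by (rule emeasure_subadditive_countably) (auto simp: J_def)
  also have "\<dots> \<le> (\<Sum>i. ennreal C * ennreal (diameter (U i)))"
    using diam C by (intro suminf_le) (auto simp: J_def ennreal_mult[symmetric])
  also have "\<dots> = ennreal C * (\<Sum>i. ennreal (diameter (U i)))" by simp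
  finally have "emeasure lborel T \<le> ennreal C * (\<Sum>i. ennreal (diameter (U i)))" .
  then show "emeasure lborel T / ennreal C \<le> (\<Sum>i. ennreal (diameter (U i)))"
    using C by (intro divide_le_posI_ennreal) (auto simp: mult.commute)
qed

lemma lebesgue_le_hausdorff1_outer:
  fixes h :: "real \<Rightarrow> 'a::metric_space"
  assumes C: "0 < C" and exp: "\<And>s t. s \<in> T \<Longrightarrow> t \<in> T \<Longrightarrow> \<bar>s - t\<bar> \<le> C * dist (h s) (h t)"
    and T: "T \<in> sets lborel"
  shows "emeasure lborel T \<le> ennreal C * hausdorff1_outer (h ` T)"
proof -
  have "emeasure lborel T = ennreal C * (emeasure lborel T / ennreal C)"
    using C by (simp add: ennreal_times_divide mult.commute[of "ennreal C"] ennreal_mult_divide_eq)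
  also have "\<dots> \<le> ennreal C * hausdorff1_outer (h ` T)"
    using lebesgue_le_hausdorff1_delta[OF C exp T, of 1] hausdorff1_delta_le_outer[of 1 "h ` T"]
    by (intro mult_left_mono) auto
  finally show ?thesis .
qed

text \<open>Subdivide the interval into so many equal pieces that their images have diameter at most \<open>d\<close>.\<close>

lemma hausdorff1_outer_lipschitz_image:
  fixes h :: "real \<Rightarrow> 'a::real_normed_vector"
  assumes ab: "a < b" and K: "0 \<le> K"
    and lip: "\<And>s t. s \<in> {a..b} \<Longrightarrow> t \<in> {a..b} \<Longrightarrow> dist (h s) (h t) \<le> K * \<bar>s - t\<bar>"
  shows "hausdorff1_outer (h ` {a..b}) \<le> ennreal (K * (b - a))"
  unfolding hausdorff1_outer_def
proof (rule SUP_least)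
  fix d :: real assume "d \<in> {0<..}"
  then have d: "0 < d" by simp
  obtain n :: nat where n: "K * (b - a) / d < real n" using reals_Archimedean2 by blast
  have n0: "0 < n"
  proof (rule ccontr)
    assume "\<not> 0 < n"
    then have "K * (b - a) / d < 0" using n by simp
    moreover have "0 \<le> K * (b - a) / d" using K ab d by simp
    ultimately show False by simp
  qed
  define w where "w = (b - a) / real n"
  have w: "0 < w" "real n * w = b - a" using ab n0 by (auto simp: w_def)
  have Kw: "K * w \<le> d"
  proof -
    have "K * (b - a) < d * real n" using n d by (simp add: field_simps)
    then have "(K * w) * real n \<le> d * real n" using w(2) by (simp add: mult_ac)
    then show ?thesis using n0 by simp
  qed
  define J where "J i = {a + real i * w .. a + real (Suc i) * w}" for i
  define U where "U i = (if i < n then h ` J i else {})" for i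
  have Jsub: "J i \<subseteq> {a..b}" if "i < n" for i
  proof -
    have "real (Suc i) * w \<le> real n * w" using that w by (intro mult_right_mono) auto
    moreover have "0 \<le> real i * w" using w by simp
    ultimately show ?thesis using w by (auto simp: J_def)
  qed
  have dU: "dist x y \<le> K * w" if xy: "x \<in> U i" "y \<in> U i" for x y i
  proof -
    have i: "i < n" using xy by (auto simp: U_def split: if_splits)
    then obtain s t where st: "s \<in> J i" "t \<in> J i" "x = h s" "y = h t" using xy by (auto simp: U_def)
    have "dist x y \<le> K * \<bar>s - t\<bar>" unfolding st using Jsub[OF i] st by (intro lip) auto
    also have "\<dots> \<le> K * w" using st K by (intro mult_left_mono) (auto simp: J_def algebra_simps)
    finally show ?thesis .
  qed
  have diam: "diameter (U i) \<le> K * w" for i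
    using dU K w by (intro diameter_le) (auto simp: dist_norm)
  have bdd: "bounded (U i)" for i
    unfolding bounded_two_points using dU by blast
  have "hausdorff1_delta d (h ` {a..b}) \<le> (\<Sum>i. ennreal (diameter (U i)))"
    unfolding hausdorff1_delta_def
  proof (rule INF_lower, safe)
    fix s assume s: "s \<in> {a..b}"
    \<comment> \<open>The minimum puts the right end point \<open>b\<close> into the last piece.\<close>
    define i where "i = min (n - 1) (nat \<lfloor>(s - a) / w\<rfloor>)"
    have i: "i < n" using n0 by (simp add: i_def)
    have nn: "0 \<le> (s - a) / w" using s w by simp
    have "real i \<le> (s - a) / w"
    proof -
      have "real i \<le> real (nat \<lfloor>(s - a) / w\<rfloor>)" by (simp add: i_def)
      also have "\<dots> \<le> (s - a) / w" using nn by (simp add: of_nat_nat)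
      finally show ?thesis .
    qed
    then have lo: "a + real i * w \<le> s" using w by (simp add: field_simps)
    have "(s - a) / w \<le> real (Suc i)"
    proof (cases "nat \<lfloor>(s - a) / w\<rfloor> \<le> n - 1")
      case True
      then have "i = nat \<lfloor>(s - a) / w\<rfloor>" by (simp add: i_def)
      then show ?thesis using nn by linarith
    next
      case False
      then have "Suc i = n" using n0 by (simp add: i_def)
      moreover have "(s - a) / w \<le> real n" using s w by (simp add: field_simps)
      ultimately show ?thesis by simp
    qed
    then have hi: "s \<le> a + real (Suc i) * w" using w by (simp add: field_simps)
    have "h s \<in> U i" using i lo hi by (auto simp: U_def J_def)
    then show "h s \<in> (\<Union>i. U i)" by blast
  qed (use bdd diam Kw in \<open>auto intro: order_trans\<close>)
  also have "\<dots> = (\<Sum>i<n. ennreal (diameter (U i)))"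
    by (rule suminf_finite) (auto simp: U_def)
  also have "\<dots> \<le> (\<Sum>i<n. ennreal (K * w))" by (intro sum_mono ennreal_leI diam)
  also have "\<dots> = ennreal (K * (b - a))"
  proof -
    have "(\<Sum>i<n. ennreal (K * w)) = ennreal (real n * (K * w))"
      using K w by (simp add: ennreal_mult ennreal_of_nat_eq_real_of_nat)
    also have "real n * (K * w) = K * (b - a)" unfolding w(2)[symmetric] by simp
    finally show ?thesis .
  qed
  finally show "hausdorff1_delta d (h ` {a..b}) \<le> ennreal (K * (b - a))" .
qed

lemma smooth_curve_lipschitz:
  fixes g :: "real \<Rightarrow> 'a::real_normed_vector"
  assumes g: "smooth_curve g a b"
  obtains K where "0 \<le> K" "\<And>s t. s \<in> {a..b} \<Longrightarrow> t \<in> {a..b} \<Longrightarrow> dist (g s) (g t) \<le> K * \<bar>s - t\<bar>"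
proof -
  have diff: "nth_vector_derivative {a..b} n g differentiable_on {a..b}" for n
    using g by (auto simp: smooth_curve_def C_infinity_on_def)
  let ?g' = "nth_vector_derivative {a..b} 1 g"
  have "compact (?g' ` {a..b})"
    by (intro compact_continuous_image differentiable_imp_continuous_on diff) simp
  then have "bounded (?g' ` {a..b})" by (rule compact_imp_bounded)
  then obtain K where K: "0 < K" "\<And>s. s \<in> {a..b} \<Longrightarrow> norm (?g' s) \<le> K"
    unfolding bounded_pos by auto
  have d: "(g has_derivative (\<lambda>v. v *\<^sub>R ?g' s)) (at s within {a..b})" if "s \<in> {a..b}" for s
  proof -
    have "g differentiable (at s within {a..b})" using diff[of 0] that by (auto simp: differentiable_on_def)
    then show ?thesis by (simp add: vector_derivative_works has_vector_derivative_def)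
  qed
  show ?thesis
  proof (rule that[of K])
    fix s t assume st: "s \<in> {a..b}" "t \<in> {a..b}"
    have "norm (g s - g t) \<le> K * norm (s - t)"
    proof (rule differentiable_bound[OF _ d])
      show "onorm (\<lambda>v. v *\<^sub>R ?g' x) \<le> K" if "x \<in> {a..b}" for x
      proof (rule onorm_le)
        fix v :: real
        show "norm (v *\<^sub>R ?g' x) \<le> K * norm v"
          using mult_left_mono[OF K(2)[OF that] abs_ge_zero[of v]] by (simp add: mult.commute)
      qed
    qed (use st in auto)
    then show "dist (g s) (g t) \<le> K * \<bar>s - t\<bar>" by (simp add: dist_norm)
  qed (use K in simp)
qed

lemma finite_union_of_smooth_curves_compact:
  assumes "finite_union_of_smooth_curves (E :: 'a::real_normed_vector set)"
  shows "compact E" and "hausdorff1_outer E < top"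
proof -
  obtain C where C: "finite C" "\<forall>K\<in>C. \<exists>g a b. smooth_curve g a b \<and> K = g ` {a..b}" "E = \<Union>C"
    using assms unfolding finite_union_of_smooth_curves_def by (elim exE conjE) (rule that)
  have K: "compact K \<and> hausdorff1_outer K < top" if KC: "K \<in> C" for K
  proof -
    obtain g a b where g: "smooth_curve g a b" "K = g ` {a..b}" using C(2)[rule_format, OF KC] by (elim exE conjE) (rule that)
    have "g differentiable_on {a..b}" using g(1)
      unfolding smooth_curve_def C_infinity_on_def by (metis nth_vector_derivative.simps(1))
    then have "compact K" unfolding g(2)
      by (intro compact_continuous_image differentiable_imp_continuous_on) simp_all
    moreover obtain L where L: "0 \<le> L" "\<And>s t. s \<in> {a..b} \<Longrightarrow> t \<in> {a..b} \<Longrightarrow> dist (g s) (g t) \<le> L * \<bar>s - t\<bar>"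
      by (rule smooth_curve_lipschitz[OF g(1)], rule that)
    have "hausdorff1_outer K \<le> ennreal (L * (b - a))"
      unfolding g(2) using g(1) by (intro hausdorff1_outer_lipschitz_image L) (auto simp: smooth_curve_def)
    then have "hausdorff1_outer K < top" by (rule le_less_trans) simp
    ultimately show ?thesis by blast
  qed
  show "compact E" unfolding C(3) using C(1) K by (intro compact_Union) auto
  have "hausdorff1_outer (\<Union>D) < top" if "D \<subseteq> C" for D
    using finite_subset[OF that C(1)] that
  proof (induction D rule: finite_induct)
    case empty then show ?case by (simp add: hausdorff1_outer_empty)
  next
    case (insert K D)
    have "hausdorff1_outer (\<Union>(insert K D)) \<le> hausdorff1_outer K + hausdorff1_outer (\<Union>D)"
      using hausdorff1_outer_subadditive[of K "\<Union>D"] by simp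
    also have "\<dots> < top" using insert K by (simp add: ennreal_add_less_top)
    finally show ?case .
  qed
  then show "hausdorff1_outer E < top" unfolding C(3) by blast
qed

lemma sets_arc_length_measure: "sets (arc_length_measure E) = sets borel"
  by (simp add: arc_length_measure_def sets_hausdorff1)

lemma finite_arc_length_measure:
  assumes "compact E" "hausdorff1_outer E < top" "0 < hausdorff1_outer E"
  shows "finite_measure (arc_length_measure E)"
proof -
  have E: "E \<in> sets hausdorff1" using assms(1) by (simp add: sets_hausdorff1 borel_compact)
  have "emeasure hausdorff1 E = hausdorff1_outer E"
    using E by (intro emeasure_hausdorff1) (simp add: sets_hausdorff1)
  then have "emeasure (uniform_measure hausdorff1 E) UNIV = hausdorff1_outer E / hausdorff1_outer E"
    using E by (subst emeasure_uniform_measure) (auto simp: sets_hausdorff1)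
  also have "\<dots> = 1" using assms by (intro ennreal_divide_self) auto
  finally have "emeasure (arc_length_measure E) (space (arc_length_measure E)) = 1"
    unfolding arc_length_measure_def
    using sets_eq_imp_space_eq[OF sets_hausdorff1[where 'a="real^2"]] by simp
  then show ?thesis by (intro finite_measureI) simp
qed

text \<open>A parametrisation that does not contract distances by more than \<open>C\<close> cannot map a set of positive
  length to a set of small arc length.\<close>

lemma dominated_param_arc_length:
  fixes h :: "real \<Rightarrow> real^2"
  assumes E: "compact E" "hausdorff1_outer E < top" "0 < hausdorff1_outer E"
    and I: "I \<in> sets borel" "bounded I" and h: "h \<in> borel_measurable borel" and sub: "h ` I \<subseteq> E"
    and C: "0 < C" and exp: "\<And>s t. s \<in> I \<Longrightarrow> t \<in> I \<Longrightarrow> \<bar>s - t\<bar> \<le> C * dist (h s) (h t)"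
  shows "dominated_param (arc_length_measure E) I h"
  unfolding dominated_param_def
proof (intro conjI I h exI[of _ "C * enn2real (hausdorff1_outer E)"] ballI)
  fix B :: "(real^2) set" assume B: "B \<in> sets borel"
  have Eb: "E \<in> sets borel" using E(1) by (rule borel_compact)
  let ?e = "hausdorff1_outer E"
  have "emeasure lborel (I \<inter> h -` B) \<le> ennreal C * hausdorff1_outer (h ` (I \<inter> h -` B))"
    using I h B measurable_sets_borel[of h borel B]
    by (intro lebesgue_le_hausdorff1_outer[OF C] exp) auto
  also have "\<dots> \<le> ennreal C * hausdorff1_outer (E \<inter> B)"
    using sub by (intro mult_left_mono hausdorff1_outer_mono) auto
  also have "hausdorff1_outer (E \<inter> B) = ?e * (hausdorff1_outer (E \<inter> B) / ?e)"
  proof -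
    have "(hausdorff1_outer (E \<inter> B) * ?e) / ?e = hausdorff1_outer (E \<inter> B)"
      using E by (intro ennreal_mult_divide_eq) auto
    then show ?thesis by (simp add: ennreal_times_divide mult.commute)
  qed
  also have "hausdorff1_outer (E \<inter> B) / ?e = emeasure (arc_length_measure E) B"
    unfolding arc_length_measure_def using Eb B
    by (subst emeasure_uniform_measure) (auto simp: sets_hausdorff1 emeasure_hausdorff1)
  also have "ennreal C * (?e * emeasure (arc_length_measure E) B)
      = ennreal (C * enn2real ?e) * emeasure (arc_length_measure E) B"
    using C E(2) by (simp add: ennreal_mult mult.assoc)
  finally show "emeasure lborel (I \<inter> h -` B) \<le> ennreal (C * enn2real ?e) * emeasure (arc_length_measure E) B" .
qed

lemma hausdorff1_outer_pos:
  fixes h :: "real \<Rightarrow> 'a::metric_space"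
  assumes "a < b" "h ` {a..b} \<subseteq> E" "0 < C" "\<And>s t. s \<in> {a..b} \<Longrightarrow> t \<in> {a..b} \<Longrightarrow> \<bar>s - t\<bar> \<le> C * dist (h s) (h t)"
  shows "0 < hausdorff1_outer E"
proof -
  have "0 < emeasure lborel {a..b}" using assms(1) by simp
  also have "\<dots> \<le> ennreal C * hausdorff1_outer (h ` {a..b})"
    by (rule lebesgue_le_hausdorff1_outer[OF assms(3,4)]) auto
  finally have "0 < hausdorff1_outer (h ` {a..b})" by (auto simp: ennreal_zero_less_mult_iff)
  then show ?thesis using hausdorff1_outer_mono[OF assms(2)] by simp
qed

text \<open>A ball of radius \<open>\<epsilon>\<close> around \<open>h a\<close> contains the part of the curve with parameters up to \<open>a + \<epsilon> / K\<close>.\<close>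

lemma dominated_param_mass:
  fixes h :: "real \<Rightarrow> 'a::euclidean_space"
  assumes fin: "finite_measure M" and sets: "sets M = sets borel"
    and dom: "dominated_param M I h" and l: "0 < l" and sub: "{a..a + l} \<subseteq> I"
    and K: "0 < K" and lip: "\<And>s. s \<in> {a..a + l} \<Longrightarrow> dist (h a) (h s) \<le> K * (s - a)"
  obtains c e where "0 < c" "0 < e" "\<And>\<epsilon>. 0 < \<epsilon> \<Longrightarrow> \<epsilon> \<le> e \<Longrightarrow> c * \<epsilon> \<le> measure M (cball (h a) \<epsilon>)"
proof -
  interpret finite_measure M by (rule fin)
  have I: "I \<in> sets borel" and h: "h \<in> borel_measurable borel"
    using dom by (auto simp: dominated_param_def)
  obtain C :: real where "\<forall>B\<in>sets borel. emeasure lborel (I \<inter> h -` B) \<le> ennreal C * emeasure M B"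
    using dom unfolding dominated_param_def by (elim conjE exE) (rule that)
  note C = this[rule_format]
  define C1 where "C1 = max C 1"
  have C1: "0 < C1" "C \<le> C1" by (auto simp: C1_def)
  show ?thesis
  proof (rule that[of "1 / (K * C1)" "K * l"])
    fix \<epsilon> assume e: "0 < \<epsilon>" "\<epsilon> \<le> K * l"
    have el: "\<epsilon> / K \<le> l" using e K by (simp add: field_simps)
    have "{a..a + \<epsilon> / K} \<subseteq> I \<inter> h -` cball (h a) \<epsilon>"
    proof
      fix s assume s: "s \<in> {a..a + \<epsilon> / K}"
      then have s': "s \<in> {a..a + l}" using el by auto
      have "dist (h a) (h s) \<le> K * (s - a)" by (rule lip[OF s'])
      also have "\<dots> \<le> K * (\<epsilon> / K)" using s K by (intro mult_left_mono) auto
      finally show "s \<in> I \<inter> h -` cball (h a) \<epsilon>" using s' sub K by auto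
    qed
    then have "emeasure lborel {a..a + \<epsilon> / K} \<le> emeasure lborel (I \<inter> h -` cball (h a) \<epsilon>)"
      using I measurable_sets_borel[OF h, of "cball (h a) \<epsilon>"] by (intro emeasure_mono) auto
    also have "\<dots> \<le> ennreal C * emeasure M (cball (h a) \<epsilon>)" by (rule C) simp
    also have "\<dots> \<le> ennreal C1 * emeasure M (cball (h a) \<epsilon>)"
      using C1 by (intro mult_right_mono ennreal_leI) auto
    finally have "ennreal (\<epsilon> / K) \<le> ennreal (C1 * measure M (cball (h a) \<epsilon>))"
      using e K C1 by (simp add: emeasure_eq_measure ennreal_mult)
    then have "\<epsilon> / K \<le> C1 * measure M (cball (h a) \<epsilon>)"
      using C1 by (subst (asm) ennreal_le_iff) auto
    then show "1 / (K * C1) * \<epsilon> \<le> measure M (cball (h a) \<epsilon>)" using K C1 by (simp add: field_simps)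
  qed (use K C1 l in auto)
qed

section \<open>Directions in the plane\<close>

lemma cross2_simps:
  "cross2 (a + b) c = cross2 a c + cross2 b c" "cross2 a (b + c) = cross2 a b + cross2 a c"
  "cross2 (a - b) c = cross2 a c - cross2 b c" "cross2 a (b - c) = cross2 a b - cross2 a c"
  "cross2 (k *\<^sub>R a) c = k * cross2 a c" "cross2 a (k *\<^sub>R c) = k * cross2 a c"
  "cross2 (- a) c = - cross2 a c" "cross2 a (- c) = - cross2 a c"
  "cross2 a a = 0" "cross2 0 c = 0" "cross2 a 0 = 0"
  by (simp_all add: cross2_def algebra_simps)

lemma cross2_commute: "cross2 a b = - cross2 b a"
  by (simp add: cross2_def)

text \<open>Cramer's rule, giving the coordinates of \<open>u\<close> with respect to \<open>v\<close> and \<open>w\<close>.\<close>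

lemma cross2_cramer: "cross2 v w *\<^sub>R u = cross2 u w *\<^sub>R v + cross2 v u *\<^sub>R w"
  by (simp add: cross2_def vec_eq_iff forall_2 algebra_simps)

lemma bounded_linear_cross2:
  "bounded_linear (\<lambda>u. cross2 u w / d)" "bounded_linear (\<lambda>u. cross2 w u / d)"
  unfolding linear_conv_bounded_linear[symmetric]
  by (rule linearI; simp add: cross2_simps add_divide_distrib)+

lemma cross2_parallel:
  assumes "cross2 \<phi> v = 0" "\<phi> \<noteq> 0" obtains \<tau> where "v = \<tau> *\<^sub>R \<phi>"
proof -
  have "(\<phi> \<bullet> \<phi>) *\<^sub>R v = (\<phi> \<bullet> v) *\<^sub>R \<phi>"
    using assms(1) unfolding cross2_def
    by (simp add: vec_eq_iff forall_2 inner_vec_def UNIV_2 algebra_simps)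
  then have "v = ((\<phi> \<bullet> v) / (\<phi> \<bullet> \<phi>)) *\<^sub>R \<phi>"
    using assms(2) by (simp add: field_simps eq_vector_fraction_iff)
  then show ?thesis by (rule that)
qed

text \<open>\<open>P\<close> holds near the origin in a conical neighbourhood of the open ray through \<open>\<phi>\<close>, which is given by balls
  of radius proportional to the distance from the origin.\<close>

definition near_ray :: "'a::real_normed_vector \<Rightarrow> ('a \<Rightarrow> bool) \<Rightarrow> bool" where
  "near_ray \<phi> P \<longleftrightarrow> (\<exists>c>0. \<exists>r>0. \<forall>\<rho>. 0 < \<rho> \<longrightarrow> \<rho> \<le> r \<longrightarrow> (\<forall>u\<in>ball (\<rho> *\<^sub>R \<phi>) (c * \<rho>). P u))"

lemma near_rayI:
  assumes "0 < c" "0 < r" "\<And>\<rho> u. 0 < \<rho> \<Longrightarrow> \<rho> \<le> r \<Longrightarrow> u \<in> ball (\<rho> *\<^sub>R \<phi>) (c * \<rho>) \<Longrightarrow> P u"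
  shows "near_ray \<phi> P"
  unfolding near_ray_def using assms by blast

lemma near_ray_conj:
  assumes "near_ray \<phi> P" "near_ray \<phi> Q" shows "near_ray \<phi> (\<lambda>u. P u \<and> Q u)"
proof -
  obtain c r where 1: "0 < c" "0 < r" "\<forall>\<rho>. 0 < \<rho> \<longrightarrow> \<rho> \<le> r \<longrightarrow> (\<forall>u\<in>ball (\<rho> *\<^sub>R \<phi>) (c * \<rho>). P u)"
    using assms(1) unfolding near_ray_def by (elim exE conjE) (rule that)
  obtain c' r' where 2: "0 < c'" "0 < r'" "\<forall>\<rho>. 0 < \<rho> \<longrightarrow> \<rho> \<le> r' \<longrightarrow> (\<forall>u\<in>ball (\<rho> *\<^sub>R \<phi>) (c' * \<rho>). Q u)"
    using assms(2) unfolding near_ray_def by (elim exE conjE) (rule that)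
  show ?thesis
  proof (rule near_rayI[of "min c c'" "min r r'"])
    fix \<rho> u assume r: "0 < \<rho>" "\<rho> \<le> min r r'" and u: "u \<in> ball (\<rho> *\<^sub>R \<phi>) (min c c' * \<rho>)"
    have "min c c' * \<rho> \<le> c * \<rho>" "min c c' * \<rho> \<le> c' * \<rho>" using r by (auto intro: mult_right_mono)
    then have "u \<in> ball (\<rho> *\<^sub>R \<phi>) (c * \<rho>)" "u \<in> ball (\<rho> *\<^sub>R \<phi>) (c' * \<rho>)" using u by auto
    then show "P u \<and> Q u" using 1(3) 2(3) r by auto
  qed (use 1 2 in auto)
qed

lemma near_ray_mono: "near_ray \<phi> P \<Longrightarrow> (\<And>u. P u \<Longrightarrow> Q u) \<Longrightarrow> near_ray \<phi> Q"
  unfolding near_ray_def by meson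

lemma near_ray_small:
  fixes f :: "'a::real_normed_vector \<Rightarrow> real"
  assumes f: "bounded_linear f" shows "near_ray \<phi> (\<lambda>u. f u \<le> 1)"
proof -
  obtain K where K: "0 < K" "\<And>u. norm (f u) \<le> norm u * K"
    using bounded_linear.pos_bounded[OF f] by blast
  have pos: "0 < K * (norm \<phi> + 1)" using K by (intro mult_pos_pos) (auto intro: add_nonneg_pos)
  show ?thesis
  proof (rule near_rayI[of 1 "1 / (K * (norm \<phi> + 1))"])
    fix \<rho> u assume r: "0 < \<rho>" "\<rho> \<le> 1 / (K * (norm \<phi> + 1))" and u: "u \<in> ball (\<rho> *\<^sub>R \<phi>) (1 * \<rho>)"
    have "norm u \<le> norm (\<rho> *\<^sub>R \<phi>) + norm (u - \<rho> *\<^sub>R \<phi>)"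
      by (metis add.commute diff_add_cancel norm_triangle_ineq)
    also have "\<dots> \<le> \<rho> * (norm \<phi> + 1)" using u r by (simp add: dist_norm norm_minus_commute algebra_simps)
    finally have "norm u * K \<le> \<rho> * (norm \<phi> + 1) * K" using K by (intro mult_right_mono) auto
    also have "\<dots> \<le> 1" using r(2) pos by (simp add: field_simps)
    finally show "f u \<le> 1" using K(2)[of u] by simp
  qed (use pos in auto)
qed

lemma near_ray_pos:
  fixes f :: "'a::real_normed_vector \<Rightarrow> real"
  assumes f: "bounded_linear f" and pos: "0 < f \<phi>" shows "near_ray \<phi> (\<lambda>u. 0 < f u)"
proof -
  obtain K where K: "0 < K" "\<And>u. norm (f u) \<le> norm u * K"
    using bounded_linear.pos_bounded[OF f] by blast
  interpret bounded_linear f by (rule f)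
  show ?thesis
  proof (rule near_rayI[of "f \<phi> / K" 1])
    fix \<rho> u assume r: "0 < \<rho>" and u: "u \<in> ball (\<rho> *\<^sub>R \<phi>) (f \<phi> / K * \<rho>)"
    have "norm (f (u - \<rho> *\<^sub>R \<phi>)) \<le> norm (u - \<rho> *\<^sub>R \<phi>) * K" by (rule K)
    also have "\<dots> < (f \<phi> / K * \<rho>) * K" using u K by (intro mult_strict_right_mono) (auto simp: dist_norm norm_minus_commute)
    also have "\<dots> = \<rho> * f \<phi>" using K by simp
    finally show "0 < f u" by (simp add: diff scaleR)
  qed (use pos K in auto)
qed

text \<open>The set \<open>U\<close> may depend on the scale \<open>\<rho>\<close>; convex arcs need this, since they have to be cut into pieces
  short compared with \<open>\<rho>\<close>.\<close>

definition covered_direction :: "(real^2) measure \<Rightarrow> real^2 \<Rightarrow> bool" where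
  "covered_direction M \<phi> \<longleftrightarrow> (\<exists>c>0. \<exists>r>0. \<forall>\<rho>. 0 < \<rho> \<longrightarrow> \<rho> \<le> r \<longrightarrow>
     (\<exists>U. ball (\<rho> *\<^sub>R \<phi>) (c * \<rho>) \<subseteq> U \<and> off_diagonal_pairing M U))"

lemma covered_directionI:
  assumes "0 < c" "0 < r" "\<And>\<rho>. 0 < \<rho> \<Longrightarrow> \<rho> \<le> r \<Longrightarrow>
     \<exists>U. ball (\<rho> *\<^sub>R \<phi>) (c * \<rho>) \<subseteq> U \<and> off_diagonal_pairing M U"
  shows "covered_direction M \<phi>"
  unfolding covered_direction_def using assms by blast

lemma covered_direction_near_ray:
  assumes "near_ray \<phi> (\<lambda>u. u \<in> U)" "off_diagonal_pairing M U" shows "covered_direction M \<phi>"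
proof -
  obtain c r where 1: "0 < c" "0 < r" "\<forall>\<rho>. 0 < \<rho> \<longrightarrow> \<rho> \<le> r \<longrightarrow> (\<forall>u\<in>ball (\<rho> *\<^sub>R \<phi>) (c * \<rho>). u \<in> U)"
    using assms(1) unfolding near_ray_def by (elim exE conjE) (rule that)
  show ?thesis
    by (rule covered_directionI[OF 1(1,2)], rule exI[of _ U]) (use 1(3) assms(2) in blast)
qed

lemma covered_direction_uminus:
  assumes fin: "finite_measure M" and sets: "sets M = sets borel" and cov: "covered_direction M (- \<phi>)"
  shows "covered_direction M \<phi>"
proof -
  obtain c r where 1: "0 < c" "0 < r" "\<forall>\<rho>. 0 < \<rho> \<longrightarrow> \<rho> \<le> r \<longrightarrow>
     (\<exists>U. ball (\<rho> *\<^sub>R (- \<phi>)) (c * \<rho>) \<subseteq> U \<and> off_diagonal_pairing M U)"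
    using cov unfolding covered_direction_def by (elim exE conjE) (rule that)
  show ?thesis
  proof (rule covered_directionI[OF 1(1,2)])
    fix \<rho> assume "0 < \<rho>" "\<rho> \<le> r"
    then obtain U where U: "ball (\<rho> *\<^sub>R (- \<phi>)) (c * \<rho>) \<subseteq> U" "off_diagonal_pairing M U" using 1(3) by blast
    have "ball (\<rho> *\<^sub>R \<phi>) (c * \<rho>) \<subseteq> uminus ` U"
    proof
      fix u assume u: "u \<in> ball (\<rho> *\<^sub>R \<phi>) (c * \<rho>)"
      have "dist (\<rho> *\<^sub>R (- \<phi>)) (- u) = dist (\<rho> *\<^sub>R \<phi>) u"
        by (simp add: dist_norm norm_minus_commute)
      then have "- u \<in> U" using u U(1) by auto
      then show "u \<in> uminus ` U" by (metis image_eqI minus_minus)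
    qed
    then show "\<exists>U. ball (\<rho> *\<^sub>R \<phi>) (c * \<rho>) \<subseteq> U \<and> off_diagonal_pairing M U"
      using off_diagonal_pairing_uminus[OF fin sets U(2)] by blast
  qed
qed

text \<open>The condition for a direction extends, with a halved constant, to all directions close to it, so
  compactness of the unit circle yields constants that work for all directions.\<close>

lemma covered_directions_uniform:
  assumes "\<And>\<phi>. norm \<phi> = 1 \<Longrightarrow> covered_direction M \<phi>"
  obtains c r where "0 < c" "0 < r"
    "\<And>u. 0 < norm u \<Longrightarrow> norm u \<le> r \<Longrightarrow> \<exists>U. ball u (c * norm u) \<subseteq> U \<and> off_diagonal_pairing M U"
proof -
  have "\<forall>\<phi>\<in>sphere 0 1. \<exists>c r. 0 < c \<and> 0 < r \<and> (\<forall>\<rho>. 0 < \<rho> \<longrightarrow> \<rho> \<le> r \<longrightarrow>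
     (\<exists>U. ball (\<rho> *\<^sub>R \<phi>) (c * \<rho>) \<subseteq> U \<and> off_diagonal_pairing M U))"
  proof
    fix \<phi> :: "real^2" assume "\<phi> \<in> sphere 0 1"
    then have "norm \<phi> = 1" by simp
    from assms[OF this] show "\<exists>c r. 0 < c \<and> 0 < r \<and> (\<forall>\<rho>. 0 < \<rho> \<longrightarrow> \<rho> \<le> r \<longrightarrow>
     (\<exists>U. ball (\<rho> *\<^sub>R \<phi>) (c * \<rho>) \<subseteq> U \<and> off_diagonal_pairing M U))"
      unfolding covered_direction_def by blast
  qed
  then obtain c r where cr: "\<forall>\<phi>\<in>sphere 0 1. 0 < c \<phi> \<and> 0 < r \<phi> \<and> (\<forall>\<rho>. 0 < \<rho> \<longrightarrow> \<rho> \<le> r \<phi> \<longrightarrow>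
     (\<exists>U. ball (\<rho> *\<^sub>R \<phi>) (c \<phi> * \<rho>) \<subseteq> U \<and> off_diagonal_pairing M U))"
    unfolding bchoice_iff by (elim exE) (rule that)
  have "sphere (0::real^2) 1 \<subseteq> (\<Union>\<phi>\<in>sphere 0 1. ball \<phi> (c \<phi> / 2))"
    using cr by (intro subsetI) (auto intro!: bexI)
  then obtain F where F: "F \<subseteq> sphere 0 1" "finite F" "sphere (0::real^2) 1 \<subseteq> (\<Union>\<phi>\<in>F. ball \<phi> (c \<phi> / 2))"
    by (rule compactE_image[OF compact_sphere, rotated]) auto
  have "axis 1 1 \<in> sphere (0::real^2) 1" by (simp add: norm_real2 axis_def)
  then have Fne: "F \<noteq> {}" using F(3) by blast
  define c0 where "c0 = Min (c ` F) / 2"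
  define r0 where "r0 = Min (r ` F)"
  have c0: "0 < c0" "\<And>\<phi>. \<phi> \<in> F \<Longrightarrow> c0 \<le> c \<phi> / 2"
    using F Fne cr unfolding c0_def by (auto simp: subset_iff)
  have r0: "0 < r0" "\<And>\<phi>. \<phi> \<in> F \<Longrightarrow> r0 \<le> r \<phi>"
    using F Fne cr unfolding r0_def by (auto simp: subset_iff)
  show ?thesis
  proof (rule that[OF c0(1) r0(1)])
    fix u :: "real^2" assume u: "0 < norm u" "norm u \<le> r0"
    let ?n = "norm u"
    have "(1 / ?n) *\<^sub>R u \<in> sphere 0 1" using u by simp
    then obtain \<phi> where phi: "\<phi> \<in> F" "(1 / ?n) *\<^sub>R u \<in> ball \<phi> (c \<phi> / 2)" using F(3) by blast
    obtain U where U: "ball (?n *\<^sub>R \<phi>) (c \<phi> * ?n) \<subseteq> U" "off_diagonal_pairing M U"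
      using cr F(1) phi(1) u r0(2)[OF phi(1)] by (meson order_trans subsetD)
    have "dist (?n *\<^sub>R \<phi>) u = ?n * dist \<phi> ((1 / ?n) *\<^sub>R u)"
    proof -
      have "?n *\<^sub>R \<phi> - u = ?n *\<^sub>R (\<phi> - (1 / ?n) *\<^sub>R u)" using u by (simp add: scaleR_diff_right)
      then show ?thesis by (simp add: dist_norm)
    qed
    also have "\<dots> < ?n * (c \<phi> / 2)" using phi(2) u by (intro mult_strict_left_mono) auto
    finally have d: "dist (?n *\<^sub>R \<phi>) u < ?n * (c \<phi> / 2)" .
    have "ball u (c0 * ?n) \<subseteq> ball (?n *\<^sub>R \<phi>) (c \<phi> * ?n)"
    proof
      fix v assume "v \<in> ball u (c0 * ?n)"
      then have "dist u v < c \<phi> / 2 * ?n"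
        using mult_right_mono[OF c0(2)[OF phi(1)], of ?n] by simp
      then show "v \<in> ball (?n *\<^sub>R \<phi>) (c \<phi> * ?n)"
        using d dist_triangle[of "?n *\<^sub>R \<phi>" v u] by (simp add: algebra_simps)
    qed
    then show "\<exists>U. ball u (c0 * ?n) \<subseteq> U \<and> off_diagonal_pairing M U" using U by blast
  qed
qed

section \<open>Corners and cones\<close>

text \<open>For linearly independent \<open>v\<close> and \<open>w\<close> these are the vectors \<open>s *\<^sub>R v + t *\<^sub>R w\<close> with \<open>s \<in> I\<close> and \<open>t \<in> J\<close>.
  Being defined by the coordinates, the set is visibly Borel.\<close>

definition cone_set :: "real^2 \<Rightarrow> real^2 \<Rightarrow> real set \<Rightarrow> real set \<Rightarrow> (real^2) set" where
  "cone_set v w I J = {u. cross2 u w / cross2 v w \<in> I \<and> cross2 v u / cross2 v w \<in> J}"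

lemma cone_set_commute: "cone_set v w I J = cone_set w v J I"
  unfolding cone_set_def using cross2_commute[of v w] cross2_commute[of v] cross2_commute[of _ w] by auto

lemma cone_set_eq_image:
  assumes "cross2 v w \<noteq> 0"
  shows "cone_set v w I J = (\<lambda>(t, s). (p + t *\<^sub>R w) - (p - s *\<^sub>R v)) ` (J \<times> I)"
proof safe
  fix u assume u: "u \<in> cone_set v w I J"
  have "u = (cross2 u w / cross2 v w) *\<^sub>R v + (cross2 v u / cross2 v w) *\<^sub>R w"
  proof -
    have "cross2 v w *\<^sub>R u = cross2 v w *\<^sub>R ((cross2 u w / cross2 v w) *\<^sub>R v + (cross2 v u / cross2 v w) *\<^sub>R w)"
      using assms by (simp add: scaleR_add_right cross2_cramer[of v w u])
    then show ?thesis using assms by simp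
  qed
  then have "u = (\<lambda>(t, s). (p + t *\<^sub>R w) - (p - s *\<^sub>R v)) (cross2 v u / cross2 v w, cross2 u w / cross2 v w)"
    by (simp add: add.commute)
  then show "u \<in> (\<lambda>(t, s). (p + t *\<^sub>R w) - (p - s *\<^sub>R v)) ` (J \<times> I)"
    using u unfolding cone_set_def by (intro image_eqI) auto
next
  fix t s assume "t \<in> J" "s \<in> I"
  then show "p + t *\<^sub>R w - (p - s *\<^sub>R v) \<in> cone_set v w I J"
    using assms by (simp add: cone_set_def cross2_simps)
qed

locale finite_arc_length =
  fixes E :: "(real^2) set"
  assumes E: "compact E" "hausdorff1_outer E < top" "0 < hausdorff1_outer E"
begin

abbreviation "M \<equiv> arc_length_measure E"

lemmas fin = finite_arc_length_measure[OF E]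
lemmas sets_M = sets_arc_length_measure[of E]
lemmas dominated = dominated_param_arc_length[OF E]

lemma segment_dominated:
  assumes "w \<noteq> 0" "\<And>t. t \<in> {0..1} \<Longrightarrow> p + t *\<^sub>R w \<in> E" "I \<in> sets borel" "I \<subseteq> {0..1}"
  shows "dominated_param M I (\<lambda>t. p + t *\<^sub>R w)"
proof (rule dominated)
  show "bounded I" using assms(4) bounded_closed_interval bounded_subset by blast
  show "(\<lambda>t. p + t *\<^sub>R w) \<in> borel_measurable borel"
    by (intro borel_measurable_continuous_onI continuous_intros)
  show "(\<lambda>t. p + t *\<^sub>R w) ` I \<subseteq> E" using assms(2,4) by auto
  show "0 < 1 / norm w" using assms(1) by simp
  fix s t
  have "dist (p + s *\<^sub>R w) (p + t *\<^sub>R w) = \<bar>s - t\<bar> * norm w"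
    by (simp add: dist_norm flip: scaleR_diff_left)
  then show "\<bar>s - t\<bar> \<le> 1 / norm w * dist (p + s *\<^sub>R w) (p + t *\<^sub>R w)"
    using assms(1) by simp
qed fact+

text \<open>At the corner \<open>p\<close>, where a segment in direction \<open>v\<close> ends and one in direction \<open>w\<close> starts, the differences
  of points of the two segments form the cone spanned by \<open>v\<close> and \<open>w\<close>. The only common point of the segments
  is \<open>p\<close> itself, so excluding the parameter \<open>0\<close> on one side makes the supports disjoint.\<close>

lemma corner_pairing:
  assumes D: "cross2 v w \<noteq> 0"
    and seg: "\<And>s. s \<in> {0..1} \<Longrightarrow> p - s *\<^sub>R v \<in> E" "\<And>s. s \<in> {0..1} \<Longrightarrow> p + s *\<^sub>R w \<in> E"
    and I: "I \<in> sets borel" "I \<subseteq> {0..1}" and J: "J \<in> sets borel" "J \<subseteq> {0..1}" and zero: "\<not> (0 \<in> I \<and> 0 \<in> J)"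
  shows "off_diagonal_pairing M (cone_set v w I J)"
proof -
  have v0: "v \<noteq> 0" "w \<noteq> 0" using D by (auto simp: cross2_simps)
  have [measurable]: "(\<lambda>x. cross2 (x - q) z) \<in> borel_measurable borel" "(\<lambda>x. cross2 z (x - q)) \<in> borel_measurable borel"
    "(\<lambda>x. cross2 x z) \<in> borel_measurable borel" "(\<lambda>x. cross2 z x) \<in> borel_measurable borel" for q z
    unfolding cross2_def by (intro borel_measurable_continuous_onI continuous_intros)+
  note [measurable] = I(1) J(1)
  define S1 where "S1 = {x. cross2 v (x - p) / cross2 v w \<in> J \<and> cross2 (x - p) w / cross2 v w = 0}"
  define S2 where "S2 = {x. - (cross2 (x - p) w / cross2 v w) \<in> I \<and> cross2 v (x - p) / cross2 v w = 0}"
  have "off_diagonal_pairing M ((\<lambda>(t, s). (p + t *\<^sub>R w) - (p - s *\<^sub>R v)) ` (J \<times> I))"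
  proof (rule off_diagonal_pairing_product[OF fin sets_M, where ?h1' = "\<lambda>_. w" and ?h2' = "\<lambda>_. - v" and \<kappa> = "sgn (cross2 w (- v))"])
    show "dominated_param M J (\<lambda>t. p + t *\<^sub>R w)" by (rule segment_dominated) (use v0 seg J in auto)
    show "dominated_param M I (\<lambda>s. p - s *\<^sub>R v)"
      using segment_dominated[of "- v" p I] v0 seg I by simp
    show "S1 \<in> sets borel" "S2 \<in> sets borel" unfolding S1_def S2_def by measurable
    show "(\<lambda>t. p + t *\<^sub>R w) ` J \<subseteq> S1" using D by (auto simp: S1_def cross2_simps)
    show "(\<lambda>s. p - s *\<^sub>R v) ` I \<subseteq> S2" using D by (auto simp: S2_def cross2_simps)
    show "S1 \<inter> S2 = {}" using zero by (auto simp: S1_def S2_def)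
    show "((\<lambda>t. p + t *\<^sub>R w) has_vector_derivative w) (at s within J)" for s
      by (auto intro!: derivative_eq_intros)
    show "((\<lambda>s. p - s *\<^sub>R v) has_vector_derivative - v) (at t within I)" for t
      by (auto intro!: derivative_eq_intros)
    show "bounded_borel (\<lambda>s. indicator J s * w $ i)" "bounded_borel (\<lambda>t. indicator I t * (- v) $ i)" for i
      by (rule bounded_borelI[where B="\<bar>w $ i\<bar> + \<bar>v $ i\<bar>"], measurable, simp add: indicator_def)+
    show "\<bar>cross2 w (- v)\<bar> = sgn (cross2 w (- v)) * cross2 w (- v)" by (simp add: sgn_if)
    show "inj_on (\<lambda>(t, s). (p + t *\<^sub>R w) - (p - s *\<^sub>R v)) (J \<times> I)"
    proof (rule inj_onI, clarify)
      fix t s t' s'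
      assume eq: "p + t *\<^sub>R w - (p - s *\<^sub>R v) = p + t' *\<^sub>R w - (p - s' *\<^sub>R v)"
      then have "cross2 v (t *\<^sub>R w + s *\<^sub>R v) = cross2 v (t' *\<^sub>R w + s' *\<^sub>R v)"
        "cross2 (t *\<^sub>R w + s *\<^sub>R v) w = cross2 (t' *\<^sub>R w + s' *\<^sub>R v) w" by simp_all
      then show "t = t' \<and> s = s'" using D by (simp add: cross2_simps)
    qed
    show "(\<lambda>(t, s). (p + t *\<^sub>R w) - (p - s *\<^sub>R v)) ` (J \<times> I) \<in> sets borel"
      unfolding cone_set_eq_image[OF D, of I J p, symmetric] cone_set_def by measurable
    have "norm ((p + t *\<^sub>R w) - (p - s *\<^sub>R v)) \<le> norm w + norm v" if "t \<in> J" "s \<in> I" for t s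
    proof -
      have "norm ((p + t *\<^sub>R w) - (p - s *\<^sub>R v)) \<le> norm (t *\<^sub>R w) + norm (s *\<^sub>R v)"
        using norm_triangle_ineq[of "t *\<^sub>R w" "s *\<^sub>R v"] by simp
      also have "\<dots> \<le> 1 * norm w + 1 * norm v"
        unfolding norm_scaleR using that I J by (intro add_mono mult_right_mono) (auto simp: subset_iff)
      finally show ?thesis by simp
    qed
    then show "bounded ((\<lambda>(t, s). (p + t *\<^sub>R w) - (p - s *\<^sub>R v)) ` (J \<times> I))"
      unfolding bounded_iff by auto
  qed
  then show ?thesis by (simp only: cone_set_eq_image[OF D, of I J p])
qed

end

lemma covered_direction_cone_interior:
  assumes pair: "off_diagonal_pairing M (cone_set v w {0<..1} {0<..1})"
    and pos: "0 < cross2 \<phi> w / cross2 v w" "0 < cross2 v \<phi> / cross2 v w"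
  shows "covered_direction M \<phi>"
proof (rule covered_direction_near_ray[OF _ pair])
  show "near_ray \<phi> (\<lambda>u. u \<in> cone_set v w {0<..1} {0<..1})"
  proof (rule near_ray_mono)
    show "near_ray \<phi> (\<lambda>u. (cross2 u w / cross2 v w \<le> 1 \<and> 0 < cross2 u w / cross2 v w) \<and>
        (cross2 v u / cross2 v w \<le> 1 \<and> 0 < cross2 v u / cross2 v w))"
      by (intro near_ray_conj near_ray_small near_ray_pos bounded_linear_cross2 pos)
  qed (simp add: cone_set_def)
qed

text \<open>The cones lie on opposite sides of the line through \<open>\<phi>\<close> and both have the ray of \<open>\<phi>\<close> on their boundary;
  together they cover a neighbourhood of this ray. The ray is assigned to the first cone only, which
  keeps the union disjoint.\<close>

lemma covered_direction_two_cones: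
  assumes p1: "off_diagonal_pairing M (cone_set x (\<tau> *\<^sub>R \<phi>) {0..1} {0<..1})"
    and p2: "off_diagonal_pairing M (cone_set (\<tau>' *\<^sub>R \<phi>) w {0<..1} {0<..1})"
    and t: "0 < \<tau>" "0 < \<tau>'" and opp: "cross2 \<phi> x * cross2 \<phi> w < 0"
  shows "covered_direction M \<phi>"
proof -
  let ?c = "cross2 \<phi>"
  let ?U1 = "cone_set x (\<tau> *\<^sub>R \<phi>) {0..1} {0<..1}" and ?U2 = "cone_set (\<tau>' *\<^sub>R \<phi>) w {0<..1} {0<..1}"
  have ne: "?c x \<noteq> 0" "?c w \<noteq> 0" using opp by auto
  have f1: "cross2 u (\<tau> *\<^sub>R \<phi>) / cross2 x (\<tau> *\<^sub>R \<phi>) = ?c u / ?c x" for u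
    using t cross2_commute[of u \<phi>] cross2_commute[of x \<phi>] by (simp add: cross2_simps)
  have g2: "cross2 (\<tau>' *\<^sub>R \<phi>) u / cross2 (\<tau>' *\<^sub>R \<phi>) w = ?c u / ?c w" for u
    using t by (simp add: cross2_simps)
  have signs: "0 < ?c u / ?c w \<longleftrightarrow> \<not> 0 \<le> ?c u / ?c x" for u
    using opp by (auto simp: mult_less_0_iff zero_less_divide_iff zero_le_divide_iff)
  have disj: "?U1 \<inter> ?U2 = {}"
    unfolding cone_set_def f1 g2 using signs by auto
  have pos: "0 < cross2 x \<phi> / cross2 x (\<tau> *\<^sub>R \<phi>)" "0 < cross2 \<phi> w / cross2 (\<tau>' *\<^sub>R \<phi>) w"
    using t ne cross2_commute[of x \<phi>] by (simp_all add: cross2_simps)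
  show ?thesis
  proof (rule covered_direction_near_ray[OF _ off_diagonal_pairing_Un[OF p1 p2 disj]])
    have "near_ray \<phi> (\<lambda>u. (cross2 x u / cross2 x (\<tau> *\<^sub>R \<phi>) \<le> 1 \<and> 0 < cross2 x u / cross2 x (\<tau> *\<^sub>R \<phi>)) \<and>
        (cross2 u w / cross2 (\<tau>' *\<^sub>R \<phi>) w \<le> 1 \<and> 0 < cross2 u w / cross2 (\<tau>' *\<^sub>R \<phi>) w) \<and>
        ?c u / ?c x \<le> 1 \<and> ?c u / ?c w \<le> 1)"
      by (intro near_ray_conj near_ray_small near_ray_pos bounded_linear_cross2 pos)
    then show "near_ray \<phi> (\<lambda>u. u \<in> ?U1 \<union> ?U2)"
    proof (rule near_ray_mono)
      fix u
      assume u: "(cross2 x u / cross2 x (\<tau> *\<^sub>R \<phi>) \<le> 1 \<and> 0 < cross2 x u / cross2 x (\<tau> *\<^sub>R \<phi>)) \<and>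
        (cross2 u w / cross2 (\<tau>' *\<^sub>R \<phi>) w \<le> 1 \<and> 0 < cross2 u w / cross2 (\<tau>' *\<^sub>R \<phi>) w) \<and>
        ?c u / ?c x \<le> 1 \<and> ?c u / ?c w \<le> 1"
      show "u \<in> ?U1 \<union> ?U2"
      proof (cases "0 \<le> ?c u / ?c x")
        case True
        then have "u \<in> ?U1" using u unfolding cone_set_def f1 by auto
        then show ?thesis ..
      next
        case False
        then have "u \<in> ?U2" using u signs[of u] unfolding cone_set_def g2 by auto
        then show ?thesis ..
      qed
    qed
  qed
qed

section \<open>Closed sequences of directions\<close>

text \<open>A periodic sequence with sum zero takes both signs. Going from a negative term to the next positive
  one and then back to the last negative term before it leaves only zeros in between.\<close>

lemma sign_change:
  fixes d :: "nat \<Rightarrow> real"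
  assumes N: "0 < N" and per: "\<And>k. d (k + N) = d k" and sum: "(\<Sum>k<N. d k) = 0" and nz: "\<exists>k. d k \<noteq> 0"
  obtains a b where "a < b" "d a < 0" "0 < d b" "\<And>k. a < k \<Longrightarrow> k < b \<Longrightarrow> d k = 0"
proof -
  have permod: "d k = d (k mod N)" for k
  proof (induction k rule: less_induct)
    case (less k)
    show ?case
    proof (cases "k < N")
      case False
      then have "d k = d (k - N)" using per[of "k - N"] by simp
      also have "\<dots> = d ((k - N) mod N)" using less False N by simp
      also have "(k - N) mod N = k mod N" using False by (simp add: le_mod_geq)
      finally show ?thesis .
    qed simp
  qed
  have "\<exists>k<N. d k < 0"
  proof (rule ccontr)
    assume "\<not> ?thesis"
    then have nn: "\<And>k. k < N \<Longrightarrow> 0 \<le> d k" by force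
    then have "\<forall>k\<in>{..<N}. d k = 0" using sum by (subst (asm) sum_nonneg_eq_0_iff) auto
    then show False using nz permod N by (metis lessThan_iff mod_less_divisor)
  qed
  then obtain a0 where a0: "d a0 < 0" by blast
  have "\<exists>k<N. 0 < d k"
  proof (rule ccontr)
    assume "\<not> ?thesis"
    then have nn: "\<And>k. k < N \<Longrightarrow> 0 \<le> - d k" by force
    have "(\<Sum>k<N. - d k) = 0" using sum by (simp add: sum_negf)
    then have "\<forall>k\<in>{..<N}. - d k = 0" using nn by (subst (asm) sum_nonneg_eq_0_iff) auto
    then show False using nz permod N by (metis lessThan_iff mod_less_divisor neg_equal_0_iff_equal)
  qed
  then obtain b0 where b0: "b0 < N" "0 < d b0" by blast
  have "d (b0 + N * Suc a0) = d b0" using permod[of "b0 + N * Suc a0"] permod[of b0] by (simp only: mod_mult_self2)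
  moreover have "a0 < b0 + N * Suc a0" using N by (cases N) auto
  ultimately have ex: "\<exists>b. a0 < b \<and> 0 < d b" using b0 by auto
  define b where "b = (LEAST b. a0 < b \<and> 0 < d b)"
  have b: "a0 < b" "0 < d b" using LeastI_ex[OF ex] by (auto simp: b_def)
  have bl: "\<not> 0 < d k" if "a0 < k" "k < b" for k using not_less_Least[of k "\<lambda>b. a0 < b \<and> 0 < d b"] that by (auto simp: b_def)
  define a where "a = Max {k. k < b \<and> d k < 0}"
  have fin: "finite {k. k < b \<and> d k < 0}" by simp
  have ne: "a0 \<in> {k. k < b \<and> d k < 0}" using a0 b by simp
  have a: "a \<in> {k. k < b \<and> d k < 0}" unfolding a_def using fin ne by (intro Max_in) auto
  have aa: "a0 \<le> a" unfolding a_def using fin ne by (rule Max_ge)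
  have al: "\<not> d k < 0" if "a < k" "k < b" for k
  proof
    assume "d k < 0"
    then have "k \<le> a" unfolding a_def using that by (intro Max_ge[OF fin]) simp
    then show False using that by simp
  qed
  show ?thesis
    by (rule that[of a b]) (use a b al bl aa in \<open>auto intro: antisym simp: not_less\<close>)
qed

text \<open>Without reversals, consecutive parallel vectors keep pointing to the same side.\<close>

lemma parallel_run:
  fixes e :: "nat \<Rightarrow> real^2"
  assumes ne: "\<And>k. e k \<noteq> 0" and anti: "\<And>k c. 0 < c \<Longrightarrow> e (Suc k) \<noteq> - (c *\<^sub>R e k)" and phi: "\<phi> \<noteq> 0"
    and par: "\<And>k. a \<le> k \<Longrightarrow> k \<le> m \<Longrightarrow> cross2 \<phi> (e k) = 0" and am: "a \<le> m"
  shows "\<exists>\<psi> \<tau> \<tau>'. (\<psi> = \<phi> \<or> \<psi> = - \<phi>) \<and> 0 < \<tau> \<and> 0 < \<tau>' \<and> e a = \<tau> *\<^sub>R \<psi> \<and> e m = \<tau>' *\<^sub>R \<psi>"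
proof -
  obtain \<tau>0 where t0: "e a = \<tau>0 *\<^sub>R \<phi>" using cross2_parallel[OF par[OF order_refl am] phi] .
  have t0n: "\<tau>0 \<noteq> 0" using ne[of a] t0 by auto
  define \<psi> where "\<psi> = (if 0 < \<tau>0 then \<phi> else - \<phi>)"
  have psi: "\<psi> = \<phi> \<or> \<psi> = - \<phi>" "\<psi> \<noteq> 0" "\<And>v. cross2 \<psi> v = 0 \<longleftrightarrow> cross2 \<phi> v = 0"
    using phi by (auto simp: \<psi>_def cross2_simps)
  have base: "\<exists>\<tau>>0. e a = \<tau> *\<^sub>R \<psi>"
    using t0 t0n by (intro exI[of _ "\<bar>\<tau>0\<bar>"]) (auto simp: \<psi>_def)
  have step: "k \<le> m \<longrightarrow> (\<exists>\<tau>>0. e k = \<tau> *\<^sub>R \<psi>)" if "a \<le> k" for k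
    using that
  proof (induction k rule: dec_induct)
    case base then show ?case using \<open>\<exists>\<tau>>0. e a = \<tau> *\<^sub>R \<psi>\<close> by simp
  next
    case (step k)
    show ?case
    proof
      assume km: "Suc k \<le> m"
      then obtain t where t: "0 < t" "e k = t *\<^sub>R \<psi>" using step by auto
      have "cross2 \<psi> (e (Suc k)) = 0" using par[of "Suc k"] km step(1) psi(3) by simp
      then obtain t' where t': "e (Suc k) = t' *\<^sub>R \<psi>" using cross2_parallel[OF _ psi(2)] by blast
      have "t' \<noteq> 0" using ne[of "Suc k"] t' by auto
      moreover have "\<not> t' < 0"
      proof
        assume "t' < 0"
        then have "0 < - t' / t" "e (Suc k) = - ((- t' / t) *\<^sub>R e k)"
          using t t' \<open>t' < 0\<close> by (auto simp: divide_neg_pos)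
        then show False using anti by blast
      qed
      ultimately show "\<exists>\<tau>>0. e (Suc k) = \<tau> *\<^sub>R \<psi>" using t' by (intro exI[of _ t']) auto
    qed
  qed
  obtain \<tau> where 1: "0 < \<tau>" "e a = \<tau> *\<^sub>R \<psi>" using base by blast
  obtain \<tau>' where 2: "0 < \<tau>'" "e m = \<tau>' *\<^sub>R \<psi>" using step[OF am] by blast
  show ?thesis using psi(1) 1 2 by blast
qed

text \<open>The determinants \<open>d k\<close> of \<open>\<phi>\<close> with the vectors \<open>e k\<close> sum to zero over a period. They cannot all vanish,
  since then all \<open>e k\<close> would be positive multiples of one vector and their sum would not be zero.
  Hence the sequence passes from one side of the line through \<open>\<phi>\<close> to the other. It does so either in one
  step, and then \<open>\<phi>\<close> or \<open>- \<phi>\<close> lies inside the cone of two consecutive vectors, or by way of multiples of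
  \<open>\<phi>\<close>, and then this ray separates two cones of consecutive vectors.\<close>

lemma covered_direction_cyclic:
  fixes e :: "nat \<Rightarrow> real^2"
  assumes fin: "finite_measure M" and sets: "sets M = sets borel"
    and N: "0 < N" and per: "\<And>k. e (k + N) = e k" and sum: "(\<Sum>k<N. e k) = 0"
    and ne: "\<And>k. e k \<noteq> 0" and anti: "\<And>k c. 0 < c \<Longrightarrow> e (Suc k) \<noteq> - (c *\<^sub>R e k)"
    and pair: "\<And>k I J. cross2 (e k) (e (Suc k)) \<noteq> 0 \<Longrightarrow> I \<in> sets borel \<Longrightarrow> I \<subseteq> {0..1} \<Longrightarrow> J \<in> sets borel \<Longrightarrow> J \<subseteq> {0..1} \<Longrightarrow>
       \<not> (0 \<in> I \<and> 0 \<in> J) \<Longrightarrow> off_diagonal_pairing M (cone_set (e k) (e (Suc k)) I J)"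
    and phi: "\<phi> \<noteq> 0"
  shows "covered_direction M \<phi>"
proof -
  define d where "d k = cross2 \<phi> (e k)" for k
  have dsum: "(\<Sum>k<N. d k) = 0"
  proof -
    have "(\<Sum>k<n. d k) = cross2 \<phi> (\<Sum>k<n. e k)" for n
      by (induction n) (simp_all add: d_def cross2_simps)
    then show ?thesis using sum by (simp add: cross2_simps)
  qed
  have nz: "\<exists>k. d k \<noteq> 0"
  proof (rule ccontr)
    assume "\<not> ?thesis"
    then have d0: "\<And>k. cross2 \<phi> (e k) = 0" by (simp add: d_def)
    have pos: "0 < e 0 \<bullet> e k" for k
    proof -
      obtain \<psi> \<tau> \<tau>' where t: "0 < \<tau>" "0 < \<tau>'" "e 0 = \<tau> *\<^sub>R \<psi>" "e k = \<tau>' *\<^sub>R \<psi>"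
        using parallel_run[where e = e and \<phi> = \<phi> and a = 0 and m = k, OF ne anti phi d0] by auto
      have "\<psi> \<noteq> 0" using t ne[of 0] by auto
      then show ?thesis using t by simp
    qed
    have "0 < (\<Sum>k<N. e 0 \<bullet> e k)" using N pos by (intro sum_pos) auto
    then show False using sum by (simp flip: inner_sum_right)
  qed
  obtain a b where ab: "a < b" "d a < 0" "0 < d b" "\<And>k. a < k \<Longrightarrow> k < b \<Longrightarrow> d k = 0"
    using sign_change[OF N _ dsum nz] per by (metis d_def)
  note um = covered_direction_uminus[OF fin sets]
  show ?thesis
  proof (cases "b = Suc a")
    case True
    let ?x = "e a" and ?y = "e b"
    let ?D = "cross2 ?x ?y"
    have D0: "?D \<noteq> 0"
    proof
      assume D: "?D = 0"
      obtain t where t: "?y = t *\<^sub>R ?x" using cross2_parallel[OF D ne] .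
      then have "d b = t * d a" by (simp add: d_def cross2_simps)
      then have "t < 0" using ab by (metis mult_nonneg_nonpos less_eq_real_def not_less)
      then show False using anti[of "- t" a] t True by simp
    qed
    have pr: "off_diagonal_pairing M (cone_set ?x ?y {0<..1} {0<..1})"
      unfolding True using D0 True by (intro pair) auto
    have xphi: "cross2 ?x \<phi> = - d a" using cross2_commute[of "e a" \<phi>] by (simp add: d_def)
    show ?thesis
    proof (cases "0 < ?D")
      case True
      show ?thesis
        by (rule covered_direction_cone_interior[OF pr]) (use True ab xphi in \<open>auto simp: d_def[symmetric] divide_neg_pos\<close>)
    next
      case False
      then have "?D < 0" using D0 by simp
      then have "covered_direction M (- \<phi>)"
        by (intro covered_direction_cone_interior[OF pr])
           (use ab xphi in \<open>auto simp: d_def[symmetric] cross2_simps divide_neg_neg divide_pos_neg\<close>)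
      then show ?thesis by (rule um)
    qed
  next
    case False
    then have lt: "Suc a \<le> b - 1" "Suc (b - 1) = b" using ab(1) by auto
    obtain \<psi> \<tau> \<tau>' where t: "\<psi> = \<phi> \<or> \<psi> = - \<phi>" "0 < \<tau>" "0 < \<tau>'" "e (Suc a) = \<tau> *\<^sub>R \<psi>" "e (b - 1) = \<tau>' *\<^sub>R \<psi>"
    proof -
      have "cross2 \<phi> (e k) = 0" if "Suc a \<le> k" "k \<le> b - 1" for k
        using ab(4)[of k] that lt unfolding d_def by auto
      from parallel_run[where e = e and \<phi> = \<phi> and a = "Suc a" and m = "b - 1", OF ne anti phi this lt(1)]
      show ?thesis using that by blast
    qed
    have psi: "cross2 \<psi> (e a) * cross2 \<psi> (e b) < 0"
      using t(1) ab(2,3) by (auto simp: d_def cross2_simps mult_neg_pos)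
    have "covered_direction M \<psi>"
    proof (rule covered_direction_two_cones[OF _ _ t(2,3) psi])
      have "cross2 (e a) \<psi> \<noteq> 0" "cross2 \<psi> (e b) \<noteq> 0"
        using psi cross2_commute[of "e a" \<psi>] by auto
      then have ne1: "cross2 (e a) (e (Suc a)) \<noteq> 0" and ne2: "cross2 (e (b - 1)) (e (Suc (b - 1))) \<noteq> 0"
        unfolding lt(2) t(4,5) using t(2,3) by (simp_all add: cross2_simps)
      show "off_diagonal_pairing M (cone_set (e a) (\<tau> *\<^sub>R \<psi>) {0..1} {0<..1})"
        unfolding t(4)[symmetric] using ne1 by (intro pair) auto
      show "off_diagonal_pairing M (cone_set (\<tau>' *\<^sub>R \<psi>) (e b) {0<..1} {0<..1})"
        unfolding t(5)[symmetric] using pair[OF ne2, of "{0<..1}" "{0<..1}"] unfolding lt(2) by (auto simp: subset_iff)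
    qed
    then show ?thesis using t(1) um by auto
  qed
qed

context finite_arc_length begin

lemma not_tight_frame_if_covered:
  assumes cov: "\<And>\<phi>. norm \<phi> = 1 \<Longrightarrow> covered_direction M \<phi>"
    and dom: "dominated_param M I h" and l: "0 < l" and sub: "{a..a + l} \<subseteq> I"
    and K: "0 < K" and lip: "\<And>s. s \<in> {a..a + l} \<Longrightarrow> dist (h a) (h s) \<le> K * (s - a)"
  shows "\<not> tight_frame_spectral_measure M"
proof -
  obtain c e where ce: "0 < c" "0 < e" "\<And>\<epsilon>. 0 < \<epsilon> \<Longrightarrow> \<epsilon> \<le> e \<Longrightarrow> c * \<epsilon> \<le> measure M (cball (h a) \<epsilon>)"
    by (rule dominated_param_mass[OF fin sets_M dom l sub K lip], assumption, rule that)
  obtain c' r where cr: "0 < c'" "0 < r"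
    "\<And>u. 0 < norm u \<Longrightarrow> norm u \<le> r \<Longrightarrow> \<exists>U. ball u (c' * norm u) \<subseteq> U \<and> off_diagonal_pairing M U"
    by (rule covered_directions_uniform[OF cov], assumption, rule that)
  show ?thesis by (rule not_tight_frame_if_off_diagonal_pairings[OF fin sets_M cr ce])
qed

text \<open>The set \<open>{v, w}\<close> leaves open which of the two consecutive vectors arrives at the corner and which one
  departs from it: both occur for three segments starting at a common point.\<close>

lemma not_tight_frame_if_segments_cyclic:
  fixes e :: "nat \<Rightarrow> real^2"
  assumes N: "0 < N" and per: "\<And>k. e (k + N) = e k" and sum: "(\<Sum>k<N. e k) = 0"
    and ne: "\<And>k. e k \<noteq> 0" and anti: "\<And>k c. 0 < c \<Longrightarrow> e (Suc k) \<noteq> - (c *\<^sub>R e k)"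
    and corner: "\<And>k. \<exists>p. \<exists>v w. {v, w} = {e k, e (Suc k)} \<and> (\<forall>s\<in>{0..1}. p - s *\<^sub>R v \<in> E \<and> p + s *\<^sub>R w \<in> E)"
  shows "\<not> tight_frame_spectral_measure M"
proof -
  have pair: "off_diagonal_pairing M (cone_set (e k) (e (Suc k)) I J)"
    if D: "cross2 (e k) (e (Suc k)) \<noteq> 0" and I: "I \<in> sets borel" "I \<subseteq> {0..1}" and J: "J \<in> sets borel" "J \<subseteq> {0..1}"
      and z: "\<not> (0 \<in> I \<and> 0 \<in> J)" for k I J
  proof -
    obtain p v w where c: "{v, w} = {e k, e (Suc k)}" "\<forall>s\<in>{0..1}. p - s *\<^sub>R v \<in> E \<and> p + s *\<^sub>R w \<in> E"
      using corner[of k] by (elim exE conjE) (rule that)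
    then consider "v = e k" "w = e (Suc k)" | "w = e k" "v = e (Suc k)" by (auto simp: doubleton_eq_iff)
    then show ?thesis
    proof cases
      case 1
      then show ?thesis using D I J z c(2) by (intro corner_pairing[of _ _ p]) auto
    next
      case 2
      have "off_diagonal_pairing M (cone_set v w J I)"
        using D I J z c(2) 2 cross2_commute[of v w] by (intro corner_pairing[of _ _ p]) auto
      then show ?thesis using 2 cone_set_commute by metis
    qed
  qed
  have cov: "covered_direction M \<phi>" if "norm \<phi> = 1" for \<phi>
  proof -
    have "\<phi> \<noteq> 0" using that by auto
    from covered_direction_cyclic[OF fin sets_M N per sum ne anti pair this] show ?thesis .
  qed
  obtain p v w where c: "{v, w} = {e 0, e (Suc 0)}" "\<forall>s\<in>{0..1}. p - s *\<^sub>R v \<in> E \<and> p + s *\<^sub>R w \<in> E"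
    using corner[of 0] by (elim exE conjE) (rule that)
  have w: "w \<noteq> 0" using c(1) ne by (metis insertCI insertE singletonD)
  show ?thesis
  proof (rule not_tight_frame_if_covered[OF cov, where h = "\<lambda>t. p + t *\<^sub>R w" and a = 0 and l = 1 and K = "norm w" and I = "{0..1}"])
    show "dominated_param M {0..1} (\<lambda>t. p + t *\<^sub>R w)" by (rule segment_dominated) (use w c(2) in auto)
    show "dist (p + 0 *\<^sub>R w) (p + s *\<^sub>R w) \<le> norm w * (s - 0)" if "s \<in> {0..0 + 1}" for s
      using that by (simp add: dist_norm)
  qed (use w in auto)
qed

end

lemma segment_hausdorff1_pos:
  fixes w :: "'a::real_normed_vector"
  assumes "w \<noteq> 0" "\<And>s. s \<in> {0..1} \<Longrightarrow> p + s *\<^sub>R w \<in> E"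
  shows "0 < hausdorff1_outer E"
proof (rule hausdorff1_outer_pos[of 0 1 "\<lambda>t. p + t *\<^sub>R w" _ "1 / norm w"])
  fix s t
  have "dist (p + s *\<^sub>R w) (p + t *\<^sub>R w) = \<bar>s - t\<bar> * norm w"
    by (simp add: dist_norm flip: scaleR_diff_left)
  then show "\<bar>s - t\<bar> \<le> 1 / norm w * dist (p + s *\<^sub>R w) (p + t *\<^sub>R w)" using assms(1) by simp
qed (use assms in auto)

section \<open>Strictly convex arcs\<close>

definition rot :: "real^2 \<Rightarrow> real^2" where
  "rot v = vector [- v $ 2, v $ 1]"

lemma rot_simps:
  "norm (rot v) = norm v" "v \<bullet> rot v = 0" "cross2 v (rot v) = v \<bullet> v"
  by (simp_all add: rot_def norm_real2 cross2_def inner_vec_def UNIV_2 algebra_simps)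

lemma rot_decomposition:
  assumes "norm \<phi> = 1"
  shows "u = (u \<bullet> \<phi>) *\<^sub>R \<phi> + (u \<bullet> rot \<phi>) *\<^sub>R rot \<phi>"
proof -
  have n: "\<phi> $ 1 * \<phi> $ 1 + \<phi> $ 2 * \<phi> $ 2 = 1"
    using assms by (simp add: norm_real2 power2_eq_square)
  have "(u \<bullet> \<phi>) *\<^sub>R \<phi> + (u \<bullet> rot \<phi>) *\<^sub>R rot \<phi> = (\<phi> $ 1 * \<phi> $ 1 + \<phi> $ 2 * \<phi> $ 2) *\<^sub>R u"
    by (simp add: rot_def vec_eq_iff forall_2 inner_vec_def UNIV_2 algebra_simps)
  then show ?thesis by (simp add: n)
qed

lemma half_open_Union: "{c..<d::real} = (\<Union>m. {c..d - 1 / real (Suc m)})"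
proof safe
  fix x assume x: "x \<in> {c..<d}"
  then obtain m where "inverse (real (Suc m)) < d - x" using reals_Archimedean[of "d - x"] by auto
  then have "x \<in> {c..d - 1 / real (Suc m)}" using x by (simp add: inverse_eq_divide)
  then show "x \<in> (\<Union>m. {c..d - 1 / real (Suc m)})" by blast
next
  fix x m assume "x \<in> {c..d - 1 / real (Suc m)}"
  then have x: "c \<le> x" "x \<le> d - 1 / real (Suc m)" by auto
  have "0 < 1 / real (Suc m)" by simp
  with x have "c \<le> x" "x < d" by linarith+
  then show "x \<in> {c..<d}" by simp
qed

text \<open>An arc in \<open>E\<close> that is the graph of a strictly convex function \<open>g\<close> over its tangent at \<open>p\<close>, in direction
  \<open>\<phi>\<close>. The sign \<open>\<epsilon>\<close> says to which side the arc bends.\<close>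

locale convex_graph =
  fixes E :: "(real^2) set" and p \<phi> :: "real^2" and \<epsilon> a :: real and g g' :: "real \<Rightarrow> real"
  assumes phi: "norm \<phi> = 1" and eps_abs: "\<bar>\<epsilon>\<bar> = 1" and a: "0 < a"
    and deriv: "\<And>x. x \<in> {-a..a} \<Longrightarrow> (g has_real_derivative g' x) (at x)"
    and cont': "continuous_on {-a..a} g'"
    and mono: "\<And>x y. x \<in> {-a..a} \<Longrightarrow> y \<in> {-a..a} \<Longrightarrow> x < y \<Longrightarrow> g' x < g' y"
    and zero: "g' 0 = 0"
    and mem: "\<And>x. x \<in> {-a..a} \<Longrightarrow> p + x *\<^sub>R \<phi> + (\<epsilon> * g x) *\<^sub>R rot \<phi> \<in> E"
begin

lemma eps: "\<bar>\<epsilon>\<bar> = 1" "\<epsilon> * \<epsilon> = 1"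
  using eps_abs by (auto simp: abs_if split: if_splits)

text \<open>The arc is continued by its tangent line outside \<open>{-a..a}\<close>, so that \<open>h\<close> is a Borel function on the
  whole line.\<close>

definition h :: "real \<Rightarrow> real^2" where
  "h x = p + x *\<^sub>R \<phi> + (\<epsilon> * (indicator {-a..a} x * g x)) *\<^sub>R rot \<phi>"

lemma mvt:
  assumes "- a \<le> s" "s < t" "t \<le> a"
  obtains z where "s < z" "z < t" "g t - g s = (t - s) * g' z"
proof -
  have "\<exists>z>s. z < t \<and> g t - g s = (t - s) * g' z"
    by (rule MVT2[OF assms(2)]) (use assms deriv in auto)
  then show ?thesis using that by blast
qed

text \<open>By convexity the increments of \<open>g\<close> over intervals of equal length increase. Overlapping intervals are
  compared after removing the overlap.\<close>

lemma increment_mono: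
  assumes X: "0 < X" and xy: "- a \<le> x" "x < y" "y + X \<le> a"
  shows "g (x + X) - g x < g (y + X) - g y"
proof (cases "x + X \<le> y")
  case True
  obtain z1 where z1: "x < z1" "z1 < x + X" "g (x + X) - g x = (x + X - x) * g' z1"
    by (rule mvt[of x "x + X"]) (use X xy in auto)
  obtain z2 where z2: "y < z2" "z2 < y + X" "g (y + X) - g y = (y + X - y) * g' z2"
    by (rule mvt[of y "y + X"]) (use X xy in auto)
  have "g' z1 < g' z2" using z1 z2 xy X True by (intro mono) auto
  then show ?thesis using z1 z2 X by (auto intro: mult_strict_left_mono)
next
  case False
  obtain z1 where z1: "x < z1" "z1 < y" "g y - g x = (y - x) * g' z1"
    by (rule mvt[of x y]) (use X xy in auto)
  obtain z2 where z2: "x + X < z2" "z2 < y + X" "g (y + X) - g (x + X) = (y + X - (x + X)) * g' z2"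
    by (rule mvt[of "x + X" "y + X"]) (use X xy in auto)
  have "g' z1 < g' z2" using z1 z2 xy X False by (intro mono) auto
  then have "(y - x) * g' z1 < (y - x) * g' z2" using xy by (intro mult_strict_left_mono) auto
  moreover have "g (y + X) - g (x + X) = (y - x) * g' z2" using z2(3) by simp
  ultimately show ?thesis using z1(3) by linarith
qed

text \<open>Short chords near the two ends of the arc have slopes below \<open>- \<kappa>\<close> and above \<open>\<kappa>\<close>.\<close>

definition \<kappa> :: real where "\<kappa> = min (g' (a / 2)) (- g' (- a / 2))"

lemma \<kappa>_pos: "0 < \<kappa>"
  using mono[of 0 "a / 2"] mono[of "- a / 2" 0] a zero by (auto simp: \<kappa>_def)

text \<open>Moving a chord of horizontal length \<open>X\<close> along the arc, its vertical component varies continuously from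
  below \<open>- \<kappa> * X\<close> to above \<open>\<kappa> * X\<close>.\<close>

lemma chord_exists:
  assumes X: "0 < X" "X \<le> a / 2" and Y: "\<bar>Y\<bar> < \<kappa> * X"
  obtains x where "- a \<le> x" "x + X < a" "g (x + X) - g x = Y"
proof -
  define k where "k x = g (x + X) - g x" for x
  obtain z1 where z1: "- a < z1" "z1 < - a + X" "g (- a + X) - g (- a) = (- a + X - (- a)) * g' z1"
    by (rule mvt[of "- a" "- a + X"]) (use X a in auto)
  have "g' z1 < g' (- a / 2)" using z1 X a by (intro mono) auto
  also have "\<dots> \<le> - \<kappa>" by (simp add: \<kappa>_def)
  finally have "X * g' z1 < X * - \<kappa>" using X by (intro mult_strict_left_mono) auto
  then have lo: "k (- a) < Y" using z1(3) Y by (simp add: k_def mult.commute)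
  obtain z2 where z2: "a - X < z2" "z2 < a" "g a - g (a - X) = (a - (a - X)) * g' z2"
    by (rule mvt[of "a - X" a]) (use X a in auto)
  have "\<kappa> \<le> g' (a / 2)" by (simp add: \<kappa>_def)
  also have "\<dots> < g' z2" using z2 X a by (intro mono) auto
  finally have "X * \<kappa> < X * g' z2" using X by (intro mult_strict_left_mono) auto
  then have hi: "Y < k (a - X)" using z2(3) Y by (simp add: k_def mult.commute)
  have gc: "isCont g x" if "x \<in> {-a..a}" for x using deriv[OF that] by (rule DERIV_isCont)
  have "\<exists>x. - a \<le> x \<and> x \<le> a - X \<and> k x = Y"
  proof (rule IVT')
    show "continuous_on {- a..a - X} k"
      unfolding k_def
    proof (intro continuous_on_diff)
      show "continuous_on {- a..a - X} g"
        by (intro continuous_at_imp_continuous_on ballI gc) (use X in auto)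
      show "continuous_on {- a..a - X} (\<lambda>x. g (x + X))"
        by (rule continuous_on_compose2[of "{-a..a}" g])
           (use X in \<open>auto intro!: continuous_at_imp_continuous_on gc continuous_intros\<close>)
    qed
  qed (use lo hi X a in auto)
  then obtain x where x: "- a \<le> x" "x \<le> a - X" "k x = Y" by blast
  then have "x \<noteq> a - X" using hi by auto
  then show ?thesis using x by (intro that[of x]) (auto simp: k_def)
qed

lemma h_in: "x \<in> {-a..a} \<Longrightarrow> h x = p + x *\<^sub>R \<phi> + (\<epsilon> * g x) *\<^sub>R rot \<phi>"
  by (simp add: h_def)

lemma h_diff: "s \<in> {-a..a} \<Longrightarrow> t \<in> {-a..a} \<Longrightarrow> h s - h t = (s - t) *\<^sub>R \<phi> + (\<epsilon> * (g s - g t)) *\<^sub>R rot \<phi>"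
  by (simp add: h_in algebra_simps)

lemma orthonormal_simps: "\<phi> \<bullet> \<phi> = 1" "rot \<phi> \<bullet> rot \<phi> = 1" "\<phi> \<bullet> rot \<phi> = 0" "rot \<phi> \<bullet> \<phi> = 0"
  using phi rot_simps[of \<phi>] by (simp_all add: norm_eq_1 inner_commute dot_square_norm)

lemma h_image: "h ` {-a..a} \<subseteq> E" using mem h_in by auto

lemma h_expand: "\<bar>s - t\<bar> \<le> 1 * dist (h s) (h t)"
proof -
  have "(h s - h t) \<bullet> \<phi> = s - t"
    by (simp add: h_def orthonormal_simps inner_diff_left inner_add_left)
  then have "\<bar>s - t\<bar> \<le> norm (h s - h t) * norm \<phi>" using Cauchy_Schwarz_ineq2[of "h s - h t" \<phi>] by simp
  then show ?thesis by (simp add: phi dist_norm)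
qed

lemma h_lipschitz:
  obtains K where "0 < K" "\<And>s. s \<in> {-a..-a + 2 * a} \<Longrightarrow> dist (h (- a)) (h s) \<le> K * (s - (- a))"
proof -
  define K where "K = 1 + \<bar>g' (- a)\<bar> + \<bar>g' a\<bar>"
  show ?thesis
  proof (rule that[of K])
    fix s assume "s \<in> {-a..-a + 2 * a}"
    then have s: "s \<in> {-a..a}" by auto
    show "dist (h (- a)) (h s) \<le> K * (s - (- a))"
    proof (cases "s = - a")
      case False
      obtain z where z: "- a < z" "z < s" "g s - g (- a) = (s - (- a)) * g' z"
        by (rule mvt[of "- a" s]) (use s False in auto)
      have "g' (- a) < g' z" "g' z < g' a" using z s by (auto intro!: mono)
      then have "\<bar>g' z\<bar> \<le> \<bar>g' (- a)\<bar> + \<bar>g' a\<bar>" by auto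
      then have gz: "\<bar>g s - g (- a)\<bar> \<le> (s + a) * (\<bar>g' (- a)\<bar> + \<bar>g' a\<bar>)"
        using s z by (simp add: abs_mult mult_left_mono)
      have "dist (h (- a)) (h s) = norm (h s - h (- a))" by (simp add: dist_norm norm_minus_commute)
      also have "h s - h (- a) = (s - (- a)) *\<^sub>R \<phi> + (\<epsilon> * (g s - g (- a))) *\<^sub>R rot \<phi>"
        using s a by (intro h_diff) auto
      also have "norm \<dots> \<le> norm ((s - (- a)) *\<^sub>R \<phi>) + norm ((\<epsilon> * (g s - g (- a))) *\<^sub>R rot \<phi>)"
        by (rule norm_triangle_ineq)
      also have "\<dots> = (s + a) + \<bar>g s - g (- a)\<bar>"
        using s by (simp add: abs_mult eps phi rot_simps)
      also have "\<dots> \<le> K * (s - (- a))" using gz by (simp add: K_def algebra_simps)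
      finally show ?thesis .
    qed simp
  qed (simp add: K_def)
qed

lemma h_borel: "h \<in> borel_measurable borel"
proof -
  have "continuous_on {-a..a} g"
    using deriv by (intro continuous_at_imp_continuous_on ballI DERIV_isCont) auto
  then have [measurable]: "(\<lambda>x. indicator {-a..a} x * g x) \<in> borel_measurable borel"
    using borel_measurable_continuous_on_indicator[of "{-a..a}" g] by simp
  show ?thesis unfolding h_def[abs_def] by measurable
qed

text \<open>The component of a chord along \<open>\<phi>\<close> determines its horizontal length, and among the chords of equal
  length the vertical component is strictly increasing.\<close>

lemma chord_inj:
  assumes st: "- a \<le> t" "t < s" "s \<le> a" and st': "- a \<le> t'" "t' < s'" "s' \<le> a"
    and eq: "h s - h t = h s' - h t'"
  shows "s = s' \<and> t = t'"
proof -
  have d: "h s - h t = (s - t) *\<^sub>R \<phi> + (\<epsilon> * (g s - g t)) *\<^sub>R rot \<phi>" "h s' - h t' = (s' - t') *\<^sub>R \<phi> + (\<epsilon> * (g s' - g t')) *\<^sub>R rot \<phi>"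
    using st st' by (intro h_diff; auto)+
  have "(h s - h t) \<bullet> \<phi> = s - t" "(h s' - h t') \<bullet> \<phi> = s' - t'"
    unfolding d by (simp_all add: orthonormal_simps inner_add_left)
  then have X: "s - t = s' - t'" using eq by simp
  have "(h s - h t) \<bullet> rot \<phi> = \<epsilon> * (g s - g t)" "(h s' - h t') \<bullet> rot \<phi> = \<epsilon> * (g s' - g t')"
    unfolding d by (simp_all add: orthonormal_simps inner_add_left)
  then have "\<epsilon> * (g s - g t) = \<epsilon> * (g s' - g t')" using eq by (simp only:)
  then have Y: "g s - g t = g s' - g t'" using eps by auto
  have e: "t + (s - t) = s" "t' + (s - t) = s'" using X by auto
  have "\<not> t < t'"
    using increment_mono[of "s - t" t t', unfolded e] st st' Y by auto
  moreover have "\<not> t' < t"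
    using increment_mono[of "s - t" t' t, unfolded e] st st' Y by auto
  ultimately show ?thesis using X by auto
qed

text \<open>The arc meets itself in the difference set, so the two end points of a chord must be confined to
  disjoint pieces before a pairing can be formed.\<close>

definition cell :: "nat \<Rightarrow> nat \<Rightarrow> real set" where
  "cell n j = {- a + real j * (2 * a / real n) ..< - a + real (Suc j) * (2 * a / real n)}"

lemma cell_sub: "j < n \<Longrightarrow> cell n j \<subseteq> {-a..a}" "j < n \<Longrightarrow> s \<in> cell n j \<Longrightarrow> s < a"
proof -
  assume j: "j < n"
  have "real (Suc j) * (2 * a / real n) \<le> real n * (2 * a / real n)"
    using j a by (intro mult_right_mono) auto
  then have u: "- a + real (Suc j) * (2 * a / real n) \<le> a" using j by simp
  have "0 \<le> real j * (2 * a / real n)" using a by simp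
  then show "cell n j \<subseteq> {-a..a}" using u by (auto simp: cell_def)
  show "s < a" if "s \<in> cell n j" using that u by (auto simp: cell_def)
qed

lemma cell_less: "k < j \<Longrightarrow> j < n \<Longrightarrow> t \<in> cell n k \<Longrightarrow> s \<in> cell n j \<Longrightarrow> t < s"
proof -
  assume k: "k < j" "j < n" "t \<in> cell n k" "s \<in> cell n j"
  have "real (Suc k) * (2 * a / real n) \<le> real j * (2 * a / real n)"
    using k a by (intro mult_right_mono) auto
  then show ?thesis using k unfolding cell_def by auto
qed

lemma cell_exists:
  assumes "0 < n" "- a \<le> s" "s < a" obtains j where "j < n" "s \<in> cell n j"
proof -
  let ?w = "2 * a / real n"
  have w: "0 < ?w" using assms a by simp
  define j where "j = nat \<lfloor>(s + a) / ?w\<rfloor>"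
  have nn: "0 \<le> (s + a) / ?w" using assms w by simp
  have "(s + a) / ?w < real n" using assms w a by (simp add: field_simps)
  then have "j < n" using nn unfolding j_def by linarith
  moreover have "real j \<le> (s + a) / ?w" "(s + a) / ?w < real (Suc j)" using nn unfolding j_def by linarith+
  then have "real j * ?w \<le> s + a" "s + a < real (Suc j) * ?w" by (simp_all only: pos_le_divide_eq[OF w] pos_divide_less_eq[OF w])
  ultimately show ?thesis by (intro that[of j]) (auto simp: cell_def)
qed

lemma cell_diff: "0 < n \<Longrightarrow> s \<in> cell n j \<Longrightarrow> t \<in> cell n j \<Longrightarrow> s - t < 2 * a / real n"
  by (auto simp: cell_def algebra_simps add_divide_distrib)

lemma h_cont: "continuous_on {-a..a} h"
proof -
  have "continuous_on {-a..a} g"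
    using deriv by (intro continuous_at_imp_continuous_on ballI DERIV_isCont) auto
  then have "continuous_on {-a..a} (\<lambda>x. p + x *\<^sub>R \<phi> + (\<epsilon> * g x) *\<^sub>R rot \<phi>)"
    by (intro continuous_intros)
  then show ?thesis by (rule continuous_on_eq) (simp add: h_in)
qed

lemma difference_cont: "continuous_on ({-a..a} \<times> {-a..a}) (\<lambda>(s, t). h s - h t)"
  unfolding case_prod_unfold
  by (intro continuous_on_diff continuous_on_compose2[OF h_cont] continuous_intros) auto

lemma image_bounded: "bounded ((\<lambda>(s, t). h s - h t) ` (I \<times> J))" if "I \<subseteq> {-a..a}" "J \<subseteq> {-a..a}"
proof -
  have "compact ((\<lambda>(s, t). h s - h t) ` ({-a..a} \<times> {-a..a}))"
    by (intro compact_continuous_image difference_cont compact_Times) auto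
  then show ?thesis by (rule bounded_subset[OF compact_imp_bounded]) (use that in auto)
qed

lemma image_borel:
  assumes "{c..<d} \<subseteq> {-a..a}" "{c'..<d'} \<subseteq> {-a..a}"
  shows "(\<lambda>(s, t). h s - h t) ` ({c..<d} \<times> {c'..<d'}) \<in> sets borel"
proof -
  let ?F = "\<lambda>(s, t). h s - h t"
  let ?A = "\<lambda>m. {c..d - 1 / real (Suc m)}" and ?B = "\<lambda>m. {c'..d' - 1 / real (Suc m)}"
  have "?F ` ({c..<d} \<times> {c'..<d'}) = (\<Union>m. \<Union>m'. ?F ` (?A m \<times> ?B m'))"
    unfolding half_open_Union by blast
  moreover have "?F ` (?A m \<times> ?B m') \<in> sets borel" for m m'
  proof (intro borel_compact compact_continuous_image compact_Times)
    have "?A m \<subseteq> {-a..a}" "?B m' \<subseteq> {-a..a}"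
      using assms half_open_Union[of c d] half_open_Union[of c' d'] by blast+
    then show "continuous_on (?A m \<times> ?B m') ?F" by (intro continuous_on_subset[OF difference_cont]) auto
  qed auto
  ultimately show ?thesis by simp
qed

end

locale convex_graph_measure = finite_arc_length E + convex_graph E p \<phi> \<epsilon> a g g' for E p \<phi> \<epsilon> a g g'
begin

lemma h_dominated: "I \<in> sets borel \<Longrightarrow> I \<subseteq> {-a..a} \<Longrightarrow> dominated_param M I h"
  by (rule dominated[OF _ _ h_borel _ zero_less_one h_expand])
     (use h_image bounded_subset[OF bounded_closed_interval] in blast)+

text \<open>The tangent turns strictly monotonically, so the Jacobian has the constant sign \<open>- \<epsilon>\<close> when the first
  parameter is larger than the second.\<close>

lemma cell_pairing:
  assumes kj: "k < j" "j < n"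
  shows "off_diagonal_pairing M ((\<lambda>(s, t). h s - h t) ` (cell n j \<times> cell n k))"
proof -
  have cb [measurable]: "cell n j \<in> sets borel" for j by (simp add: cell_def)
  have sub: "cell n j \<subseteq> {-a..a}" "cell n k \<subseteq> {-a..a}" using cell_sub kj by auto
  define S where "S j = {x. (x - p) \<bullet> \<phi> \<in> cell n j}" for j
  have Sb: "S j \<in> sets borel" for j unfolding S_def by measurable
  have hS: "h ` cell n j \<subseteq> S j" for j by (auto simp: S_def h_def orthonormal_simps inner_diff_left inner_add_left)
  define h' where "h' x = \<phi> + (\<epsilon> * g' x) *\<^sub>R rot \<phi>" for x
  have hd: "(h has_vector_derivative h' s) (at s within I)" if "s \<in> I" "I \<subseteq> {-a..a}" for s I
  proof -
    have "s \<in> {-a..a}" using that by auto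
    then have gd: "(g has_real_derivative g' s) (at s within I)"
      using deriv has_field_derivative_at_within by blast
    have "((\<lambda>x. p + x *\<^sub>R \<phi> + (\<epsilon> * g x) *\<^sub>R rot \<phi>) has_vector_derivative h' s) (at s within I)"
      unfolding h'_def
      by (rule derivative_eq_intros gd refl | simp)+
    then show ?thesis
      by (rule has_vector_derivative_transform[OF that(1), rotated]) (use that h_in in auto)
  qed
  have gb: "bounded_borel (\<lambda>s. indicator (cell n j) s * g' s)" if "cell n j \<subseteq> {-a..a}" for j
  proof (rule bounded_borelI[where B="\<bar>g' (- a)\<bar> + \<bar>g' a\<bar>"])
    show "(\<lambda>s. indicator (cell n j) s * g' s) \<in> borel_measurable borel"
      using borel_measurable_continuous_on_indicator[OF cb continuous_on_subset[OF cont' that]] by simp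
    fix s
    show "\<bar>indicator (cell n j) s * g' s\<bar> \<le> \<bar>g' (- a)\<bar> + \<bar>g' a\<bar>"
    proof (cases "s \<in> cell n j")
      case True
      then have s: "s \<in> {-a..a}" using that by auto
      have "g' (- a) \<le> g' s" "g' s \<le> g' a"
        using mono[of "- a" s] mono[of s a] s a by (cases "s = - a"; cases "s = a"; force)+
      then show ?thesis using True by auto
    qed simp
  qed
  have hb: "bounded_borel (\<lambda>s. indicator (cell n j) s * (h' s $ i))" if "cell n j \<subseteq> {-a..a}" for j i
  proof -
    have "bounded_borel (\<lambda>s. indicator (cell n j) s * \<phi> $ i + (\<epsilon> * rot \<phi> $ i) * (indicator (cell n j) s * g' s))"
      by (rule bounded_borel_add[OF bounded_borel_mult[OF bounded_borel_indicator[OF cb] bounded_borel_const]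
            bounded_borel_mult[OF bounded_borel_const gb[OF that]]])
    then show ?thesis by (simp add: h'_def algebra_simps)
  qed
  show ?thesis
  proof (rule off_diagonal_pairing_product[OF fin sets_M, where ?h1' = h' and ?h2' = h' and \<kappa> = "- \<epsilon>"])
    show "dominated_param M (cell n j) h" "dominated_param M (cell n k) h" by (intro h_dominated cb sub)+
    show "S j \<inter> S k = {}" using cell_less[OF kj] by (force simp: S_def)
    show "\<bar>cross2 (h' s) (h' t)\<bar> = - \<epsilon> * cross2 (h' s) (h' t)" if "s \<in> cell n j" "t \<in> cell n k" for s t
    proof -
      have lt: "g' t < g' s" using cell_less[OF kj that(2,1)] that sub by (intro mono) auto
      have "cross2 (h' s) (h' t) = \<epsilon> * (g' t - g' s) * (\<phi> \<bullet> \<phi>)"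
        using rot_simps(3)[of \<phi>] cross2_commute[of "rot \<phi>" \<phi>]
        by (simp add: h'_def cross2_simps algebra_simps)
      then have c: "cross2 (h' s) (h' t) = \<epsilon> * (g' t - g' s)" by (simp add: orthonormal_simps)
      have "\<bar>\<epsilon> * (g' t - g' s)\<bar> = g' s - g' t" using lt eps by (simp add: abs_mult)
      moreover have "- \<epsilon> * (\<epsilon> * (g' t - g' s)) = - ((\<epsilon> * \<epsilon>) * (g' t - g' s))" by simp
      ultimately show ?thesis unfolding c by (simp add: eps)
    qed
    show "inj_on (\<lambda>(s, t). h s - h t) (cell n j \<times> cell n k)"
    proof (rule inj_onI, clarify)
      fix s t s' t'
      assume st: "s \<in> cell n j" "t \<in> cell n k" "s' \<in> cell n j" "t' \<in> cell n k" and eq: "h s - h t = h s' - h t'"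
      have "s \<in> {-a..a}" "t \<in> {-a..a}" "s' \<in> {-a..a}" "t' \<in> {-a..a}" using st sub by auto
      then show "s = s' \<and> t = t'"
        using chord_inj[OF _ _ _ _ _ _ eq] cell_less[OF kj st(2,1)] cell_less[OF kj st(4,3)] by simp
    qed
    show "(\<lambda>(s, t). h s - h t) ` (cell n j \<times> cell n k) \<in> sets borel"
      using sub unfolding cell_def by (rule image_borel)
    show "bounded ((\<lambda>(s, t). h s - h t) ` (cell n j \<times> cell n k))" using sub by (rule image_bounded)
  qed (use Sb hS hd hb sub in simp_all)
qed

text \<open>Every vector close to \<open>\<rho> *\<^sub>R \<phi>\<close> is a chord of the arc in exactly one way. The cells are shorter than the
  chords in question, so the end points lie in different cells, and the finitely many differences of
  cells are disjoint.\<close>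

lemma covered: "covered_direction M \<phi>"
proof -
  define c where "c = min (1 / 2) (\<kappa> / 2)"
  have c: "0 < c" "c \<le> 1 / 2" "c \<le> \<kappa> / 2" using \<kappa>_pos by (auto simp: c_def)
  show ?thesis
  proof (rule covered_directionI[of c "a / 3"])
    fix \<rho> :: real assume rho: "0 < \<rho>" "\<rho> \<le> a / 3"
    obtain n :: nat where n: "4 * a / \<rho> < real n" using reals_Archimedean2 by blast
    have n0: "0 < n" using n rho a by (metis divide_pos_pos mult_pos_pos not_gr_zero of_nat_0 order.asym zero_less_numeral)
    \<comment> \<open>The chords used below have horizontal length more than \<open>\<rho> / 2\<close>.\<close>
    have nr: "2 * a / real n < \<rho> / 2" using n n0 rho by (simp add: field_simps)
    let ?P = "{(j, k). k < j \<and> j < n}"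
    let ?U = "\<lambda>(j, k). (\<lambda>(s, t). h s - h t) ` (cell n j \<times> cell n k)"
    have "off_diagonal_pairing M (\<Union>jk\<in>?P. ?U jk)"
    proof (rule off_diagonal_pairing_UN)
      show "finite ?P" by (rule finite_subset[of _ "{..<n} \<times> {..<n}"]) auto
      show "off_diagonal_pairing M (?U jk)" if "jk \<in> ?P" for jk using that cell_pairing by auto
      fix x y assume xy: "x \<in> ?P" "y \<in> ?P" "x \<noteq> y"
      obtain j k j' k' where jk: "x = (j, k)" "y = (j', k')" by (cases x, cases y)
      have lt: "k < j" "j < n" "k' < j'" "j' < n" using xy jk by auto
      show "?U x \<inter> ?U y = {}"
      proof (rule ccontr)
        assume "?U x \<inter> ?U y \<noteq> {}"
        then obtain s t s' t' where st: "s \<in> cell n j" "t \<in> cell n k" "s' \<in> cell n j'" "t' \<in> cell n k'"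
          "h s - h t = h s' - h t'" unfolding jk by auto
        have b: "s \<in> {-a..a}" "t \<in> {-a..a}" "s' \<in> {-a..a}" "t' \<in> {-a..a}"
          using st cell_sub(1) lt by (meson less_trans subsetD)+
        have "s = s' \<and> t = t'"
          using chord_inj[of t s t' s'] st(5) b cell_less[OF lt(1,2) st(2,1)] cell_less[OF lt(3,4) st(4,3)] by auto
        then have "j = j'" "k = k'"
          using st cell_less[of j j' n s s] cell_less[of j' j n s s] cell_less[of k k' n t t] cell_less[of k' k n t t] lt
          by (metis less_irrefl less_trans linorder_neqE_nat)+
        then show False using xy(3) jk by simp
      qed
    qed
    moreover have "ball (\<rho> *\<^sub>R \<phi>) (c * \<rho>) \<subseteq> (\<Union>jk\<in>?P. ?U jk)"
    proof
      fix u assume u: "u \<in> ball (\<rho> *\<^sub>R \<phi>) (c * \<rho>)"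
      define X where "X = u \<bullet> \<phi>"
      define Y where "Y = \<epsilon> * (u \<bullet> rot \<phi>)"
      have d: "norm (u - \<rho> *\<^sub>R \<phi>) < c * \<rho>" using u by (simp add: dist_norm norm_minus_commute)
      have "X - \<rho> = (u - \<rho> *\<^sub>R \<phi>) \<bullet> \<phi>" by (simp add: X_def inner_diff_left orthonormal_simps)
      then have "\<bar>X - \<rho>\<bar> \<le> norm (u - \<rho> *\<^sub>R \<phi>)"
        using Cauchy_Schwarz_ineq2[of "u - \<rho> *\<^sub>R \<phi>" \<phi>] by (simp add: phi)
      then have X1: "\<bar>X - \<rho>\<bar> < c * \<rho>" using d by simp
      have "u \<bullet> rot \<phi> = (u - \<rho> *\<^sub>R \<phi>) \<bullet> rot \<phi>" by (simp add: inner_diff_left orthonormal_simps)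
      then have "\<bar>u \<bullet> rot \<phi>\<bar> \<le> norm (u - \<rho> *\<^sub>R \<phi>)"
        using Cauchy_Schwarz_ineq2[of "u - \<rho> *\<^sub>R \<phi>" "rot \<phi>"] by (simp add: phi rot_simps)
      then have Y1: "\<bar>Y\<bar> < c * \<rho>" using d by (simp add: Y_def abs_mult eps)
      have "c * \<rho> \<le> 1 / 2 * \<rho>" using c rho by (intro mult_right_mono) auto
      then have X2: "\<rho> / 2 < X" "X \<le> a / 2" using X1 rho unfolding abs_less_iff by linarith+
      have "c * \<rho> \<le> \<kappa> / 2 * \<rho>" using c rho by (intro mult_right_mono) auto
      also have "\<dots> = \<kappa> * (\<rho> / 2)" by simp
      also have "\<dots> < \<kappa> * X" using X2 \<kappa>_pos by (intro mult_strict_left_mono)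
      finally have Y2: "\<bar>Y\<bar> < \<kappa> * X" using Y1 by simp
      obtain x where x: "- a \<le> x" "x + X < a" "g (x + X) - g x = Y"
        by (rule chord_exists[OF _ X2(2) Y2]) (use X2 rho in auto)
      have b: "x + X \<in> {-a..a}" "x \<in> {-a..a}" using x X2 rho by auto
      have "h (x + X) - h x = X *\<^sub>R \<phi> + (\<epsilon> * Y) *\<^sub>R rot \<phi>" using h_diff[OF b] x(3) by simp
      also have "\<dots> = u"
        using rot_decomposition[OF phi, of u] by (simp add: X_def Y_def eps(2) flip: mult.assoc)
      finally have hu: "u = h (x + X) - h x" ..
      obtain j where j: "j < n" "x + X \<in> cell n j" by (rule cell_exists[OF n0, of "x + X"]) (use x b in auto)
      obtain k where k: "k < n" "x \<in> cell n k" by (rule cell_exists[OF n0, of x]) (use x b X2 rho in auto)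
      have "k < j"
      proof (rule ccontr)
        assume "\<not> k < j"
        then consider "k = j" | "j < k" by linarith
        then show False
        proof cases
          case 1
          then show False using cell_diff[OF n0 j(2), of x] k(2) nr X2 by auto
        next
          case 2
          then show False using cell_less[OF 2 k(1) j(2) k(2)] X2 rho by auto
        qed
      qed
      then show "u \<in> (\<Union>jk\<in>?P. ?U jk)" using j k hu by (intro UN_I[of "(j, k)"]) auto
    qed
    ultimately show "\<exists>U. ball (\<rho> *\<^sub>R \<phi>) (c * \<rho>) \<subseteq> U \<and> off_diagonal_pairing M U" by blast
  qed (use c a in auto)
qed

end

section \<open>Closed curves of positive curvature\<close>

lemma nth_vector_derivative_works:
  assumes "C_infinity_on {a..b} \<gamma>" "a < s" "s < b"
  shows "(nth_vector_derivative {a..b} n \<gamma> has_vector_derivative nth_vector_derivative {a..b} (Suc n) \<gamma> s) (at s)"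
proof -
  have "nth_vector_derivative {a..b} n \<gamma> differentiable (at s within {a..b})"
    using assms by (auto simp: C_infinity_on_def differentiable_on_def)
  then have "(nth_vector_derivative {a..b} n \<gamma> has_vector_derivative nth_vector_derivative {a..b} (Suc n) \<gamma> s) (at s within {a..b})"
    by (simp add: vector_derivative_works)
  then show ?thesis using at_within_Icc_at[OF assms(2,3)] by simp
qed

lemma has_vector_derivative_inner_const:
  assumes "(f has_vector_derivative f') (at s)"
  shows "((\<lambda>s. f s \<bullet> v) has_real_derivative f' \<bullet> v) (at s)"
  unfolding has_real_derivative_iff_has_vector_derivative
  by (rule bounded_linear.has_vector_derivative[OF bounded_linear_inner_left assms])

text \<open>Rolle's theorem for the component of the closed curve orthogonal to \<open>\<phi>\<close>.\<close>

lemma smooth_closed_curve_tangent: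
  assumes c: "smooth_closed_curve \<gamma> L" and phi: "norm \<phi> = 1"
  obtains p where "0 < p" "p < L" "nth_vector_derivative {0..L} 1 \<gamma> p = \<phi> \<or> nth_vector_derivative {0..L} 1 \<gamma> p = - \<phi>"
proof -
  let ?g1 = "nth_vector_derivative {0..L} 1 \<gamma>"
  have L: "0 < L" and Ci: "C_infinity_on {0..L} \<gamma>" and unit: "\<And>s. s \<in> {0..L} \<Longrightarrow> norm (?g1 s) = 1"
    and closed: "\<gamma> 0 = \<gamma> L"
    using c unfolding smooth_closed_curve_def by (auto dest: spec[of _ 0])
  have d: "((\<lambda>s. \<gamma> s \<bullet> rot \<phi>) has_real_derivative ?g1 s \<bullet> rot \<phi>) (at s)" if "0 < s" "s < L" for s
    using has_vector_derivative_inner_const[OF nth_vector_derivative_works[OF Ci that, of 0]] by simp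
  have "\<exists>z. 0 < z \<and> z < L \<and> DERIV (\<lambda>s. \<gamma> s \<bullet> rot \<phi>) z :> 0"
  proof (rule Rolle[OF L])
    have "nth_vector_derivative {0..L} 0 \<gamma> differentiable_on {0..L}" using Ci unfolding C_infinity_on_def by blast
    then have "continuous_on {0..L} \<gamma>" by (auto intro: differentiable_imp_continuous_on)
    then show "continuous_on {0..L} (\<lambda>s. \<gamma> s \<bullet> rot \<phi>)" by (intro continuous_intros)
    show "(\<lambda>s. \<gamma> s \<bullet> rot \<phi>) differentiable at x" if "0 < x" "x < L" for x
      using d[OF that] real_differentiable_def by blast
  qed (simp add: closed)
  then obtain p where p: "0 < p" "p < L" "DERIV (\<lambda>s. \<gamma> s \<bullet> rot \<phi>) p :> 0" by blast
  have z: "?g1 p \<bullet> rot \<phi> = 0" using DERIV_unique[OF d[OF p(1,2)] p(3)] .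
  then have e: "?g1 p = (?g1 p \<bullet> \<phi>) *\<^sub>R \<phi>" using rot_decomposition[OF phi, of "?g1 p"] by simp
  have "norm (?g1 p) = \<bar>?g1 p \<bullet> \<phi>\<bar>" by (subst e) (simp add: phi)
  then have "\<bar>?g1 p \<bullet> \<phi>\<bar> = 1" using unit[of p] p by simp
  then have "?g1 p \<bullet> \<phi> = 1 \<or> ?g1 p \<bullet> \<phi> = - 1" by linarith
  then have "?g1 p = \<phi> \<or> ?g1 p = - \<phi>" using e by (metis scaleR_minus1_left scaleR_one)
  then show ?thesis by (rule that[OF p(1,2)])
qed

text \<open>Since \<open>x\<close> is strictly increasing, the plane curve \<open>(x, y)\<close> is a graph over the first axis; the inverse
  \<open>\<xi>\<close> of \<open>x\<close> reparametrises it, and the slope \<open>m\<close> becomes the derivative of the graph.\<close>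

lemma convex_graph_of_monotone_slope:
  fixes x y x1 y1 m :: "real \<Rightarrow> real"
  assumes eta: "0 < \<eta>"
    and dx: "\<And>s. s \<in> {p-\<eta>..p+\<eta>} \<Longrightarrow> (x has_real_derivative x1 s) (at s)"
    and dy: "\<And>s. s \<in> {p-\<eta>..p+\<eta>} \<Longrightarrow> (y has_real_derivative y1 s) (at s)"
    and x1: "\<And>s. s \<in> {p-\<eta>..p+\<eta>} \<Longrightarrow> 0 < x1 s"
    and m: "\<And>s. s \<in> {p-\<eta>..p+\<eta>} \<Longrightarrow> m s = y1 s / x1 s" "continuous_on {p-\<eta>..p+\<eta>} m"
    and mono: "\<And>s t. s \<in> {p-\<eta>..p+\<eta>} \<Longrightarrow> t \<in> {p-\<eta>..p+\<eta>} \<Longrightarrow> s < t \<Longrightarrow> m s < m t"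
    and p0: "x p = 0" "y1 p = 0"
  obtains a \<xi> where "0 < a" "\<And>v. v \<in> {-a..a} \<Longrightarrow> \<xi> v \<in> {p-\<eta>..p+\<eta>} \<and> x (\<xi> v) = v"
    "\<And>v. v \<in> {-a..a} \<Longrightarrow> ((\<lambda>v. y (\<xi> v)) has_real_derivative m (\<xi> v)) (at v)"
    "continuous_on {-a..a} (\<lambda>v. m (\<xi> v))"
    "\<And>v w. v \<in> {-a..a} \<Longrightarrow> w \<in> {-a..a} \<Longrightarrow> v < w \<Longrightarrow> m (\<xi> v) < m (\<xi> w)" "m (\<xi> 0) = 0"
proof -
  let ?J = "{p-\<eta>..p+\<eta>}"
  have xmono: "x s < x t" if "s \<in> ?J" "t \<in> ?J" "s < t" for s t
  proof (rule DERIV_pos_imp_increasing[OF that(3)])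
    fix z assume "s \<le> z" "z \<le> t"
    then have "z \<in> ?J" using that(1,2) by auto
    then show "\<exists>d. DERIV x z :> d \<and> d > 0" using dx x1 by (intro exI[of _ "x1 z"]) simp
  qed
  have inj: "inj_on x ?J"
  proof (rule inj_onI)
    fix s t assume st: "s \<in> ?J" "t \<in> ?J" "x s = x t"
    show "s = t" using xmono[OF st(1,2)] xmono[OF st(2,1)] st(3) by (cases s t rule: linorder_cases) auto
  qed
  define \<xi> where "\<xi> = the_inv_into ?J x"
  have xi_x: "\<xi> (x s) = s" if "s \<in> ?J" for s unfolding \<xi>_def by (rule the_inv_into_f_f[OF inj that])
  have xc: "continuous_on ?J x" using dx by (intro continuous_at_imp_continuous_on ballI DERIV_isCont)
  let ?l = "x (p - \<eta>)" and ?u = "x (p + \<eta>)"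
  have xi: "\<xi> v \<in> ?J \<and> x (\<xi> v) = v" if "v \<in> {?l..?u}" for v
  proof -
    have "\<exists>s. p - \<eta> \<le> s \<and> s \<le> p + \<eta> \<and> x s = v"
      by (rule IVT'[OF _ _ _ xc]) (use that eta in simp_all)
    then obtain s where "s \<in> ?J" "x s = v" by (elim exE conjE) simp
    then show ?thesis using xi_x[of s] by simp
  qed
  have lu: "?l < 0" "0 < ?u" using xmono[of "p - \<eta>" p] xmono[of p "p + \<eta>"] eta p0 by simp_all
  define a where "a = min (- ?l) ?u / 2"
  have a: "0 < a" "\<And>v. v \<in> {-a..a} \<Longrightarrow> ?l < v \<and> v < ?u" using lu by (auto simp: a_def min_def split: if_splits)
  have "continuous_on (x ` ?J) \<xi>" by (rule continuous_on_inv[OF xc]) (use xi_x in auto)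
  moreover have "{?l..?u} \<subseteq> x ` ?J"
  proof
    fix v assume "v \<in> {?l..?u}"
    then show "v \<in> x ` ?J" using xi[of v] by (intro image_eqI[of _ _ "\<xi> v"]) simp_all
  qed
  ultimately have xic: "continuous_on {?l..?u} \<xi>" by (rule continuous_on_subset)
  then have "continuous_on {?l<..<?u} \<xi>" by (rule continuous_on_subset) auto
  then have xicont: "isCont \<xi> v" if "?l < v" "v < ?u" for v
    using that by (simp add: continuous_on_eq_continuous_at)
  have dxi: "(\<xi> has_real_derivative inverse (x1 (\<xi> v))) (at v)" if v: "?l < v" "v < ?u" for v
  proof (rule DERIV_inverse_function[OF _ _ v _ xicont[OF v]])
    have J: "\<xi> v \<in> ?J" using xi[of v] v by auto
    show "(x has_real_derivative x1 (\<xi> v)) (at (\<xi> v))" by (rule dx[OF J])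
    show "x1 (\<xi> v) \<noteq> 0" using x1[OF J] by simp
    show "x (\<xi> w) = w" if "?l < w" "w < ?u" for w using xi[of w] that by auto
  qed
  have sub: "{-a..a} \<subseteq> {?l..?u}" using a(2) by force
  show ?thesis
  proof (rule that[OF a(1), of \<xi>])
    show "\<xi> v \<in> ?J \<and> x (\<xi> v) = v" if "v \<in> {-a..a}" for v using xi sub that by blast
    show "((\<lambda>v. y (\<xi> v)) has_real_derivative m (\<xi> v)) (at v)" if "v \<in> {-a..a}" for v
    proof -
      have J: "\<xi> v \<in> ?J" using xi sub that by blast
      have "((\<lambda>v. y (\<xi> v)) has_real_derivative y1 (\<xi> v) * inverse (x1 (\<xi> v))) (at v)"
        using a(2)[OF that] by (intro DERIV_chain2[OF dy[OF J] dxi]) auto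
      then show ?thesis using m(1)[OF J] by (simp add: divide_inverse)
    qed
    show "continuous_on {-a..a} (\<lambda>v. m (\<xi> v))"
      by (rule continuous_on_compose2[OF m(2) continuous_on_subset[OF xic sub]]) (use xi sub in blast)
    show "m (\<xi> v) < m (\<xi> w)" if vw: "v \<in> {-a..a}" "w \<in> {-a..a}" "v < w" for v w
    proof (rule mono)
      have 1: "\<xi> v \<in> ?J \<and> x (\<xi> v) = v" and 2: "\<xi> w \<in> ?J \<and> x (\<xi> w) = w" using xi sub vw by blast+
      then show "\<xi> v \<in> ?J" "\<xi> w \<in> ?J" by auto
      show "\<xi> v < \<xi> w"
      proof (rule ccontr)
        assume "\<not> \<xi> v < \<xi> w"
        then consider "\<xi> v = \<xi> w" | "\<xi> w < \<xi> v" by linarith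
        then show False using 1 2 vw(3) xmono[of "\<xi> w" "\<xi> v"] by cases auto
      qed
    qed
    have "\<xi> 0 = p" using xi_x[of p] p0 eta by simp
    then show "m (\<xi> 0) = 0" using m(1)[of p] p0 eta by simp
  qed
qed

text \<open>Take a point with tangent \<open>\<phi>\<close> or \<open>- \<phi>\<close>. As the curvature does not vanish there, the slope of the curve
  relative to this tangent has a nonzero derivative at the point, hence is strictly monotone near it.\<close>

lemma smooth_closed_curve_convex_graph:
  assumes c: "smooth_closed_curve \<gamma> L" and curv: "positive_curvature \<gamma> L" and phi: "norm \<phi> = 1"
  obtains \<psi> p \<epsilon> a g g' where "\<psi> = \<phi> \<or> \<psi> = - \<phi>" "convex_graph (\<gamma> ` {0..L}) p \<psi> \<epsilon> a g g'"
proof -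
  let ?g1 = "nth_vector_derivative {0..L} 1 \<gamma>" and ?g2 = "nth_vector_derivative {0..L} 2 \<gamma>"
  have L: "0 < L" and Ci: "C_infinity_on {0..L} \<gamma>" and unit: "\<And>s. s \<in> {0..L} \<Longrightarrow> norm (?g1 s) = 1"
    using c unfolding smooth_closed_curve_def by auto
  obtain p where p: "0 < p" "p < L" "?g1 p = \<phi> \<or> ?g1 p = - \<phi>"
    by (rule smooth_closed_curve_tangent[OF c phi], rule that)
  define \<psi> where "\<psi> = ?g1 p"
  have psi: "norm \<psi> = 1" using unit[of p] p by (simp add: \<psi>_def)
  have d0: "(\<gamma> has_vector_derivative ?g1 s) (at s)" if "0 < s" "s < L" for s
    using nth_vector_derivative_works[OF Ci that, of 0] by simp
  have d1: "(?g1 has_vector_derivative ?g2 s) (at s)" if "0 < s" "s < L" for s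
    using nth_vector_derivative_works[OF Ci that, of 1] by (simp add: numeral_2_eq_2)
  have d2: "isCont ?g2 s" if "0 < s" "s < L" for s
    using nth_vector_derivative_works[OF Ci that, of 2] by (rule has_vector_derivative_continuous)
  have perp: "?g2 p \<bullet> \<psi> = 0"
  proof -
    have "((\<lambda>s. ?g1 s \<bullet> ?g1 s) has_vector_derivative (?g1 p \<bullet> ?g2 p + ?g2 p \<bullet> ?g1 p)) (at p)"
      by (rule bounded_bilinear.has_vector_derivative[OF bounded_bilinear_inner d1[OF p(1,2)] d1[OF p(1,2)]])
    moreover have "((\<lambda>s. ?g1 s \<bullet> ?g1 s) has_vector_derivative 0) (at p)"
    proof (rule has_vector_derivative_transform_within_open[of "\<lambda>_. 1" _ _ "{0<..<L}"])
      show "1 = ?g1 s \<bullet> ?g1 s" if "s \<in> {0<..<L}" for s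
        using unit[of s] that by (simp add: dot_square_norm)
    qed (use p in auto)
    ultimately have "?g1 p \<bullet> ?g2 p + ?g2 p \<bullet> ?g1 p = 0" by (rule vector_derivative_unique_at)
    then show ?thesis by (simp add: \<psi>_def inner_commute)
  qed
  define k0 where "k0 = ?g2 p \<bullet> rot \<psi>"
  have k0: "k0 \<noteq> 0"
  proof
    assume "k0 = 0"
    then have "?g2 p = 0" using rot_decomposition[OF psi, of "?g2 p"] perp by (simp add: k0_def)
    then show False using curv p by (auto simp: positive_curvature_def)
  qed
  define \<epsilon> where "\<epsilon> = sgn k0"
  have eps: "\<bar>\<epsilon>\<bar> = 1" "\<epsilon> * \<epsilon> = 1" "0 < \<epsilon> * k0" using k0 by (auto simp: \<epsilon>_def sgn_if)
  define x where "x s = (\<gamma> s - \<gamma> p) \<bullet> \<psi>" for s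
  define y where "y s = \<epsilon> * ((\<gamma> s - \<gamma> p) \<bullet> rot \<psi>)" for s
  define x1 where "x1 s = ?g1 s \<bullet> \<psi>" for s
  define y1 where "y1 s = \<epsilon> * (?g1 s \<bullet> rot \<psi>)" for s
  define x2 where "x2 s = ?g2 s \<bullet> \<psi>" for s
  define y2 where "y2 s = \<epsilon> * (?g2 s \<bullet> rot \<psi>)" for s
  have D: "(x has_real_derivative x1 s) (at s)" "(y has_real_derivative y1 s) (at s)"
    "(x1 has_real_derivative x2 s) (at s)" "(y1 has_real_derivative y2 s) (at s)" if s: "0 < s" "s < L" for s
  proof -
    have "((\<lambda>s. \<gamma> s - \<gamma> p) has_vector_derivative ?g1 s) (at s)"
      using has_vector_derivative_diff[OF d0[OF s] has_vector_derivative_const[of "\<gamma> p"]] by simp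
    note i = has_vector_derivative_inner_const[OF this] has_vector_derivative_inner_const[OF d1[OF s]]
    show "(x has_real_derivative x1 s) (at s)" unfolding x_def[abs_def] x1_def by (rule i)
    show "(y has_real_derivative y1 s) (at s)" unfolding y_def[abs_def] y1_def by (rule DERIV_cmult[OF i(1)])
    show "(x1 has_real_derivative x2 s) (at s)" unfolding x1_def[abs_def] x2_def by (rule i)
    show "(y1 has_real_derivative y2 s) (at s)" unfolding y1_def[abs_def] y2_def by (rule DERIV_cmult[OF i(2)])
  qed
  have p0: "x p = 0" "x1 p = 1" "y1 p = 0" "x2 p = 0" "0 < y2 p"
    using psi rot_simps(2)[of \<psi>] perp eps(3)
    unfolding x_def x1_def y1_def x2_def y2_def \<psi>_def[symmetric] k0_def
    by (simp_all add: dot_square_norm del: nth_vector_derivative.simps)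
  \<comment> \<open>The numerator of the derivative of the slope \<open>y1 / x1\<close>.\<close>
  define w where "w s = y2 s * x1 s - y1 s * x2 s" for s
  have C: "isCont x1 p" "isCont w p"
  proof -
    have c1: "isCont x1 p" "isCont y1 p" using D(3,4)[OF p(1,2)] by (auto intro: DERIV_isCont)
    have c2: "isCont x2 p" "isCont y2 p" unfolding x2_def y2_def
      by (intro continuous_mult continuous_inner continuous_const d2[OF p(1,2)])+
    show "isCont x1 p" by fact
    show "isCont w p" unfolding w_def using c1 c2 by (intro continuous_intros)
  qed
  have "w p > 0" using p0 by (simp add: w_def)
  then have "\<forall>\<^sub>F s in at p. 0 < w s" "\<forall>\<^sub>F s in at p. 0 < x1 s"
    using C p0 by (auto simp: isCont_def intro: order_tendstoD)
  then have "\<forall>\<^sub>F s in at p. 0 < w s \<and> 0 < x1 s" by (rule eventually_conj)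
  then obtain \<delta> where \<delta>: "0 < \<delta>" "\<And>s. s \<noteq> p \<Longrightarrow> dist s p < \<delta> \<Longrightarrow> 0 < w s \<and> 0 < x1 s"
    unfolding eventually_at by auto
  define \<eta> where "\<eta> = min \<delta> (min p (L - p)) / 2"
  have eta: "0 < \<eta>" using \<delta> p by (simp add: \<eta>_def)
  have J: "0 < s \<and> s < L \<and> 0 < w s \<and> 0 < x1 s" if "s \<in> {p-\<eta>..p+\<eta>}" for s
  proof -
    have "\<eta> < \<delta>" "\<eta> < p" "\<eta> < L - p" using \<delta> p by (auto simp: \<eta>_def)
    then have "dist s p < \<delta>" "0 < s" "s < L" using that by (auto simp: dist_real_def abs_if)
    then show ?thesis using \<delta>(2)[of s] \<open>w p > 0\<close> p0 by (cases "s = p") auto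
  qed
  define m where "m s = y1 s / x1 s" for s
  have dm: "(m has_real_derivative w s / (x1 s * x1 s)) (at s)" if "s \<in> {p-\<eta>..p+\<eta>}" for s
    unfolding m_def w_def using J[OF that] D(3,4)[of s] by (intro DERIV_divide) auto
  obtain a \<xi> where ax: "0 < a" "\<And>v. v \<in> {-a..a} \<Longrightarrow> \<xi> v \<in> {p-\<eta>..p+\<eta>} \<and> x (\<xi> v) = v"
    "\<And>v. v \<in> {-a..a} \<Longrightarrow> ((\<lambda>v. y (\<xi> v)) has_real_derivative m (\<xi> v)) (at v)"
    "continuous_on {-a..a} (\<lambda>v. m (\<xi> v))"
    "\<And>v w. v \<in> {-a..a} \<Longrightarrow> w \<in> {-a..a} \<Longrightarrow> v < w \<Longrightarrow> m (\<xi> v) < m (\<xi> w)" "m (\<xi> 0) = 0"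
  proof (rule convex_graph_of_monotone_slope[of \<eta> p x x1 y y1 m])
    show "continuous_on {p-\<eta>..p+\<eta>} m"
      using dm by (intro continuous_at_imp_continuous_on ballI DERIV_isCont)
    show "m s < m t" if "s \<in> {p-\<eta>..p+\<eta>}" "t \<in> {p-\<eta>..p+\<eta>}" "s < t" for s t
    proof (rule DERIV_pos_imp_increasing[OF that(3)])
      fix z assume "s \<le> z" "z \<le> t"
      then have z: "z \<in> {p-\<eta>..p+\<eta>}" using that by auto
      show "\<exists>d. (m has_real_derivative d) (at z) \<and> 0 < d"
        using dm[OF z] J[OF z] by (intro exI[of _ "w z / (x1 z * x1 z)"]) simp
    qed
  qed (use eta J D p0 m_def in auto)
  have "convex_graph (\<gamma> ` {0..L}) (\<gamma> p) \<psi> \<epsilon> a (\<lambda>v. y (\<xi> v)) (\<lambda>v. m (\<xi> v))"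
  proof
    fix v assume v: "v \<in> {-a..a}"
    let ?s = "\<xi> v"
    have s: "?s \<in> {0..L}" "x ?s = v" using ax(2)[OF v] J[of ?s] by auto
    have "\<gamma> ?s - \<gamma> p = x ?s *\<^sub>R \<psi> + ((\<gamma> ?s - \<gamma> p) \<bullet> rot \<psi>) *\<^sub>R rot \<psi>"
      using rot_decomposition[OF psi, of "\<gamma> ?s - \<gamma> p"] by (simp add: x_def)
    also have "(\<gamma> ?s - \<gamma> p) \<bullet> rot \<psi> = \<epsilon> * y ?s" by (simp add: y_def eps(2) flip: mult.assoc)
    finally have "\<gamma> p + v *\<^sub>R \<psi> + (\<epsilon> * y ?s) *\<^sub>R rot \<psi> = \<gamma> ?s" using s by (simp add: algebra_simps)
    then show "\<gamma> p + v *\<^sub>R \<psi> + (\<epsilon> * y (\<xi> v)) *\<^sub>R rot \<psi> \<in> \<gamma> ` {0..L}" using s(1) by auto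
  qed (use ax psi eps in auto)
  then show ?thesis using that[of \<psi>] p(3) by (auto simp: \<psi>_def)
qed

lemma convex_graph_mono: "convex_graph P p \<phi> \<epsilon> a g g' \<Longrightarrow> P \<subseteq> E \<Longrightarrow> convex_graph E p \<phi> \<epsilon> a g g'"
  unfolding convex_graph_def by blast

lemma not_tight_frame_curve:
  assumes E: "compact E" "hausdorff1_outer E < top"
    and c: "smooth_closed_curve \<gamma> L" "positive_curvature \<gamma> L" and sub: "\<gamma> ` {0..L} \<subseteq> E"
  shows "\<not> tight_frame_spectral_measure (arc_length_measure E)"
proof -
  have "norm (axis 1 1 :: real^2) = 1" by (simp add: norm_real2 axis_def)
  then obtain \<psi>0 p0 \<epsilon>0 a0 g0 g0' where "convex_graph (\<gamma> ` {0..L}) p0 \<psi>0 \<epsilon>0 a0 g0 g0'"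
    using smooth_closed_curve_convex_graph[OF c] by metis
  then interpret G: convex_graph E p0 \<psi>0 \<epsilon>0 a0 g0 g0' by (rule convex_graph_mono[OF _ sub])
  have pos: "0 < hausdorff1_outer E"
    by (rule hausdorff1_outer_pos[of "- a0" a0 G.h E 1]) (use G.a G.h_image G.h_expand in auto)
  interpret finite_arc_length E using E pos by unfold_locales
  interpret GM: convex_graph_measure E p0 \<psi>0 \<epsilon>0 a0 g0 g0' ..
  obtain K where K: "0 < K" "\<And>s. s \<in> {-a0..-a0 + 2 * a0} \<Longrightarrow> dist (G.h (- a0)) (G.h s) \<le> K * (s - (- a0))"
    by (rule G.h_lipschitz, rule that)
  show ?thesis
  proof (rule not_tight_frame_if_covered[OF _ GM.h_dominated[of "{-a0..a0}"] _ _ K])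
    fix \<phi> :: "real^2" assume phi: "norm \<phi> = 1"
    obtain \<psi> p \<epsilon> a g g' where psi: "\<psi> = \<phi> \<or> \<psi> = - \<phi>" and gr: "convex_graph (\<gamma> ` {0..L}) p \<psi> \<epsilon> a g g'"
      by (rule smooth_closed_curve_convex_graph[OF c phi], rule that)
    interpret G1: convex_graph E p \<psi> \<epsilon> a g g' by (rule convex_graph_mono[OF gr sub])
    interpret GM1: convex_graph_measure E p \<psi> \<epsilon> a g g' ..
    have "covered_direction M \<psi>" by (rule GM1.covered)
    then show "covered_direction M \<phi>" using psi covered_direction_uminus[OF fin sets_M, of \<phi>] by auto
  qed (use G.a in auto)
qed

section \<open>Closed polygons\<close>

text \<open>The edge vectors form a closed sequence, and two consecutive edges cannot be antiparallel: the segments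
  would overlap in infinitely many points.\<close>

lemma not_tight_frame_polygon:
  assumes E: "compact E" "hausdorff1_outer E < top" and P: "closed_polygonal_curve P" "P \<subseteq> E"
  shows "\<not> tight_frame_spectral_measure (arc_length_measure E)"
proof -
  obtain N :: nat and x :: "nat \<Rightarrow> real^2" where N: "3 \<le> N" and xN: "x N = x 0"
    and ne: "\<forall>i\<in>{1..N}. x (i - 1) \<noteq> x i"
    and fin_Int: "\<forall>i\<in>{1..N}. \<forall>j\<in>{1..N}. i \<noteq> j \<longrightarrow>
           finite (closed_segment (x (i - 1)) (x i) \<inter> closed_segment (x (j - 1)) (x j))"
    and P_eq: "P = (\<Union>i\<in>{1..N}. closed_segment (x (i - 1)) (x i))"
    using P(1) unfolding closed_polygonal_curve_def by (elim exE conjE) (rule that)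
  \<comment> \<open>The edges are numbered cyclically from \<open>0\<close>; the edge \<open>e k\<close> ends at \<open>x (Suc (k mod N))\<close>.\<close>
  define e where "e k = x (Suc (k mod N)) - x (k mod N)" for k
  have seg_fwd: "x i + s *\<^sub>R (x (Suc i) - x i) \<in> closed_segment (x i) (x (Suc i))"
    and seg_bwd: "x (Suc i) - s *\<^sub>R (x (Suc i) - x i) \<in> closed_segment (x i) (x (Suc i))"
    if "s \<in> {0..1}" for i s
  proof -
    show "x i + s *\<^sub>R (x (Suc i) - x i) \<in> closed_segment (x i) (x (Suc i))"
      unfolding in_segment using that by (intro exI[of _ s]) (auto simp: algebra_simps)
    show "x (Suc i) - s *\<^sub>R (x (Suc i) - x i) \<in> closed_segment (x i) (x (Suc i))"
      unfolding in_segment using that by (intro exI[of _ "1 - s"]) (auto simp: algebra_simps)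
  qed
  have segE: "closed_segment (x i) (x (Suc i)) \<subseteq> E" if "i < N" for i
  proof -
    have "closed_segment (x (Suc i - 1)) (x (Suc i)) \<subseteq> P" unfolding P_eq using that by (intro UN_upper) auto
    then show ?thesis using P(2) by simp
  qed
  have modN: "k mod N < N" for k using N by simp
  have join: "x (Suc k mod N) = x (Suc (k mod N))" for k
    using xN N by (simp add: mod_Suc)
  have e0: "e k \<noteq> 0" for k
    using ne[rule_format, of "Suc (k mod N)"] modN[of k] by (simp add: e_def Suc_le_eq)
  have c1: "x (Suc (k mod N)) - s *\<^sub>R e k \<in> closed_segment (x (k mod N)) (x (Suc (k mod N)))"
    and c2: "x (Suc (k mod N)) + s *\<^sub>R e (Suc k) \<in> closed_segment (x (Suc k mod N)) (x (Suc (Suc k mod N)))"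
    if "s \<in> {0..1}" for k s
    using seg_bwd[OF that, of "k mod N"] seg_fwd[OF that, of "Suc k mod N"] by (simp_all add: e_def join)
  have pos: "0 < hausdorff1_outer E"
  proof (rule segment_hausdorff1_pos[of "e 0" "x 0"])
    show "e 0 \<noteq> 0" by (rule e0)
    show "x 0 + s *\<^sub>R e 0 \<in> E" if "s \<in> {0..1}" for s
      using seg_fwd[OF that, of 0] segE[of 0] N by (auto simp: e_def)
  qed
  interpret finite_arc_length E using E pos by unfold_locales
  show ?thesis
  proof (rule not_tight_frame_if_segments_cyclic[of N e])
    show "0 < N" using N by simp
    show "e (k + N) = e k" for k by (simp add: e_def)
    have "(\<Sum>k<N. e k) = (\<Sum>k<N. x (Suc k) - x k)" by (intro sum.cong) (auto simp: e_def)
    also have "\<dots> = 0" using xN by (simp add: sum_lessThan_telescope)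
    finally show "(\<Sum>k<N. e k) = 0" .
    show "e k \<noteq> 0" for k by (rule e0)
    show "e (Suc k) \<noteq> - (c *\<^sub>R e k)" if c: "0 < c" for k c
    proof
      assume eq: "e (Suc k) = - (c *\<^sub>R e k)"
      let ?i = "Suc (k mod N)" and ?j = "Suc (Suc k mod N)"
      have "?i \<noteq> ?j" using N by (auto simp: mod_Suc split: if_splits)
      moreover have "?i \<in> {1..N}" "?j \<in> {1..N}" using modN by (auto simp: Suc_le_eq)
      ultimately have "finite (closed_segment (x (k mod N)) (x ?i) \<inter> closed_segment (x (Suc k mod N)) (x ?j))"
        using fin_Int[rule_format, of ?i ?j] by simp
      moreover have "(\<lambda>s. x ?i - s *\<^sub>R e k) ` {0..min 1 c} \<subseteq> closed_segment (x (k mod N)) (x ?i) \<inter> closed_segment (x (Suc k mod N)) (x ?j)"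
      proof (rule image_subsetI, rule IntI)
        fix s assume s: "s \<in> {0..min 1 c}"
        show "x ?i - s *\<^sub>R e k \<in> closed_segment (x (k mod N)) (x ?i)" using s by (intro c1) auto
        have "x ?i - s *\<^sub>R e k = x ?i + (s / c) *\<^sub>R e (Suc k)" using c by (simp add: eq)
        also have "\<dots> \<in> closed_segment (x (Suc k mod N)) (x ?j)" using s c by (intro c2) auto
        finally show "x ?i - s *\<^sub>R e k \<in> closed_segment (x (Suc k mod N)) (x ?j)" .
      qed
      ultimately have "finite ((\<lambda>s. x ?i - s *\<^sub>R e k) ` {0..min 1 c})" by (rule finite_subset[rotated])
      then have "finite {0..min 1 c}" by (rule finite_imageD) (simp add: inj_on_def e0)
      then show False using c infinite_Icc[of 0 "min 1 c"] by simp
    qed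
    show "\<exists>p. \<exists>v w. {v, w} = {e k, e (Suc k)} \<and> (\<forall>s\<in>{0..1}. p - s *\<^sub>R v \<in> E \<and> p + s *\<^sub>R w \<in> E)" for k
      by (rule exI[of _ "x (Suc (k mod N))"], rule exI[of _ "e k"], rule exI[of _ "e (Suc k)"])
         (use c1 c2 segE modN in blast)
  qed
qed

section \<open>Three segments from a point\<close>

text \<open>At \<open>x0\<close> one can walk in along any segment and out along any other, so every pair \<open>- v i\<close>, \<open>v j\<close> with
  \<open>i \<noteq> j\<close> is realised by a corner. The signs can be balanced: in the cyclic sequence
  \<open>v 1, - v 2, v 3, - v 1, v 2, - v 3\<close> consecutive vectors come from different segments with opposite
  signs, and the sum is zero. Pairwise distinct directions exclude reversals.\<close>

lemma not_tight_frame_three_segments: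
  assumes E: "compact E" "hausdorff1_outer E < top" and P: "three_segments_from_point P" "P \<subseteq> E"
  shows "\<not> tight_frame_spectral_measure (arc_length_measure E)"
proof -
  obtain x0 :: "real^2" and v :: "nat \<Rightarrow> real^2" where v0: "\<forall>k\<in>{1..3}. v k \<noteq> 0"
    and dir: "\<forall>i\<in>{1..3}. \<forall>j\<in>{1..3}. i \<noteq> j \<longrightarrow> \<not> (\<exists>c>0. v i = c *\<^sub>R v j)"
    and P_eq: "P = (\<Union>k\<in>{1..3}. (\<lambda>t. x0 + t *\<^sub>R v k) ` {0..1})"
    using P(1) unfolding three_segments_from_point_def by (elim exE conjE) (rule that)
  have seg: "x0 + s *\<^sub>R v k \<in> E" if "k \<in> {1..3}" "s \<in> {0..1}" for k s
    using P(2) that unfolding P_eq by blast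
  have pos: "0 < hausdorff1_outer E"
    by (rule segment_hausdorff1_pos[of "v 1" x0]) (use v0 seg in auto)
  interpret finite_arc_length E using E pos by unfold_locales
  define u where "u j = (if j = 0 then v 1 else if j = 1 then - v 2 else if j = 2 then v 3
      else if j = 3 then - v 1 else if j = 4 then v 2 else - v 3)" for j :: nat
  define e where "e k = u (k mod 6)" for k
  have cases6: "\<exists>i\<in>{1..3}. \<exists>j\<in>{1..3}. i \<noteq> j \<and> ((e k = v i \<and> e (Suc k) = - v j) \<or> (e k = - v i \<and> e (Suc k) = v j))" for k
  proof -
    have "k mod 6 < 6" by simp
    then consider "k mod 6 = 0" | "k mod 6 = 1" | "k mod 6 = 2" | "k mod 6 = 3" | "k mod 6 = 4" | "k mod 6 = 5" by linarith
    then show ?thesis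
    proof cases
      case 1 then show ?thesis by (intro bexI[of _ 1] bexI[of _ 2]) (auto simp: e_def u_def mod_Suc)
    next
      case 2 then show ?thesis by (intro bexI[of _ 2] bexI[of _ 3]) (auto simp: e_def u_def mod_Suc)
    next
      case 3 then show ?thesis by (intro bexI[of _ 3] bexI[of _ 1]) (auto simp: e_def u_def mod_Suc)
    next
      case 4 then show ?thesis by (intro bexI[of _ 1] bexI[of _ 2]) (auto simp: e_def u_def mod_Suc)
    next
      case 5 then show ?thesis by (intro bexI[of _ 2] bexI[of _ 3]) (auto simp: e_def u_def mod_Suc)
    next
      case 6 then show ?thesis by (intro bexI[of _ 3] bexI[of _ 1]) (auto simp: e_def u_def mod_Suc)
    qed
  qed
  show ?thesis
  proof (rule not_tight_frame_if_segments_cyclic[of 6 e])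
    show "e (k + 6) = e k" for k by (simp add: e_def)
    have "(\<Sum>k<6. e k) = e 0 + e 1 + e 2 + e 3 + e 4 + e 5" by (simp add: eval_nat_numeral)
    moreover have "e 0 = v 1" "e 1 = - v 2" "e 2 = v 3" "e 3 = - v 1" "e 4 = v 2" "e 5 = - v 3"
      by (simp_all add: e_def u_def)
    ultimately show "(\<Sum>k<6. e k) = 0" by simp
    show "e k \<noteq> 0" for k using cases6[of k] v0 by auto
    show "e (Suc k) \<noteq> - (c *\<^sub>R e k)" if c: "0 < c" for k c
    proof
      assume eq: "e (Suc k) = - (c *\<^sub>R e k)"
      obtain i j where ij: "i \<in> {1..3}" "j \<in> {1..3}" "i \<noteq> j"
        "(e k = v i \<and> e (Suc k) = - v j) \<or> (e k = - v i \<and> e (Suc k) = v j)"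
        using cases6[of k] by blast
      then have "v j = c *\<^sub>R v i" using eq by auto
      then show False using dir ij c by metis
    qed
    show "\<exists>p. \<exists>a b. {a, b} = {e k, e (Suc k)} \<and> (\<forall>s\<in>{0..1}. p - s *\<^sub>R a \<in> E \<and> p + s *\<^sub>R b \<in> E)" for k
    proof -
      obtain i j where ij: "i \<in> {1..3}" "j \<in> {1..3}"
        and "(e k = v i \<and> e (Suc k) = - v j) \<or> (e k = - v i \<and> e (Suc k) = v j)"
        using cases6[of k] by blast
      then have "{- v j, v i} = {e k, e (Suc k)} \<or> {- v i, v j} = {e k, e (Suc k)}" by auto
      moreover have "\<forall>s\<in>{0..1}. x0 - s *\<^sub>R (- v m) \<in> E \<and> x0 + s *\<^sub>R v n \<in> E"
        if "m \<in> {1..3}" "n \<in> {1..3}" for m n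
        using seg that by simp
      ultimately show ?thesis using ij by meson
    qed
  qed simp
qed

theorem corollary1:
  fixes E :: "(real^2) set"
  assumes "finite_union_of_smooth_curves E"
    and "\<exists>P\<subseteq>E. closed_polygonal_curve P \<or> three_segments_from_point P \<or>
           transverse_positive_curvature_curve P"
  shows "\<not> tight_frame_spectral_measure (arc_length_measure E)"
proof -
  have E: "compact E" "hausdorff1_outer E < top"
    using finite_union_of_smooth_curves_compact[OF assms(1)] by auto
  obtain P where P: "P \<subseteq> E" and "closed_polygonal_curve P \<or> three_segments_from_point P \<or>
           transverse_positive_curvature_curve P" using assms(2) by blast
  then consider "closed_polygonal_curve P" | "three_segments_from_point P" | "transverse_positive_curvature_curve P" by blast
  then show ?thesis
  proof cases
    case 1 then show ?thesis using not_tight_frame_polygon[OF E] P by blast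
  next
    case 2 then show ?thesis using not_tight_frame_three_segments[OF E] P by blast
  next
    case 3
    then obtain g L where "smooth_closed_curve g L" "positive_curvature g L" "P = g ` {0..L}"
      unfolding transverse_positive_curvature_curve_def by (elim exE conjE) (rule that)
    then show ?thesis using not_tight_frame_curve[OF E] P by blast
  qed
qed

end
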